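(* Let $G>0$, $\mathcal{K}>0$, $\delta_c>0$, $\kappa>0$ and $\nu\in(-1,1/2)$ be given, and let $\gamma>0$, $\beta\neq 0$ satisfy $\beta\le 3\frac{1-\nu}{1+\nu}\gamma$. (A) If $\gamma>2$ and $1<\beta\le\gamma$, then there exists a unique static self-gravitating polytropic elastic ball of type $\mathrm{A}$ with $\delta(0)=\delta_c$. (B) If $$\big(0<\gamma\le\beta<1\ \text{ or }\ \beta<\gamma\le 1\big)\quad\text{and}\quad \frac{4-3\gamma}{3(2-\gamma)}<\left(1-\frac{\beta}{3\gamma}\,\frac{1+\nu}{1-\nu}\right)^{1/\beta},$$ then there exists a unique static self-gravitating polytropic elastic ball of type $\mathrm{B}$ with $\delta(0)=\delta_c$. Moreover, in both cases $p_{\mathrm{tan}}(r)\ge p_{\mathrm{rad}}(r)$ for all $r\in[0,R]$, where $R$ is the radius of the ball.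
   Context: Constants: $G>0$ (Newton's constant), $\mathcal{K}>0$ (reference density), $\kappa>0$ (bulk modulus), $\nu$ (Poisson ratio), $\gamma>0$ (polytropic exponent), $\beta\ne0$ (shear exponent) with $\beta\le 3\frac{1-\nu}{1+\nu}\gamma$ (in the regimes of the theorem always $\beta\neq1$). Put $$y_{\mathrm b}=\left[1-\frac{\beta}{3\gamma}\frac{1+\nu}{1-\nu}\right]^{1/\beta}\in[0,1),\qquad \theta=\frac{4\pi G\mathcal{K}^2}{9\kappa}\,\frac{1+\nu}{1-\nu},$$ and, for $\delta,\eta,y>0$ and $\beta\ne1$, $$F_{\mathrm{rad}}(\delta,\eta)=3\kappa\frac{1-\nu}{1+\nu}\,\frac{(\delta/\eta)^\beta-y_{\mathrm b}^\beta}{\beta}\,\eta^\gamma,\qquad F_{\mathrm{tan}}(\delta,\eta)=F_{\mathrm{rad}}(\delta,\eta)+3\kappa(1-\delta/\eta)\,Q(\delta/\eta)\,\eta^\gamma,$$ $$Q(y)=\frac{3(\beta-\gamma)(1-\nu)}{2\beta(\beta-1)(1+\nu)}\,\frac{1-y^\beta}{1-y}+\frac{3(\gamma-1)(1-\nu)}{2(\beta-1)(1+\nu)}-\frac12$$ ($Q$ extended continuously to $y=1$). Static self-gravitating polytropic elastic ball. This is a triple $(\rho,p_{\mathrm{rad}},p_{\mathrm{tan}})$ of functions on $[0,\infty)$ for which there is $R\in(0,\infty)$ (the radius) such that: - $\rho,p_{\mathrm{rad}},p_{\mathrm{tan}}$ are positive on $[0,R)$, belong to $C^0([0,R])\cap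 C^1([0,R))$, and vanish for $r>R$; - $p_{\mathrm{rad}}(0)=p_{\mathrm{tan}}(0)$, and $\rho',p_{\mathrm{rad}}',p_{\mathrm{tan}}'\to0$ as $r\to0^+$; - the boundary condition $p_{\mathrm{rad}}(R)=0$ holds; - the equation of state holds on the ball: $\rho=\mathcal{K}\delta$, $p_{\mathrm{rad}}=F_{\mathrm{rad}}(\delta,\eta)$, $p_{\mathrm{tan}}=F_{\mathrm{tan}}(\delta,\eta)$, where $\eta(r)=\frac{3}{r^3}\int_0^r\delta(s)s^2\,ds$ (so $\eta(0)=\delta(0)$); - the equilibrium equation holds on $(0,R)$: $p_{\mathrm{rad}}'=\frac2r(p_{\mathrm{tan}}-p_{\mathrm{rad}})-G\rho\frac{m}{r^2}$, where $m(r)=4\pi\int_0^r\rho(s)s^2\,ds$. For the constitutive functions above, the equilibrium equation is equivalent to the system $$\delta'=\left(\frac{\delta}{\eta}\right)^{1-\beta}\left(\frac{3(\beta-\gamma)}{r}B(\delta/\eta)\,\eta-\theta r\,\eta^{2-\gamma}\delta\right),\qquad \eta'=-\frac3r(\eta-\delta),\qquad ( * )$$ where $B(y)=\frac{y+(\beta-1)y^{1+\beta}-\beta y^\beta}{\beta(\beta-1)}$ for $\beta\ne1$. A solution of $( * )$ on $[0,R)$ with $\delta(0)=\eta(0)=\delta_c>0$ is called strongly regular if $\delta\in C^1([0,R))$, $\delta>0$ on $[0,R)$ and $\lim_{r\to0^+}\delta'(r)=0$. Type. A static self-gravitating polytropic elastic ball is obtained by truncating, at the first radius $R$ at which $p_{\mathrm{rad}}=F_{\mathrm{rad}}(\delta,\eta)$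 vanishes, a strongly regular solution of $( * )$ with maximal interval of existence $[0,R_{\max})$. It is said to be of type $\mathrm{A}$ if $R_{\max}<\infty$ and of type $\mathrm{B}$ if $R_{\max}=\infty$. *)

theory Defs
  imports "HOL-Analysis.Analysis"
begin

section \<open>Constitutive functions\<close>

definition y_b :: "real \<Rightarrow> real \<Rightarrow> real \<Rightarrow> real" where
  "y_b \<nu> \<gamma> \<beta> = (1 - \<beta> / (3 * \<gamma>) * ((1 + \<nu>) / (1 - \<nu>))) powr (1 / \<beta>)"

definition theta :: "real \<Rightarrow> real \<Rightarrow> real \<Rightarrow> real \<Rightarrow> real" where
  "theta G K \<kappa> \<nu> = 4 * pi * G * K\<^sup>2 / (9 * \<kappa>) * ((1 + \<nu>) / (1 - \<nu>))"

definition F_rad :: "real \<Rightarrow> real \<Rightarrow> real \<Rightarrow> real \<Rightarrow> real \<Rightarrow> real \<Rightarrow> real" where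
  "F_rad \<kappa> \<nu> \<gamma> \<beta> d e =
     3 * \<kappa> * ((1 - \<nu>) / (1 + \<nu>)) * (((d / e) powr \<beta> - y_b \<nu> \<gamma> \<beta> powr \<beta>) / \<beta>) * e powr \<gamma>"

text \<open>The value at \<open>y = 1\<close> is the limit: the quotient \<open>(1 - y powr \<beta>) / (1 - y)\<close> tends to \<open>\<beta>\<close>.\<close>

definition Q :: "real \<Rightarrow> real \<Rightarrow> real \<Rightarrow> real \<Rightarrow> real" where
  "Q \<nu> \<gamma> \<beta> y =
     3 * (\<beta> - \<gamma>) * (1 - \<nu>) / (2 * \<beta> * (\<beta> - 1) * (1 + \<nu>)) *
       (if y = 1 then \<beta> else (1 - y powr \<beta>) / (1 - y))
     + 3 * (\<gamma> - 1) * (1 - \<nu>) / (2 * (\<beta> - 1) * (1 + \<nu>)) - 1 / 2"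

definition F_tan :: "real \<Rightarrow> real \<Rightarrow> real \<Rightarrow> real \<Rightarrow> real \<Rightarrow> real \<Rightarrow> real" where
  "F_tan \<kappa> \<nu> \<gamma> \<beta> d e =
     F_rad \<kappa> \<nu> \<gamma> \<beta> d e + 3 * \<kappa> * (1 - d / e) * Q \<nu> \<gamma> \<beta> (d / e) * e powr \<gamma>"

definition B :: "real \<Rightarrow> real \<Rightarrow> real" where
  "B \<beta> y = (y + (\<beta> - 1) * y powr (1 + \<beta>) - \<beta> * y powr \<beta>) / (\<beta> * (\<beta> - 1))"


section \<open>Static self-gravitating balls\<close>

text \<open>Class \<open>C\<^sup>1\<close> on a set of reals; at an endpoint belonging to the set the derivative is one-sided.
  (The library's \<open>C1_differentiable_on\<close> asks for two-sided derivatives.)\<close>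

definition C1_within :: "real set \<Rightarrow> (real \<Rightarrow> real) \<Rightarrow> bool" where
  "C1_within S f \<longleftrightarrow>
     (\<exists>f'. (\<forall>x\<in>S. (f has_real_derivative f' x) (at x within S)) \<and> continuous_on S f')"

definition mean_density :: "(real \<Rightarrow> real) \<Rightarrow> real \<Rightarrow> real" where
  "mean_density \<delta> r =
     (if r = 0 then \<delta> 0 else 3 / r ^ 3 * integral {0..r} (\<lambda>s. \<delta> s * s\<^sup>2))"

definition mass :: "(real \<Rightarrow> real) \<Rightarrow> real \<Rightarrow> real" where
  "mass \<rho> r = 4 * pi * integral {0..r} (\<lambda>s. \<rho> s * s\<^sup>2)"

text \<open>The functions of a ball are only meaningful on \<open>[0,\<infinity>)\<close>; their values at negative
  arguments are unconstrained. The equation of state is stated on \<open>[0,R)\<close>, where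
  both arguments of \<open>F_rad\<close> and \<open>F_tan\<close> are positive; the boundary values at \<open>R\<close>
  are then determined by continuity on \<open>[0,R]\<close>.\<close>

definition static_ball ::
  "real \<Rightarrow> real \<Rightarrow> real \<Rightarrow> real \<Rightarrow> real \<Rightarrow> real \<Rightarrow>
   real \<Rightarrow> (real \<Rightarrow> real) \<Rightarrow> (real \<Rightarrow> real) \<Rightarrow> (real \<Rightarrow> real) \<Rightarrow> bool" where
  "static_ball G K \<kappa> \<nu> \<gamma> \<beta> R \<rho> p_rad p_tan \<longleftrightarrow>
     0 < R \<and>
     (\<forall>f\<in>{\<rho>, p_rad, p_tan}.
        (\<forall>r\<in>{0..<R}. 0 < f r) \<and>
        continuous_on {0..R} f \<and>
        C1_within {0..<R} f \<and>
        (deriv f \<longlongrightarrow> 0) (at_right 0) \<and>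
        (\<forall>r>R. f r = 0)) \<and>
     p_rad 0 = p_tan 0 \<and>
     p_rad R = 0 \<and>
     (\<exists>\<delta> \<eta>. \<forall>r\<in>{0..<R}.
        \<rho> r = K * \<delta> r \<and>
        \<eta> r = mean_density \<delta> r \<and>
        p_rad r = F_rad \<kappa> \<nu> \<gamma> \<beta> (\<delta> r) (\<eta> r) \<and>
        p_tan r = F_tan \<kappa> \<nu> \<gamma> \<beta> (\<delta> r) (\<eta> r)) \<and>
     (\<forall>r\<in>{0<..<R}.
        (p_rad has_real_derivative
           2 / r * (p_tan r - p_rad r) - G * \<rho> r * (mass \<rho> r / r\<^sup>2)) (at r))"


section \<open>Strongly regular solutions and the type of a ball\<close>

text \<open>The interval \<open>[0,R)\<close>, where \<open>R\<close> may be infinite.\<close>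

definition radii :: "ereal \<Rightarrow> real set" where
  "radii R = {r. 0 \<le> r \<and> ereal r < R}"

definition strongly_regular_solution ::
  "real \<Rightarrow> real \<Rightarrow> real \<Rightarrow> real \<Rightarrow> real \<Rightarrow> real \<Rightarrow>
   ereal \<Rightarrow> (real \<Rightarrow> real) \<Rightarrow> (real \<Rightarrow> real) \<Rightarrow> bool" where
  "strongly_regular_solution G K \<kappa> \<nu> \<gamma> \<beta> R \<delta> \<eta> \<longleftrightarrow>
     0 < R \<and>
     \<delta> 0 = \<eta> 0 \<and>
     (\<forall>r\<in>radii R. 0 < \<delta> r) \<and>
     C1_within (radii R) \<delta> \<and>
     (deriv \<delta> \<longlongrightarrow> 0) (at_right 0) \<and>
     continuous_on (radii R) \<eta> \<and>
     (\<forall>r\<in>radii R - {0}.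
        (\<delta> has_real_derivative
           (\<delta> r / \<eta> r) powr (1 - \<beta>) *
             (3 * (\<beta> - \<gamma>) / r * B \<beta> (\<delta> r / \<eta> r) * \<eta> r
              - theta G K \<kappa> \<nu> * r * \<eta> r powr (2 - \<gamma>) * \<delta> r)) (at r) \<and>
        (\<eta> has_real_derivative - (3 / r) * (\<eta> r - \<delta> r)) (at r))"

definition maximal_solution ::
  "real \<Rightarrow> real \<Rightarrow> real \<Rightarrow> real \<Rightarrow> real \<Rightarrow> real \<Rightarrow>
   ereal \<Rightarrow> (real \<Rightarrow> real) \<Rightarrow> (real \<Rightarrow> real) \<Rightarrow> bool" where
  "maximal_solution G K \<kappa> \<nu> \<gamma> \<beta> R_max \<delta> \<eta> \<longleftrightarrow>
     strongly_regular_solution G K \<kappa> \<nu> \<gamma> \<beta> R_max \<delta> \<eta> \<and>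
     \<not> (\<exists>R' \<delta>' \<eta>'. R_max < R' \<and>
          strongly_regular_solution G K \<kappa> \<nu> \<gamma> \<beta> R' \<delta>' \<eta>' \<and>
          (\<forall>r\<in>radii R_max. \<delta>' r = \<delta> r \<and> \<eta>' r = \<eta> r))"

definition truncation ::
  "real \<Rightarrow> real \<Rightarrow> real \<Rightarrow> real \<Rightarrow> real \<Rightarrow>
   ereal \<Rightarrow> (real \<Rightarrow> real) \<Rightarrow> (real \<Rightarrow> real) \<Rightarrow>
   real \<Rightarrow> (real \<Rightarrow> real) \<Rightarrow> (real \<Rightarrow> real) \<Rightarrow> (real \<Rightarrow> real) \<Rightarrow> bool" where
  "truncation K \<kappa> \<nu> \<gamma> \<beta> R_max \<delta> \<eta> R \<rho> p_rad p_tan \<longleftrightarrow>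
     R \<in> radii R_max \<and>
     F_rad \<kappa> \<nu> \<gamma> \<beta> (\<delta> R) (\<eta> R) = 0 \<and>
     (\<forall>r\<in>{0..<R}. F_rad \<kappa> \<nu> \<gamma> \<beta> (\<delta> r) (\<eta> r) \<noteq> 0) \<and>
     (\<forall>r\<in>{0..R}.
        \<rho> r = K * \<delta> r \<and>
        p_rad r = F_rad \<kappa> \<nu> \<gamma> \<beta> (\<delta> r) (\<eta> r) \<and>
        p_tan r = F_tan \<kappa> \<nu> \<gamma> \<beta> (\<delta> r) (\<eta> r)) \<and>
     (\<forall>r>R. \<rho> r = 0 \<and> p_rad r = 0 \<and> p_tan r = 0)"

definition static_ball_type_A ::
  "real \<Rightarrow> real \<Rightarrow> real \<Rightarrow> real \<Rightarrow> real \<Rightarrow> real \<Rightarrow>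
   real \<Rightarrow> (real \<Rightarrow> real) \<Rightarrow> (real \<Rightarrow> real) \<Rightarrow> (real \<Rightarrow> real) \<Rightarrow> bool" where
  "static_ball_type_A G K \<kappa> \<nu> \<gamma> \<beta> R \<rho> p_rad p_tan \<longleftrightarrow>
     static_ball G K \<kappa> \<nu> \<gamma> \<beta> R \<rho> p_rad p_tan \<and>
     (\<exists>R_max \<delta> \<eta>. maximal_solution G K \<kappa> \<nu> \<gamma> \<beta> R_max \<delta> \<eta> \<and>
        truncation K \<kappa> \<nu> \<gamma> \<beta> R_max \<delta> \<eta> R \<rho> p_rad p_tan \<and> R_max < \<infinity>)"

definition static_ball_type_B ::
  "real \<Rightarrow> real \<Rightarrow> real \<Rightarrow> real \<Rightarrow> real \<Rightarrow> real \<Rightarrow>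
   real \<Rightarrow> (real \<Rightarrow> real) \<Rightarrow> (real \<Rightarrow> real) \<Rightarrow> (real \<Rightarrow> real) \<Rightarrow> bool" where
  "static_ball_type_B G K \<kappa> \<nu> \<gamma> \<beta> R \<rho> p_rad p_tan \<longleftrightarrow>
     static_ball G K \<kappa> \<nu> \<gamma> \<beta> R \<rho> p_rad p_tan \<and>
     (\<exists>R_max \<delta> \<eta>. maximal_solution G K \<kappa> \<nu> \<gamma> \<beta> R_max \<delta> \<eta> \<and>
        truncation K \<kappa> \<nu> \<gamma> \<beta> R_max \<delta> \<eta> R \<rho> p_rad p_tan \<and> R_max = \<infinity>)"

text \<open>There is exactly one triple of functions on \<open>[0,\<infinity>)\<close> which together with some
  radius satisfies \<open>P\<close>. Plain \<open>\<exists>!\<close> would fail because of the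
  unconstrained values at negative arguments.\<close>

definition unique_ball ::
  "(real \<Rightarrow> (real \<Rightarrow> real) \<Rightarrow> (real \<Rightarrow> real) \<Rightarrow> (real \<Rightarrow> real) \<Rightarrow> bool) \<Rightarrow> bool" where
  "unique_ball P \<longleftrightarrow>
     (\<exists>R \<rho> p_rad p_tan. P R \<rho> p_rad p_tan) \<and>
     (\<forall>R \<rho> p_rad p_tan R' \<rho>' p_rad' p_tan'.
        P R \<rho> p_rad p_tan \<and> P R' \<rho>' p_rad' p_tan' \<longrightarrow>
        (\<forall>r\<ge>0. \<rho> r = \<rho>' r \<and> p_rad r = p_rad' r \<and> p_tan r = p_tan' r))"

end

theory Submission
  imports Defs
begin

text \<open>
  Write \<open>y = \<delta> / \<eta>\<close>, \<open>p = - ln y\<close> and \<open>u = \<theta> r\<^sup>2 \<eta> powr (2 - \<gamma>)\<close>. In these variables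
  the equations for a ball become an autonomous planar system in \<open>ln r\<close>:
  \<open>r p' = u exp ((\<beta> - 1) p) - \<Phi> p\<close> and \<open>r u' = u (2 - 3 (2 - \<gamma>) (1 - y))\<close>, where \<open>\<Phi> p = 3 p\<close> up to
  second order. The centre of a ball is the saddle point \<open>p = u = 0\<close>, whose eigenvalues are
  \<open>-3\<close> and \<open>2\<close>; the strongly regular solutions form its one-dimensional unstable manifold, and the
  central density merely selects the parametrisation. This is why the ball is unique.

  The rest of the theorem is read off the two equations. At \<open>p = 0\<close> one has \<open>r p' = u > 0\<close>, so \<open>y < 1\<close>
  away from the centre (\<open>log_ratio_pos\<close>). The radial pressure is positive exactly while \<open>y > y_b\<close>.
  As long as this holds, \<open>u\<close> grows at least like a positive power of \<open>r\<close>: for \<open>\<gamma> > 2\<close> because both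
  terms of its growth rate are then positive, and for \<open>\<gamma> \<le> 1\<close> because the lower bound on \<open>y_b\<close> says
  precisely that the rate at \<open>y = y_b\<close> is positive. Since \<open>\<Phi>\<close> is bounded for bounded \<open>p\<close>, the
  pull \<open>u\<close> eventually wins and \<open>p\<close> reaches the surface value \<open>- ln y_b\<close> (\<open>log_ratio_reaches\<close>).
  Beyond the surface the sign of \<open>\<beta> - 1\<close> decides: for \<open>\<beta> > 1\<close> the quantity \<open>y powr (\<beta> - 1)\<close> satisfies
  \<open>r (y powr (\<beta> - 1))' \<le> (\<beta> - 1) (3 - u)\<close> and would become negative at a finite radius
  (\<open>R_sup_finite\<close>, type A), while for \<open>\<beta> < 1\<close> the factor \<open>exp ((\<beta> - 1) p)\<close> damps the pull, so that
  \<open>p\<close> stays bounded at finite radii and the solution is global (\<open>R_sup_infinite\<close>, type B).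

  The tangential excess \<open>p_tan - p_rad\<close> is \<open>3 \<kappa> \<eta> powr \<gamma>\<close> times a combination of \<open>1 - y powr \<beta>\<close> and
  \<open>1 - y\<close>; comparing the power with its tangent at \<open>y = 1\<close>, or with \<open>y\<close> itself, shows that the combination is
  nonnegative (\<open>anisotropy_coefficients_nonneg\<close>).

  The analytic work lies in the singular centre. With \<open>v = p / r\<^sup>2\<close> and
  \<open>k = (ln \<delta>\<^sub>c - ln \<delta>) / r\<^sup>2\<close> the system reads \<open>r v' + 5 v = F\<^sub>1 r v k\<close>, \<open>r k' + 2 k = F\<^sub>2 r v k\<close>, and the
  Lipschitz constants of \<open>F\<^sub>1\<close>, \<open>F\<^sub>2\<close> for bounded \<open>v\<close>, \<open>k\<close> are \<open>O(r)\<close>, because only second-order terms in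
  \<open>r\<^sup>2 v\<close> are left on the right. Solutions continuous at \<open>0\<close> are the fixed points
  \<open>v r = integral {0..1} (\<lambda>t. t\<^sup>4 F\<^sub>1 (r t) ...)\<close>, and the factor \<open>r\<close> makes this map a contraction for the norm
  weighted by \<open>exp (\<lambda> r)\<close>, on an interval of any length once the nonlinearity is clipped
  (\<open>coupled_averages_exist\<close>, \<open>scaled_solution_unique\<close>). L'Hopital's rule shows that every strongly
  regular solution arises in this way (\<open>regular_imp_scaled\<close>).
\<close>

section \<open>Fixed points of Volterra type\<close>

lemma continuous_on_Icc_norm_bound:
  fixes f :: "real \<Rightarrow> 'a::real_normed_vector"
  assumes "continuous_on {a..b} f"
  obtains M where "0 \<le> M" "\<And>s. s \<in> {a..b} \<Longrightarrow> norm (f s) \<le> M"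
proof -
  have "bounded (f ` {a..b})"
    by (intro compact_imp_bounded compact_continuous_image assms) auto
  then obtain M where "\<forall>x\<in>f ` {a..b}. norm x \<le> M" by (auto simp: bounded_iff)
  then have "norm (f s) \<le> max M 0" if "s \<in> {a..b}" for s
    using that by (meson image_eqI max.coboundedI1)
  then show ?thesis using that[of "max M 0"] by simp
qed

text \<open>Both the proof of \<open>y < 1\<close> and the choice of the surface of the ball look at the first radius where a
positive function vanishes.\<close>

lemma first_zero:
  fixes f :: "real \<Rightarrow> real"
  assumes f: "continuous_on {a..b} f" "0 < f a" "f b \<le> 0" and ab: "a \<le> b"
  obtains m where "a < m" "m \<le> b" "f m = 0" "\<And>x. x \<in> {a..<m} \<Longrightarrow> 0 < f x"
proof -
  define S where "S = {x \<in> {a..b}. f x \<le> 0}"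
  have S: "closed S" "S \<noteq> {}" "bdd_below S"
  proof -
    have "closed ({a..b} \<inter> f -` {..0})" using f by (intro continuous_closed_preimage) auto
    moreover have "{a..b} \<inter> f -` {..0} = S" by (auto simp: S_def)
    ultimately show "closed S" by simp
  qed (use f ab in \<open>auto simp: S_def intro!: bdd_belowI[of _ a]\<close>)
  define m where "m = Inf S"
  have m: "m \<in> S" unfolding m_def using S by (intro closed_contains_Inf)
  have least: "m \<le> x" if "x \<in> S" for x unfolding m_def using that S by (intro cInf_lower)
  have am: "a < m" using m f(2) by (auto simp: S_def less_le)
  have "continuous_on {a..m} f" using f(1) m by (auto simp: S_def elim: continuous_on_subset)
  then obtain x where x: "a \<le> x" "x \<le> m" "f x = 0"
    using IVT2'[of f m 0 a] m f(2) by (auto simp: S_def)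
  then have "x = m" using least[of x] m by (auto simp: S_def)
  moreover have "0 < f x" if "x \<in> {a..<m}" for x
    using least[of x] that m by (force simp: S_def)
  ultimately show ?thesis using that[of m] am m x by (auto simp: S_def)
qed

lemma continuous_on_strict_bound_persists:
  fixes f :: "real \<Rightarrow> real"
  assumes f: "continuous_on {0..X} f" and Y: "0 \<le> Y" "Y < X" and bd: "\<And>r. r \<in> {0..Y} \<Longrightarrow> \<bar>f r\<bar> < V"
  obtains Z where "Y < Z" "Z \<le> X" "\<And>r. r \<in> {0..<Z} \<Longrightarrow> \<bar>f r\<bar> < V"
proof -
  have "((\<lambda>r. \<bar>f r\<bar>) \<longlongrightarrow> \<bar>f Y\<bar>) (at Y within {0..X})"
    using f Y by (intro tendsto_intros) (auto simp: continuous_on_def)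
  then have "eventually (\<lambda>r. \<bar>f r\<bar> < V) (at Y within {0..X})"
    using bd[of Y] Y by (auto dest: order_tendstoD)
  then obtain e where e: "0 < e" "\<And>r. r \<in> {0..X} \<Longrightarrow> r \<noteq> Y \<Longrightarrow> dist r Y < e \<Longrightarrow> \<bar>f r\<bar> < V"
    unfolding eventually_at by blast
  show ?thesis
  proof (rule that[of "min X (Y + e)"])
    fix r assume r: "r \<in> {0..<min X (Y + e)}"
    then show "\<bar>f r\<bar> < V" using bd[of r] e(2)[of r] by (cases "r \<le> Y") (auto simp: dist_real_def)
  qed (use Y e in auto)
qed

text \<open>The hypothesis on \<open>T\<close> says that it halves distances in the sup norm weighted by \<open>1 / E\<close>. It is phrased
through pointwise bounds; the increments of the iterates of \<open>0\<close> are dominated by a geometric series.\<close>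

lemma volterra_fixed_point_exists:
  fixes T :: "(real \<Rightarrow> 'a::banach) \<Rightarrow> real \<Rightarrow> 'a" and E :: "real \<Rightarrow> real"
  assumes cont: "\<And>w. continuous_on {0..X} w \<Longrightarrow> continuous_on {0..X} (T w)"
    and E: "continuous_on {0..X} E" "\<And>s. s \<in> {0..X} \<Longrightarrow> 1 \<le> E s"
    and contr: "\<And>w1 w2 a. \<lbrakk>continuous_on {0..X} w1; continuous_on {0..X} w2;
        \<And>s. s \<in> {0..X} \<Longrightarrow> norm (w1 s - w2 s) \<le> a * E s\<rbrakk>
        \<Longrightarrow> (\<And>s. s \<in> {0..X} \<Longrightarrow> norm (T w1 s - T w2 s) \<le> a / 2 * E s)"
  shows "\<exists>w. continuous_on {0..X} w \<and> (\<forall>s\<in>{0..X}. w s = T w s)"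
proof -
  define W where "W n = (T ^^ n) (\<lambda>_. 0)" for n
  have W0: "W 0 = (\<lambda>_. 0)" and WS: "W (Suc n) = T (W n)" for n
    by (simp_all add: W_def)
  have Wc: "continuous_on {0..X} (W n)" for n
    by (induction n) (simp_all add: W0 WS cont)
  obtain M' where M'0: "0 \<le> M'" and M: "\<And>s. s \<in> {0..X} \<Longrightarrow> norm (W 1 s) \<le> M'"
    using continuous_on_Icc_norm_bound[OF Wc] by blast
  have M': "norm (W 1 s) \<le> M' * E s" if "s \<in> {0..X}" for s
  proof -
    have "norm (W 1 s) \<le> M' * 1" using M[OF that] by simp
    also have "\<dots> \<le> M' * E s" using E(2)[OF that] by (intro mult_left_mono) (auto simp: M'0)
    finally show ?thesis .
  qed
  have step: "norm (W (Suc n) s - W n s) \<le> M' / 2 ^ n * E s" if "s \<in> {0..X}" for n s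
    using that
  proof (induction n arbitrary: s)
    case 0
    then show ?case using M' by (simp add: W0)
  next
    case (Suc n)
    have "norm (T (W (Suc n)) s - T (W n) s) \<le> M' / 2 ^ n / 2 * E s"
      by (rule contr[OF Wc Wc Suc.IH Suc.prems])
    then show ?case by (simp add: WS field_simps)
  qed
  obtain e where e: "\<And>s. s \<in> {0..X} \<Longrightarrow> norm (E s) \<le> e"
    using continuous_on_Icc_norm_bound[OF E(1)] by blast
  have "uniform_limit {0..X} (\<lambda>n s. \<Sum>i<n. W (Suc i) s - W i s)
          (\<lambda>s. suminf (\<lambda>i. W (Suc i) s - W i s)) sequentially"
  proof (rule Weierstrass_m_test)
    fix n s assume s: "s \<in> {0..X}"
    have "M' / 2 ^ n * E s \<le> M' / 2 ^ n * e"
      using e[OF s] M'0 by (intro mult_left_mono) auto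
    then show "norm (W (Suc n) s - W n s) \<le> M' * e * (1 / 2) ^ n"
      using step[OF s, of n] by (simp add: field_simps)
  qed (intro summable_mult summable_geometric, simp)
  moreover have "(\<Sum>i<n. W (Suc i) s - W i s) = W n s" for n s
    using sum_lessThan_telescope[of "\<lambda>i. W i s" n] by (simp add: W0)
  ultimately obtain w where lim: "uniform_limit {0..X} W w sequentially" by auto
  have wc: "continuous_on {0..X} w"
    by (rule uniform_limit_theorem[OF _ lim]) (simp_all add: Wc)
  have "w s = T w s" if s: "s \<in> {0..X}" for s
  proof -
    have "(\<lambda>n. W (Suc n) s) \<longlonglongrightarrow> w s"
      using tendsto_uniform_limitI[OF lim s] by (rule LIMSEQ_Suc)
    moreover have "(\<lambda>n. W (Suc n) s) \<longlonglongrightarrow> T w s"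
    proof (rule metric_LIMSEQ_I)
      fix r :: real assume r: "0 < r"
      define q where "q = r / E s"
      have q: "0 < q" using r E(2)[OF s] by (simp add: q_def)
      obtain N where N: "\<And>n x. n \<ge> N \<Longrightarrow> x \<in> {0..X} \<Longrightarrow> dist (W n x) (w x) < q"
        using uniform_limitD[OF lim q] unfolding eventually_sequentially by metis
      have "dist (W (Suc n) s) (T w s) < r" if n: "n \<ge> N" for n
      proof -
        have "norm (T (W n) s - T w s) \<le> q / 2 * E s"
        proof (rule contr[OF Wc wc _ s])
          fix x assume x: "x \<in> {0..X}"
          have "q * 1 \<le> q * E x" using q E(2)[OF x] by (intro mult_left_mono) auto
          then show "norm (W n x - w x) \<le> q * E x"
            using N[OF n x] by (simp add: dist_norm)
        qed
        also have "\<dots> < r" using r E(2)[OF s] by (simp add: q_def)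
        finally show ?thesis by (simp add: WS dist_norm)
      qed
      then show "\<exists>N. \<forall>n\<ge>N. dist (W (Suc n) s) (T w s) < r" by blast
    qed
    ultimately show ?thesis by (rule LIMSEQ_unique)
  qed
  with wc show ?thesis by blast
qed

text \<open>The contraction is only required for the two fixed points at hand, because their equations
may be known on a shorter interval than the one on which \<open>T\<close> acts.\<close>

lemma volterra_fixed_point_unique:
  fixes T :: "(real \<Rightarrow> 'a::real_normed_vector) \<Rightarrow> real \<Rightarrow> 'a" and E :: "real \<Rightarrow> real"
  assumes E: "\<And>s. s \<in> {0..Y} \<Longrightarrow> 1 \<le> E s"
    and w: "continuous_on {0..Y} w1" "continuous_on {0..Y} w2"
    and contr: "\<And>a. (\<And>s. s \<in> {0..Y} \<Longrightarrow> norm (w1 s - w2 s) \<le> a * E s)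
        \<Longrightarrow> (\<And>s. s \<in> {0..Y} \<Longrightarrow> norm (T w1 s - T w2 s) \<le> a / 2 * E s)"
    and fix1: "\<And>s. s \<in> {0..Y} \<Longrightarrow> w1 s = T w1 s" and fix2: "\<And>s. s \<in> {0..Y} \<Longrightarrow> w2 s = T w2 s"
    and s: "s \<in> {0..Y}"
  shows "w1 s = w2 s"
proof -
  have "continuous_on {0..Y} (\<lambda>s. w1 s - w2 s)" by (intro continuous_intros w)
  then obtain M where M0: "0 \<le> M" and M: "\<And>s. s \<in> {0..Y} \<Longrightarrow> norm (w1 s - w2 s) \<le> M"
    using continuous_on_Icc_norm_bound by blast
  have step: "norm (w1 s - w2 s) \<le> M / 2 ^ n * E s" if "s \<in> {0..Y}" for n s
    using that
  proof (induction n arbitrary: s)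
    case 0
    have "M * 1 \<le> M * E s" using E[OF 0] M0 by (intro mult_left_mono)
    then show ?case using M[OF 0] by simp
  next
    case (Suc n)
    have "norm (T w1 s - T w2 s) \<le> M / 2 ^ n / 2 * E s"
      by (rule contr[OF Suc.IH Suc.prems])
    then show ?case using fix1[OF Suc.prems] fix2[OF Suc.prems] by (simp add: field_simps)
  qed
  have "(\<lambda>n. (M * E s) * (1 / 2) ^ n) \<longlonglongrightarrow> (M * E s) * 0"
    by (intro tendsto_intros LIMSEQ_power_zero) simp
  then have "norm (w1 s - w2 s) \<le> (M * E s) * 0"
    by (rule LIMSEQ_le_const) (use step[OF s] in \<open>auto simp: field_simps\<close>)
  then show ?thesis by simp
qed

section \<open>Weighted averages and the equation with a regular singular point\<close>

text \<open>Up to solutions singular at the origin, \<open>power_avg n\<close> inverts the operator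
\<open>v \<mapsto> r v' + (n + 1) v\<close>. Averaging over \<open>[0,1]\<close> instead of integrating over \<open>[0,r]\<close> makes sense at
\<open>r = 0\<close> without a case distinction and shows continuity there.\<close>

definition power_avg :: "nat \<Rightarrow> (real \<Rightarrow> real) \<Rightarrow> real \<Rightarrow> real" where
  "power_avg n f r = integral {0..1} (\<lambda>t. t ^ n * f (r * t))"

lemma stretch_mem: "0 \<le> r \<Longrightarrow> r \<le> X \<Longrightarrow> 0 \<le> t \<Longrightarrow> t \<le> 1 \<Longrightarrow> r * t \<in> {0..X::real}"
  by (auto intro: order_trans[OF mult_left_le])

lemma power_avg_integrand_continuous:
  fixes f :: "real \<Rightarrow> real"
  assumes f: "continuous_on {0..X} f" and r: "r \<in> {0..X}"
  shows "continuous_on {0..1} (\<lambda>t. t ^ n * f (r * t))"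
proof (intro continuous_intros continuous_on_compose2[OF f])
  show "(*) r ` {0..1} \<subseteq> {0..X}" using r stretch_mem[of r X] by auto
qed

lemma continuous_on_power_avg:
  assumes f: "continuous_on {0..X} f"
  shows "continuous_on {0..X} (power_avg n f)"
proof -
  have "continuous_on ({0..X} \<times> cbox 0 1) (\<lambda>(r, t). t ^ n * f (r * t))"
    unfolding split_beta
  proof (intro continuous_intros continuous_on_compose2[OF f])
    show "(\<lambda>x. fst x * snd x) ` ({0..X} \<times> cbox 0 1) \<subseteq> {0..X}" using stretch_mem[of _ X] by force
  qed
  from integral_continuous_on_param[OF this]
  show ?thesis by (simp add: power_avg_def[abs_def])
qed

lemma power_avg_eq_integral:
  assumes r: "0 < r"
  shows "r ^ Suc n * power_avg n f r = integral {0..r} (\<lambda>s. s ^ n * f s)"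
proof -
  have "integral ((\<lambda>x. x / r) ` {0..r}) (\<lambda>t. (r * t) ^ n * f (r * t))
      = (1 / \<bar>r\<bar>) *\<^sub>R integral {0..r} (\<lambda>s. s ^ n * f s)"
    using integral_stretch_real[of r 0 r "\<lambda>s. s ^ n * f s"] r by simp
  moreover have "(\<lambda>x. x / r) ` {0..r} = {0..1}"
    using r by (auto simp: image_iff intro!: bexI[of _ "r * _"] mult_left_le)
  moreover have "integral {0..1} (\<lambda>t. (r * t) ^ n * f (r * t)) = r ^ n * power_avg n f r"
    by (simp add: power_avg_def power_mult_distrib mult.assoc)
  ultimately show ?thesis using r by (simp add: field_simps)
qed

lemma power_avg_zero: "power_avg n f 0 = f 0 / real (Suc n)"
proof -
  have "((\<lambda>t::real. t ^ n) has_integral (1 / Suc n)) {0..1}"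
  proof -
    have "((\<lambda>t. t ^ Suc n / real (Suc n)) has_real_derivative t ^ n) (at t within {0..1})" for t :: real
      using DERIV_cdivide[OF DERIV_pow[of "Suc n" t "{0..1}"], of "real (Suc n)"]
      by (simp del: of_nat_Suc power_Suc)
    then show ?thesis
      using fundamental_theorem_of_calculus[of 0 1 "\<lambda>t::real. t ^ Suc n / Suc n" "\<lambda>t. t ^ n"]
      by (simp add: has_real_derivative_iff_has_vector_derivative)
  qed
  then have "((\<lambda>t::real. t ^ n * f 0) has_integral (1 / Suc n * f 0)) {0..1}"
    by (rule has_integral_mult_left)
  then have "integral {0..1} (\<lambda>t. t ^ n * f 0) = 1 / Suc n * f 0" by (rule integral_unique)
  then show ?thesis by (simp add: power_avg_def)
qed

lemma power_avg_DERIV: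
  assumes f: "continuous_on {0..X} f" and r: "0 < r" "r < X"
  shows "(power_avg n f has_real_derivative (f r - real (Suc n) * power_avg n f r) / r) (at r)"
proof -
  define I where "I x = integral {0..x} (\<lambda>s. s ^ n * f s)" for x
  have "(I has_real_derivative r ^ n * f r) (at r within {0..X})"
    unfolding I_def
    by (rule integral_has_real_derivative) (use r f in \<open>auto intro!: continuous_intros\<close>)
  then have I: "(I has_real_derivative r ^ n * f r) (at r)"
    using r by (simp add: at_within_Icc_at)
  have Ir: "I r = r ^ Suc n * power_avg n f r"
    using power_avg_eq_integral[OF r(1)] by (simp add: I_def)
  have "((\<lambda>x. I x / x ^ Suc n) has_real_derivative
      (r ^ n * f r * r ^ Suc n - I r * (real (Suc n) * r ^ n)) / (r ^ Suc n * r ^ Suc n)) (at r)"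
    using DERIV_pow[of "Suc n" r] r
    by (intro DERIV_divide I) (auto)
  moreover have "(r ^ n * f r * r ^ Suc n - I r * (real (Suc n) * r ^ n)) / (r ^ Suc n * r ^ Suc n)
      = (f r - real (Suc n) * power_avg n f r) / r"
    unfolding Ir using r by (simp add: divide_simps) (simp add: algebra_simps)
  ultimately have "((\<lambda>x. I x / x ^ Suc n) has_real_derivative
      (f r - real (Suc n) * power_avg n f r) / r) (at r)" by simp
  then show ?thesis
  proof (rule has_field_derivative_transform_within_open[of _ _ _ "{0<..}"])
    fix x :: real assume "x \<in> {0<..}"
    then show "I x / x ^ Suc n = power_avg n f x"
      using power_avg_eq_integral[of x n f] by (simp add: I_def field_simps)
  qed (use r in auto)
qed

text \<open>The homogeneous solutions are multiples of \<open>1 / r ^ Suc n\<close>; continuity at \<open>0\<close> rules them out,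
so the equation determines \<open>v 0\<close> as well.\<close>

lemma power_avg_unique:
  assumes f: "continuous_on {0..Y} f" and v: "continuous_on {0..Y} v"
    and ode: "\<And>r. 0 < r \<Longrightarrow> r < Y \<Longrightarrow> (v has_real_derivative (f r - real (Suc n) * v r) / r) (at r)"
    and Y: "0 < Y" and r: "r \<in> {0..Y}"
  shows "v r = power_avg n f r"
proof -
  define D where "D x = x ^ Suc n * (v x - power_avg n f x)" for x
  have Dc: "continuous_on {0..Y} D"
    unfolding D_def by (intro continuous_intros v continuous_on_power_avg f)
  have D': "(D has_real_derivative 0) (at x)" if "0 < x" "x < Y" for x
  proof -
    have "(D has_real_derivative
        real (Suc n) * x ^ n * (v x - power_avg n f x)
        + ((f x - real (Suc n) * v x) / x - (f x - real (Suc n) * power_avg n f x) / x) * x ^ Suc n) (at x)"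
      unfolding D_def using that DERIV_pow[of "Suc n" x]
      by (intro DERIV_mult DERIV_diff ode power_avg_DERIV[OF f]) auto
    moreover have "real (Suc n) * x ^ n * (v x - power_avg n f x)
        + ((f x - real (Suc n) * v x) / x - (f x - real (Suc n) * power_avg n f x) / x) * x ^ Suc n = 0"
      using that by (simp add: divide_simps) (simp add: algebra_simps)
    ultimately show ?thesis by simp
  qed
  have D0: "D x = 0" if "x \<in> {0..Y}" for x
    using DERIV_isconst2[OF Y Dc D', of x] that by (simp add: D_def)
  have pos: "v x = power_avg n f x" if "x \<in> {0<..Y}" for x
    using D0[of x] that by (simp add: D_def)
  \<comment> \<open>the weight \<open>x ^ Suc n\<close> vanishes at 0, where equality follows by continuity\<close>
  show ?thesis
  proof (cases "r = 0")
    case True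
    have "((\<lambda>x. v x - power_avg n f x) \<longlongrightarrow> v 0 - power_avg n f 0) (at 0 within {0..Y})"
      using Y v continuous_on_power_avg[OF f, of n]
      by (intro tendsto_diff) (auto simp: continuous_on_def)
    moreover have "((\<lambda>x. v x - power_avg n f x) \<longlongrightarrow> 0) (at 0 within {0..Y})"
      by (rule tendsto_eventually) (auto simp: eventually_at_filter pos)
    moreover have "at 0 within {0..Y} \<noteq> bot" using Y by (simp add: at_within_Icc_at_right)
    ultimately have "v 0 - power_avg n f 0 = 0" using tendsto_unique by blast
    then show ?thesis using True by simp
  next
    case False
    then show ?thesis using pos r by simp
  qed
qed

text \<open>The factor \<open>s\<close> in the hypothesis is essential: it turns the average into an integral,
\<open>integral {0..1} (\<lambda>t. r exp (lam (r t))) \<le> exp (lam r) / lam\<close>, and so yields the small factor \<open>1 / lam\<close>.\<close>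

lemma power_avg_weighted_contraction:
  assumes f: "continuous_on {0..Y} f" and g: "continuous_on {0..Y} g"
    and r: "r \<in> {0..Y}" and lam: "0 < lam" and C: "0 \<le> C"
    and le: "\<And>s. s \<in> {0..Y} \<Longrightarrow> \<bar>f s - g s\<bar> \<le> C * s * exp (lam * s)"
  shows "\<bar>power_avg n f r - power_avg n g r\<bar> \<le> C / lam * exp (lam * r)"
proof -
  note fi = integrable_continuous_real[OF power_avg_integrand_continuous[OF f r, of n]]
  note gi = integrable_continuous_real[OF power_avg_integrand_continuous[OF g r, of n]]
  have hi: "((\<lambda>t. C * (r * exp (lam * (r * t)))) has_integral
      (C / lam * exp (lam * (r * 1)) - C / lam * exp (lam * (r * 0)))) {0..1}"
    using lam
    by (intro fundamental_theorem_of_calculus)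
       (auto intro!: derivative_eq_intros simp flip: has_real_derivative_iff_has_vector_derivative)
  have "power_avg n f r - power_avg n g r
      = integral {0..1} (\<lambda>t. t ^ n * f (r * t) - t ^ n * g (r * t))"
    unfolding power_avg_def by (rule integral_diff[symmetric, OF fi gi])
  also have "\<bar>\<dots>\<bar> \<le> integral {0..1} (\<lambda>t. C * (r * exp (lam * (r * t))))"
    unfolding real_norm_def[symmetric]
  proof (rule integral_norm_bound_integral)
    show "(\<lambda>t. t ^ n * f (r * t) - t ^ n * g (r * t)) integrable_on {0..1}"
      by (rule integrable_diff[OF fi gi])
    fix t :: real assume t: "t \<in> {0..1}"
    have "norm (t ^ n * f (r * t) - t ^ n * g (r * t)) = t ^ n * \<bar>f (r * t) - g (r * t)\<bar>"
      using t by (simp add: abs_mult flip: right_diff_distrib)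
    also have "\<dots> \<le> 1 * (C * (r * t) * exp (lam * (r * t)))"
      using t r stretch_mem[of r Y t] by (intro mult_mono le power_le_one) auto
    also have "\<dots> \<le> C * (r * 1) * exp (lam * (r * t))"
      unfolding mult_1 using t r C by (intro mult_right_mono mult_left_mono) auto
    finally show "norm (t ^ n * f (r * t) - t ^ n * g (r * t)) \<le> C * (r * exp (lam * (r * t)))"
      by (simp add: mult.assoc)
  qed (use hi in blast)
  also have "\<dots> = C / lam * exp (lam * r) - C / lam"
    by (subst integral_unique[OF hi]) simp
  also have "\<dots> \<le> C / lam * exp (lam * r)" using C lam by simp
  finally show ?thesis .
qed

text \<open>The weight is \<open>exp (8 L r)\<close>: a difference of size \<open>a exp (8 L s)\<close> in each component changes \<open>F\<close> by at most
\<open>2 L a s exp (8 L s)\<close>, hence its average by a quarter of \<open>a exp (8 L r)\<close>, and the two averages together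
by a half.\<close>

lemma coupled_averages_contraction:
  fixes F1 F2 :: "real \<Rightarrow> real \<Rightarrow> real \<Rightarrow> real"
  assumes L: "0 < L"
    and c: "\<And>F v k. F \<in> {F1, F2} \<Longrightarrow> continuous_on {0..Y} v \<Longrightarrow> continuous_on {0..Y} k
        \<Longrightarrow> continuous_on {0..Y} (\<lambda>r. F r (v r) (k r))"
    and lip: "\<And>F r v k v' k'. F \<in> {F1, F2} \<Longrightarrow> r \<in> {0..Y}
        \<Longrightarrow> \<bar>F r v k - F r v' k'\<bar> \<le> L * r * (\<bar>v - v'\<bar> + \<bar>k - k'\<bar>)"
    and w: "continuous_on {0..Y} w" "continuous_on {0..Y} w'"
    and le: "\<And>s. s \<in> {0..Y} \<Longrightarrow> norm (w s - w' s) \<le> a * exp (8 * L * s)"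
    and r: "r \<in> {0..Y}"
  shows "norm ((power_avg m (\<lambda>s. F1 s (fst (w s)) (snd (w s))) r,
                power_avg n (\<lambda>s. F2 s (fst (w s)) (snd (w s))) r)
             - (power_avg m (\<lambda>s. F1 s (fst (w' s)) (snd (w' s))) r,
                power_avg n (\<lambda>s. F2 s (fst (w' s)) (snd (w' s))) r)) \<le> a / 2 * exp (8 * L * r)"
proof -
  have "0 \<le> norm (w r - w' r)" by simp
  also have "\<dots> \<le> a * exp (8 * L * r)" by (rule le[OF r])
  finally have a: "0 \<le> a" by (simp add: zero_le_mult_iff)
  have main: "\<bar>power_avg j (\<lambda>s. F s (fst (w s)) (snd (w s))) r
      - power_avg j (\<lambda>s. F s (fst (w' s)) (snd (w' s))) r\<bar> \<le> a / 4 * exp (8 * L * r)"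
    if F: "F \<in> {F1, F2}" for F j
  proof -
    have "\<bar>power_avg j (\<lambda>s. F s (fst (w s)) (snd (w s))) r
      - power_avg j (\<lambda>s. F s (fst (w' s)) (snd (w' s))) r\<bar> \<le> (2 * L * a) / (8 * L) * exp (8 * L * r)"
    proof (rule power_avg_weighted_contraction[OF _ _ r])
      show "continuous_on {0..Y} (\<lambda>s. F s (fst (w s)) (snd (w s)))"
        "continuous_on {0..Y} (\<lambda>s. F s (fst (w' s)) (snd (w' s)))"
        by (intro c[OF F] continuous_on_fst continuous_on_snd w)+
      fix s assume s: "s \<in> {0..Y}"
      have "\<bar>fst (w s) - fst (w' s)\<bar> \<le> norm (w s - w' s)" "\<bar>snd (w s) - snd (w' s)\<bar> \<le> norm (w s - w' s)"
        using norm_fst_le[of "fst (w s - w' s)" "snd (w s - w' s)"]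
          norm_snd_le[of "snd (w s - w' s)" "fst (w s - w' s)"]
        unfolding prod.collapse by simp_all
      with le[OF s] have "\<bar>fst (w s) - fst (w' s)\<bar> + \<bar>snd (w s) - snd (w' s)\<bar> \<le> 2 * (a * exp (8 * L * s))"
        by linarith
      then have "L * s * (\<bar>fst (w s) - fst (w' s)\<bar> + \<bar>snd (w s) - snd (w' s)\<bar>)
          \<le> L * s * (2 * (a * exp (8 * L * s)))"
        using s L by (intro mult_left_mono) auto
      with lip[OF F s] have "\<bar>F s (fst (w s)) (snd (w s)) - F s (fst (w' s)) (snd (w' s))\<bar>
          \<le> L * s * (2 * (a * exp (8 * L * s)))" by (rule order_trans)
      then show "\<bar>F s (fst (w s)) (snd (w s)) - F s (fst (w' s)) (snd (w' s))\<bar>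
          \<le> 2 * L * a * s * exp (8 * L * s)" by (simp add: mult_ac)
    qed (use L a in auto)
    then show ?thesis using L by simp
  qed
  show ?thesis
    unfolding diff_Pair
    by (rule order_trans[OF norm_Pair_le]) (use main[of F1 m] main[of F2 n] in simp)
qed

lemma coupled_averages_exist:
  fixes F1 F2 :: "real \<Rightarrow> real \<Rightarrow> real \<Rightarrow> real"
  assumes L: "0 < L"
    and c: "\<And>F v k. F \<in> {F1, F2} \<Longrightarrow> continuous_on {0..X} v \<Longrightarrow> continuous_on {0..X} k
        \<Longrightarrow> continuous_on {0..X} (\<lambda>r. F r (v r) (k r))"
    and lip: "\<And>F r v k v' k'. F \<in> {F1, F2} \<Longrightarrow> r \<in> {0..X}
        \<Longrightarrow> \<bar>F r v k - F r v' k'\<bar> \<le> L * r * (\<bar>v - v'\<bar> + \<bar>k - k'\<bar>)"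
  obtains v k where "continuous_on {0..X} v" "continuous_on {0..X} k"
    "\<And>r. r \<in> {0..X} \<Longrightarrow> v r = power_avg m (\<lambda>s. F1 s (v s) (k s)) r"
    "\<And>r. r \<in> {0..X} \<Longrightarrow> k r = power_avg n (\<lambda>s. F2 s (v s) (k s)) r"
proof -
  let ?T = "\<lambda>(w :: real \<Rightarrow> real \<times> real) r. (power_avg m (\<lambda>s. F1 s (fst (w s)) (snd (w s))) r,
                power_avg n (\<lambda>s. F2 s (fst (w s)) (snd (w s))) r)"
  have "\<exists>w. continuous_on {0..X} w \<and> (\<forall>s\<in>{0..X}. w s = ?T w s)"
  proof (rule volterra_fixed_point_exists[where E = "\<lambda>s. exp (8 * L * s)"])
    show "continuous_on {0..X} (?T w)" if "continuous_on {0..X} w" for w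
    proof -
      have "continuous_on {0..X} (\<lambda>s. F s (fst (w s)) (snd (w s)))" if "F \<in> {F1, F2}" for F
        by (rule c[OF that continuous_on_fst continuous_on_snd]) fact+
      then show ?thesis by (intro continuous_on_Pair continuous_on_power_avg) auto
    qed
    show "1 \<le> exp (8 * L * s)" if "s \<in> {0..X}" for s using that L by simp
    show "norm (?T w1 s - ?T w2 s) \<le> a / 2 * exp (8 * L * s)"
      if "continuous_on {0..X} w1" "continuous_on {0..X} w2"
        "\<And>s. s \<in> {0..X} \<Longrightarrow> norm (w1 s - w2 s) \<le> a * exp (8 * L * s)" "s \<in> {0..X}" for w1 w2 a s
    proof (rule coupled_averages_contraction[OF L])
      show "continuous_on {0..X} (\<lambda>r. F r (v r) (k r))"
        if "F \<in> {F1, F2}" "continuous_on {0..X} v" "continuous_on {0..X} k" for F v k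
        by (rule c[OF that])
      show "\<bar>F r v k - F r v' k'\<bar> \<le> L * r * (\<bar>v - v'\<bar> + \<bar>k - k'\<bar>)"
        if "F \<in> {F1, F2}" "r \<in> {0..X}" for F r v k v' k'
        by (rule lip[OF that])
    qed (use that in auto)
  qed (intro continuous_intros)
  then obtain w where w: "continuous_on {0..X} w" "\<And>s. s \<in> {0..X} \<Longrightarrow> w s = ?T w s" by blast
  show ?thesis
  proof (rule that)
    show "continuous_on {0..X} (\<lambda>s. fst (w s))" "continuous_on {0..X} (\<lambda>s. snd (w s))"
      by (intro continuous_on_fst continuous_on_snd w)+
    fix r assume "r \<in> {0..X}"
    from w(2)[OF this] show "fst (w r) = power_avg m (\<lambda>s. F1 s (fst (w s)) (snd (w s))) r"
      "snd (w r) = power_avg n (\<lambda>s. F2 s (fst (w s)) (snd (w s))) r"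
      by (simp_all only: prod_eq_iff fst_conv snd_conv)
  qed
qed

lemma coupled_averages_unique:
  fixes F1 F2 :: "real \<Rightarrow> real \<Rightarrow> real \<Rightarrow> real"
  assumes L: "0 < L"
    and c: "\<And>F v k. F \<in> {F1, F2} \<Longrightarrow> continuous_on {0..Y} v \<Longrightarrow> continuous_on {0..Y} k
        \<Longrightarrow> continuous_on {0..Y} (\<lambda>r. F r (v r) (k r))"
    and lip: "\<And>F r v k v' k'. F \<in> {F1, F2} \<Longrightarrow> r \<in> {0..Y}
        \<Longrightarrow> \<bar>F r v k - F r v' k'\<bar> \<le> L * r * (\<bar>v - v'\<bar> + \<bar>k - k'\<bar>)"
    and vk: "continuous_on {0..Y} v" "continuous_on {0..Y} k"
      "\<And>r. r \<in> {0..Y} \<Longrightarrow> v r = power_avg m (\<lambda>s. F1 s (v s) (k s)) r"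
      "\<And>r. r \<in> {0..Y} \<Longrightarrow> k r = power_avg n (\<lambda>s. F2 s (v s) (k s)) r"
    and vk': "continuous_on {0..Y} v'" "continuous_on {0..Y} k'"
      "\<And>r. r \<in> {0..Y} \<Longrightarrow> v' r = power_avg m (\<lambda>s. F1 s (v' s) (k' s)) r"
      "\<And>r. r \<in> {0..Y} \<Longrightarrow> k' r = power_avg n (\<lambda>s. F2 s (v' s) (k' s)) r"
    and r: "r \<in> {0..Y}"
  shows "v r = v' r \<and> k r = k' r"
proof -
  let ?T = "\<lambda>(w :: real \<Rightarrow> real \<times> real) r. (power_avg m (\<lambda>s. F1 s (fst (w s)) (snd (w s))) r,
                power_avg n (\<lambda>s. F2 s (fst (w s)) (snd (w s))) r)"
  define w where "w s = (v s, k s)" for s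
  define w' where "w' s = (v' s, k' s)" for s
  have cw: "continuous_on {0..Y} w" "continuous_on {0..Y} w'"
    unfolding w_def w'_def by (intro continuous_on_Pair vk vk')+
  have "w r = w' r"
  proof (rule volterra_fixed_point_unique[where E = "\<lambda>s. exp (8 * L * s)" and T = ?T, OF _ cw _ _ _ r])
    show "1 \<le> exp (8 * L * s)" if "s \<in> {0..Y}" for s using that L by simp
    show "norm (?T w s - ?T w' s) \<le> a / 2 * exp (8 * L * s)"
      if "\<And>s. s \<in> {0..Y} \<Longrightarrow> norm (w s - w' s) \<le> a * exp (8 * L * s)" "s \<in> {0..Y}" for a s
    proof (rule coupled_averages_contraction[OF L])
      show "continuous_on {0..Y} (\<lambda>r. F r (v r) (k r))"
        if "F \<in> {F1, F2}" "continuous_on {0..Y} v" "continuous_on {0..Y} k" for F v k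
        by (rule c[OF that])
      show "\<bar>F r v k - F r v' k'\<bar> \<le> L * r * (\<bar>v - v'\<bar> + \<bar>k - k'\<bar>)"
        if "F \<in> {F1, F2}" "r \<in> {0..Y}" for F r v k v' k'
        by (rule lip[OF that])
    qed (use cw that in auto)
    show "w s = ?T w s" "w' s = ?T w' s" if "s \<in> {0..Y}" for s
      using vk(3,4)[OF that] vk'(3,4)[OF that] by (simp_all add: w_def w'_def)
  qed
  then show ?thesis by (simp add: w_def w'_def)
qed

section \<open>Estimates for the exponential function\<close>

lemma exp_growth_exceeds:
  assumes "0 < \<epsilon>" "0 < u"
  obtains r :: real where "1 \<le> r" "\<And>x. r \<le> x \<Longrightarrow> c \<le> u * exp (\<epsilon> * ln x)"
proof -
  define T where "T = max 0 (c / u)"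
  define r where "r = exp (T / \<epsilon>)"
  have r1: "1 \<le> r" using assms by (simp add: r_def T_def)
  moreover have "c \<le> u * exp (\<epsilon> * ln x)" if "r \<le> x" for x
  proof -
    have "T / \<epsilon> \<le> ln x" using that r1 by (metis r_def exp_gt_zero ln_exp ln_mono)
    then have "T \<le> \<epsilon> * ln x" using assms by (simp add: field_simps)
    then have "c / u \<le> exp (\<epsilon> * ln x)" using exp_ge_add_one_self[of "\<epsilon> * ln x"] unfolding T_def by linarith
    then show ?thesis using assms by (simp add: field_simps)
  qed
  ultimately show ?thesis by (rule that)
qed

text \<open>All nonlinear terms that survive in the scaled equations are multiples of \<open>exp_rem (m p) / r\<^sup>2\<close> with
\<open>p = r\<^sup>2 v\<close>, and \<open>exp_rem\<close> vanishes to second order at \<open>0\<close>.\<close>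

definition exp_rem :: "real \<Rightarrow> real" where
  "exp_rem t = exp t - 1 - t"

lemma exp_rem_0 [simp]: "exp_rem 0 = 0" by (simp add: exp_rem_def)

lemma exp_rem_nonneg: "0 \<le> exp_rem t"
  using exp_ge_add_one_self[of t] unfolding exp_rem_def by linarith

lemma exp_lipschitz:
  assumes "x \<le> M" "y \<le> M"
  shows "\<bar>exp x - exp y\<bar> \<le> exp M * \<bar>x - y :: real\<bar>"
proof -
  have "norm (exp x - exp y) \<le> exp M * norm (x - y)"
    using assms
    by (intro field_differentiable_bound[where S = "{..M}" and f' = exp])
       (auto intro: DERIV_subset[OF DERIV_exp])
  then show ?thesis by simp
qed

lemma exp_rem_lipschitz:
  assumes "\<bar>x\<bar> \<le> M" "\<bar>y\<bar> \<le> M"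
  shows "\<bar>exp_rem x - exp_rem y\<bar> \<le> M * exp M * \<bar>x - y\<bar>"
proof -
  have M: "0 \<le> M" using assms by simp
  have "norm (exp_rem x - exp_rem y) \<le> (M * exp M) * norm (x - y)"
  proof (rule field_differentiable_bound[where S = "{-M..M}" and f' = "\<lambda>t. exp t - 1"])
    show "(exp_rem has_field_derivative exp z - 1) (at z within {- M..M})" for z
      unfolding exp_rem_def[abs_def] by (auto intro!: derivative_eq_intros)
    show "norm (exp z - 1) \<le> M * exp M" if "z \<in> {-M..M}" for z
    proof -
      have "norm (exp z - 1) \<le> exp M * \<bar>z\<bar>" using exp_lipschitz[of z M 0] that M by simp
      also have "\<dots> \<le> exp M * M" using that by (intro mult_left_mono) auto
      finally show ?thesis by (simp add: mult.commute)
    qed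
  qed (use assms in auto)
  then show ?thesis by simp
qed

lemma exp_rem_quotient_isCont: "isCont (\<lambda>t. exp_rem t / t) z"
proof (cases "z = 0")
  case True
  have "(exp_rem has_real_derivative 0) (at 0)"
    unfolding exp_rem_def[abs_def] by (auto intro!: derivative_eq_intros)
  then show ?thesis using True by (simp add: DERIV_def isCont_def)
next
  case False
  then show ?thesis unfolding exp_rem_def by (intro continuous_intros)
qed

text \<open>At \<open>r = 0\<close> the convention \<open>x / 0 = 0\<close> gives the correct limit \<open>0\<close>, even if \<open>0\<close> belongs to \<open>S\<close>.\<close>

lemma exp_rem_scaled_continuous:
  assumes "continuous_on S w"
  shows "continuous_on S (\<lambda>r. exp_rem (r\<^sup>2 * w r) / r\<^sup>2)"
proof -
  have q: "continuous_on UNIV (\<lambda>t. exp_rem t / t)"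
    using exp_rem_quotient_isCont continuous_at_imp_continuous_on by blast
  have "continuous_on S (\<lambda>r. w r * (exp_rem (r\<^sup>2 * w r) / (r\<^sup>2 * w r)))"
    by (intro continuous_intros assms continuous_on_compose2[OF q]) auto
  moreover have "w r * (exp_rem (r\<^sup>2 * w r) / (r\<^sup>2 * w r)) = exp_rem (r\<^sup>2 * w r) / r\<^sup>2" for r
    by (cases "w r = 0") auto
  ultimately show ?thesis by simp
qed

text \<open>Second-order vanishing yields the factor \<open>r\<close> in the Lipschitz constant that the contraction needs.\<close>

lemma exp_rem_scaled_lipschitz:
  assumes x: "\<bar>x\<bar> \<le> W" and y: "\<bar>y\<bar> \<le> W" and r: "r \<in> {0..X}"
  shows "\<bar>exp_rem (r\<^sup>2 * x) / r\<^sup>2 - exp_rem (r\<^sup>2 * y) / r\<^sup>2\<bar> \<le> (X * W * exp (X\<^sup>2 * W)) * r * \<bar>x - y\<bar>"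
proof (cases "r = 0")
  case False
  have W: "0 \<le> W" and r0: "0 < r" using x r False by auto
  have "\<bar>r\<^sup>2 * x\<bar> \<le> r\<^sup>2 * W" "\<bar>r\<^sup>2 * y\<bar> \<le> r\<^sup>2 * W"
    using x y by (auto simp: abs_mult intro!: mult_left_mono)
  then have "\<bar>exp_rem (r\<^sup>2 * x) - exp_rem (r\<^sup>2 * y)\<bar> \<le> (r\<^sup>2 * W) * exp (r\<^sup>2 * W) * \<bar>r\<^sup>2 * x - r\<^sup>2 * y\<bar>"
    by (rule exp_rem_lipschitz)
  also have "\<dots> \<le> (r\<^sup>2 * W) * exp (X\<^sup>2 * W) * \<bar>r\<^sup>2 * x - r\<^sup>2 * y\<bar>"
    using mult_right_mono[OF power_mono[of r X 2] W] r r0 W by (intro mult_right_mono mult_left_mono) auto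
  also have "\<bar>r\<^sup>2 * x - r\<^sup>2 * y\<bar> = r\<^sup>2 * \<bar>x - y\<bar>"
    by (simp add: abs_mult flip: right_diff_distrib)
  also have "(r\<^sup>2 * W) * exp (X\<^sup>2 * W) * (r\<^sup>2 * \<bar>x - y\<bar>)
      = r\<^sup>2 * (r * (W * exp (X\<^sup>2 * W) * r * \<bar>x - y\<bar>))"
    by (simp only: power2_eq_square mult_ac)
  also have "\<dots> \<le> r\<^sup>2 * (X * (W * exp (X\<^sup>2 * W) * r * \<bar>x - y\<bar>))"
    by (rule mult_left_mono[OF mult_right_mono]) (use r r0 W in auto)
  finally have le: "\<bar>exp_rem (r\<^sup>2 * x) - exp_rem (r\<^sup>2 * y)\<bar> \<le> r\<^sup>2 * ((X * W * exp (X\<^sup>2 * W)) * r * \<bar>x - y\<bar>)"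
    by (simp only: mult_ac)
  have "\<bar>exp_rem (r\<^sup>2 * x) / r\<^sup>2 - exp_rem (r\<^sup>2 * y) / r\<^sup>2\<bar>
      = \<bar>exp_rem (r\<^sup>2 * x) - exp_rem (r\<^sup>2 * y)\<bar> / r\<^sup>2"
    by (simp add: abs_divide flip: diff_divide_distrib)
  also have "\<dots> \<le> (X * W * exp (X\<^sup>2 * W)) * r * \<bar>x - y\<bar>"
    using divide_right_mono[OF le, of "r\<^sup>2"] r0 by simp
  finally show ?thesis .
qed simp

text \<open>For a strongly regular solution only \<open>p = o(r)\<close> is known at first, not yet \<open>p = O(r\<^sup>2)\<close>; this already
makes the nonlinear terms negligible at the centre.\<close>

lemma exp_rem_little_o:
  assumes q: "((\<lambda>r. p r / r) \<longlongrightarrow> 0) (at_right 0)"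
  shows "((\<lambda>r. exp_rem (m * p r) / r\<^sup>2) \<longlongrightarrow> 0) (at_right 0)"
proof (rule Lim_null_comparison)
  have "((\<lambda>r. p r / r * r) \<longlongrightarrow> 0 * 0) (at_right 0)" by (intro tendsto_intros q)
  then have p: "(p \<longlongrightarrow> 0) (at_right 0)"
    unfolding mult_zero_left
    by (rule Lim_transform_eventually) (auto simp: eventually_at_filter)
  have "((\<lambda>r. (m * (p r / r))\<^sup>2 * exp \<bar>m * p r\<bar>) \<longlongrightarrow> (m * 0)\<^sup>2 * exp \<bar>m * 0\<bar>) (at_right 0)"
    by (intro tendsto_intros q p)
  then show "((\<lambda>r. (m * (p r / r))\<^sup>2 * exp \<bar>m * p r\<bar>) \<longlongrightarrow> 0) (at_right 0)" by simp
  have "norm (exp_rem (m * p r) / r\<^sup>2) \<le> (m * (p r / r))\<^sup>2 * exp \<bar>m * p r\<bar>" for r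
  proof -
    have "\<bar>exp_rem (m * p r)\<bar> \<le> \<bar>m * p r\<bar> * exp \<bar>m * p r\<bar> * \<bar>m * p r\<bar>"
      using exp_rem_lipschitz[of "m * p r" "\<bar>m * p r\<bar>" 0] by simp
    also have "\<dots> = (m * p r)\<^sup>2 * exp \<bar>m * p r\<bar>" by (simp add: power2_eq_square abs_mult)
    finally have "\<bar>exp_rem (m * p r)\<bar> / r\<^sup>2 \<le> (m * p r)\<^sup>2 * exp \<bar>m * p r\<bar> / r\<^sup>2"
      by (intro divide_right_mono) auto
    then show ?thesis by (simp add: power_mult_distrib power_divide)
  qed
  then show "eventually (\<lambda>r. norm (exp_rem (m * p r) / r\<^sup>2) \<le> (m * (p r / r))\<^sup>2 * exp \<bar>m * p r\<bar>) (at_right 0)"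
    by simp
qed

section \<open>Intervals of radii and clipping\<close>

lemma radii_ge0: "r \<in> radii R \<Longrightarrow> 0 \<le> r"
  by (simp add: radii_def)

lemma radii_down: "r \<in> radii R \<Longrightarrow> 0 \<le> s \<Longrightarrow> s \<le> r \<Longrightarrow> s \<in> radii R"
  by (auto simp: radii_def intro: le_less_trans[of "ereal s" "ereal r"])

lemma radii_mono: "r \<in> radii R \<Longrightarrow> R \<le> R' \<Longrightarrow> r \<in> radii R'"
  by (auto simp: radii_def)

lemma radii_larger: assumes "r \<in> radii R" obtains Y where "r < Y" "Y \<in> radii R"
proof -
  have "ereal r < R" "0 \<le> r" using assms by (auto simp: radii_def)
  then obtain Y where "ereal r < ereal Y" "ereal Y < R" using ereal_dense2 by blast
  then show ?thesis using that \<open>0 \<le> r\<close> by (auto simp: radii_def)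
qed

lemma radii_ereal: "radii (ereal R) = {0..<R}"
  by (auto simp: radii_def)

lemma radii_interior: assumes "r \<in> radii R" "0 < r" obtains a where "r \<in> {0<..<a}" "{0..a} \<subseteq> radii R"
proof -
  obtain Y where Y: "r < Y" "Y \<in> radii R" using radii_larger[OF assms(1)] .
  then have "{0..Y} \<subseteq> radii R" using radii_down by auto
  then show ?thesis using that[of Y] Y assms(2) by auto
qed

lemma radii_initial_segment:
  assumes "0 < R" obtains a where "0 < a" "{0..a} \<subseteq> radii R"
proof -
  have "0 \<in> radii R" using assms by (simp add: radii_def zero_ereal_def)
  then obtain Y where "0 < Y" "Y \<in> radii R" using radii_larger by blast
  then show ?thesis by (intro that[of Y]) (auto intro: radii_down)
qed

lemma eventually_at_right_radii:
  assumes "0 < R" shows "eventually (\<lambda>r. 0 < r \<and> r \<in> radii R) (at_right 0)"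
proof -
  obtain a where a: "0 < a" "{0..a} \<subseteq> radii R" using radii_initial_segment[OF assms] .
  then show ?thesis unfolding eventually_at_right_field by (intro exI[of _ a]) (auto simp: subset_iff)
qed

lemma at_within_radii: assumes "r \<in> radii R" "0 < r" shows "at r within radii R = at r"
proof -
  obtain a where "r \<in> {0<..<a}" "{0..a} \<subseteq> radii R" using radii_interior[OF assms] .
  then show ?thesis by (intro at_within_open_subset[of r "{0<..<a}"]) (auto simp: subset_iff)
qed

text \<open>Used to glue solutions defined on an increasing family of intervals.\<close>

lemma continuous_on_radii_local:
  assumes "\<And>r. r \<in> radii R \<Longrightarrow> \<exists>R'\<le>R. r \<in> radii R' \<and> continuous_on (radii R') f"
  shows "continuous_on (radii R) f"
  unfolding continuous_on_eq_continuous_within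
proof
  fix r assume r: "r \<in> radii R"
  then obtain R' where R': "R' \<le> R" "r \<in> radii R'" "continuous_on (radii R') f" using assms by blast
  obtain Y where Y: "r < Y" "Y \<in> radii R'" using radii_larger[OF R'(2)] .
  have "at r within radii R = at r within radii R'"
  proof (rule at_within_nhd[of r "{..<Y}"])
    show "radii R \<inter> {..<Y} - {r} = radii R' \<inter> {..<Y} - {r}"
      using radii_down[OF Y(2)] radii_ge0[of _ R] radii_mono[OF _ R'(1)] by auto
  qed (use Y in auto)
  then show "continuous (at r within radii R) f"
    using R' by (simp add: continuous_on_eq_continuous_within)
qed

definition clip :: "real \<Rightarrow> real \<Rightarrow> real" where
  "clip V x = max (- V) (min V x)"

lemma clip_abs_le: "0 \<le> V \<Longrightarrow> \<bar>clip V x\<bar> \<le> V"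
  by (auto simp: clip_def)

lemma clip_nonexpansive: "\<bar>clip V x - clip V y\<bar> \<le> \<bar>x - y\<bar>"
  by (auto simp: clip_def max_def min_def)

lemma clip_inactive: "\<bar>x\<bar> \<le> V \<Longrightarrow> clip V x = x"
  by (auto simp: clip_def)

lemma continuous_on_clip: "continuous_on S v \<Longrightarrow> continuous_on S (\<lambda>r. clip V (v r))"
  unfolding clip_def by (intro continuous_intros)

section \<open>The scaled equations at the centre\<close>

text \<open>\<open>d0\<close> is the logarithm of the central density.\<close>

locale scaled_flow =
  fixes \<beta> \<gamma> \<theta> d0 :: real
  assumes beta0: "\<beta> \<noteq> 0" and beta1: "\<beta> \<noteq> 1" and theta0: "0 < \<theta>"
begin

text \<open>With \<open>ln \<delta> = d0 - r\<^sup>2 k\<close> and \<open>ln \<eta> = ln \<delta> + r\<^sup>2 v\<close> this is \<open>\<theta> \<eta> powr (2 - \<gamma>) (\<delta> / \<eta>) powr (1 - \<beta>)\<close>: up to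
sign, the gravitational term of the density equation divided by \<open>r \<delta>\<close>.\<close>

definition gravity :: "real \<Rightarrow> real \<Rightarrow> real \<Rightarrow> real" where
  "gravity r v k = \<theta> * exp ((2 - \<gamma>) * (d0 - r\<^sup>2 * k) + (1 + \<beta> - \<gamma>) * (r\<^sup>2 * v))"

text \<open>The elastic terms \<open>3 (\<beta> - \<gamma>) y powr (-\<beta>) B y\<close>, rewritten with \<open>y = exp (- r\<^sup>2 v)\<close> as a combination of two
exponential remainders. The parameter \<open>c\<close> accounts for the remainder of \<open>c (1 - y)\<close>: it is \<open>3\<close> in the
equation for \<open>v = (ln \<eta> - ln \<delta>) / r\<^sup>2\<close>, where \<open>r (ln \<eta>)' = - 3 (1 - y)\<close> enters, and \<open>0\<close> in the
equation for \<open>k = (d0 - ln \<delta>) / r\<^sup>2\<close>.\<close>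

definition forcing :: "real \<Rightarrow> real \<Rightarrow> real \<Rightarrow> real \<Rightarrow> real" where
  "forcing c r v k = gravity r v k
     - 3 * (\<beta> - \<gamma>) / (\<beta> * (\<beta> - 1)) * (exp_rem (r\<^sup>2 * ((\<beta> - 1) * v)) / r\<^sup>2)
     - (3 * (\<beta> - \<gamma>) / \<beta> - c) * (exp_rem (r\<^sup>2 * (- v)) / r\<^sup>2)"

text \<open>The coefficients are \<open>5 = 2 + 3\<close> and \<open>2 = 2 + 0\<close>: the scaling by \<open>r\<^sup>2\<close> contributes \<open>2\<close>, and the linear
part of the equation for \<open>ln \<eta> - ln \<delta>\<close> contributes \<open>3\<close>.\<close>

definition scaled_solution :: "ereal \<Rightarrow> (real \<Rightarrow> real) \<Rightarrow> (real \<Rightarrow> real) \<Rightarrow> bool" where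
  "scaled_solution R v k \<longleftrightarrow> 0 < R \<and> continuous_on (radii R) v \<and> continuous_on (radii R) k \<and>
     (\<forall>r\<in>radii R - {0}. (v has_real_derivative (forcing 3 r (v r) (k r) - 5 * v r) / r) (at r) \<and>
        (k has_real_derivative (forcing 0 r (v r) (k r) - 2 * k r) / r) (at r))"

lemma forcing_at_0: "forcing c 0 v k = \<theta> * exp ((2 - \<gamma>) * d0)"
  by (simp add: forcing_def gravity_def)

lemma forcing_continuous:
  assumes "continuous_on S v" "continuous_on S k"
  shows "continuous_on S (\<lambda>r. forcing c r (v r) (k r))"
proof -
  note e1 = exp_rem_scaled_continuous[OF continuous_on_mult[OF continuous_on_const assms(1)], of "\<beta> - 1"]
  note e2 = exp_rem_scaled_continuous[OF continuous_on_minus[OF assms(1)]]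
  show ?thesis
    unfolding forcing_def gravity_def
    by (intro continuous_on_diff continuous_on_mult[OF continuous_on_const e1]
        continuous_on_mult[OF continuous_on_const e2] continuous_intros assms)
qed

lemma gravity_lipschitz:
  assumes r: "r \<in> {0..X}" and b: "\<bar>v\<bar> \<le> V" "\<bar>k\<bar> \<le> V" "\<bar>v'\<bar> \<le> V" "\<bar>k'\<bar> \<le> V"
  defines "m \<equiv> \<bar>2 - \<gamma>\<bar> + \<bar>1 + \<beta> - \<gamma>\<bar>"
  shows "\<bar>gravity r v k - gravity r v' k'\<bar>
    \<le> (\<theta> * exp (\<bar>2 - \<gamma>\<bar> * \<bar>d0\<bar> + m * (X\<^sup>2 * V)) * X * m) * r * (\<bar>v - v'\<bar> + \<bar>k - k'\<bar>)"
proof -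
  let ?g = "\<lambda>v k. (2 - \<gamma>) * (d0 - r\<^sup>2 * k) + (1 + \<beta> - \<gamma>) * (r\<^sup>2 * v)"
  let ?M = "\<bar>2 - \<gamma>\<bar> * \<bar>d0\<bar> + m * (X\<^sup>2 * V)"
  have r2: "r\<^sup>2 \<le> X\<^sup>2" "r\<^sup>2 \<le> X * r" using r by (auto simp: power2_eq_square intro: mult_mono mult_right_mono)
  have V: "0 \<le> V" using b by auto
  have M: "?g v k \<le> ?M" if "\<bar>v\<bar> \<le> V" "\<bar>k\<bar> \<le> V" for v k
  proof -
    have x: "\<bar>r\<^sup>2 * x\<bar> \<le> X\<^sup>2 * V" if "\<bar>x\<bar> \<le> V" for x
      using that r2 V by (simp add: abs_mult mult_mono)
    have "?g v k = (2 - \<gamma>) * d0 - (2 - \<gamma>) * (r\<^sup>2 * k) + (1 + \<beta> - \<gamma>) * (r\<^sup>2 * v)"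
      by (simp add: algebra_simps)
    also have "\<dots> \<le> \<bar>2 - \<gamma>\<bar> * \<bar>d0\<bar> + \<bar>2 - \<gamma>\<bar> * \<bar>r\<^sup>2 * k\<bar> + \<bar>1 + \<beta> - \<gamma>\<bar> * \<bar>r\<^sup>2 * v\<bar>"
      unfolding abs_mult[symmetric] by linarith
    also have "\<dots> \<le> \<bar>2 - \<gamma>\<bar> * \<bar>d0\<bar> + \<bar>2 - \<gamma>\<bar> * (X\<^sup>2 * V) + \<bar>1 + \<beta> - \<gamma>\<bar> * (X\<^sup>2 * V)"
      by (intro add_mono mult_left_mono x that) auto
    also have "\<dots> = ?M" by (simp add: m_def algebra_simps)
    finally show ?thesis .
  qed
  have "?g v k - ?g v' k' = r\<^sup>2 * ((1 + \<beta> - \<gamma>) * (v - v') - (2 - \<gamma>) * (k - k'))"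
    by (simp add: algebra_simps)
  then have "\<bar>?g v k - ?g v' k'\<bar> = r\<^sup>2 * \<bar>(1 + \<beta> - \<gamma>) * (v - v') - (2 - \<gamma>) * (k - k')\<bar>"
    by (simp add: abs_mult)
  also have "\<dots> \<le> r\<^sup>2 * (m * (\<bar>v - v'\<bar> + \<bar>k - k'\<bar>))"
  proof (rule mult_left_mono)
    have "\<bar>(1 + \<beta> - \<gamma>) * (v - v') - (2 - \<gamma>) * (k - k')\<bar>
        \<le> \<bar>1 + \<beta> - \<gamma>\<bar> * \<bar>v - v'\<bar> + \<bar>2 - \<gamma>\<bar> * \<bar>k - k'\<bar>"
      unfolding abs_mult[symmetric] by linarith
    also have "\<dots> \<le> m * \<bar>v - v'\<bar> + m * \<bar>k - k'\<bar>"
      by (intro add_mono mult_right_mono) (auto simp: m_def)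
    finally show "\<bar>(1 + \<beta> - \<gamma>) * (v - v') - (2 - \<gamma>) * (k - k')\<bar> \<le> m * (\<bar>v - v'\<bar> + \<bar>k - k'\<bar>)"
      by (simp add: distrib_left)
  qed simp
  also have "\<dots> \<le> X * r * (m * (\<bar>v - v'\<bar> + \<bar>k - k'\<bar>))"
    by (intro mult_right_mono r2) (auto simp: m_def)
  finally have g: "\<bar>?g v k - ?g v' k'\<bar> \<le> X * r * (m * (\<bar>v - v'\<bar> + \<bar>k - k'\<bar>))" .
  have "\<bar>gravity r v k - gravity r v' k'\<bar> = \<theta> * \<bar>exp (?g v k) - exp (?g v' k')\<bar>"
    using theta0 by (simp add: gravity_def abs_mult flip: right_diff_distrib)
  also have "\<dots> \<le> \<theta> * (exp ?M * \<bar>?g v k - ?g v' k'\<bar>)"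
    using theta0 by (intro mult_left_mono exp_lipschitz M b) auto
  also have "\<dots> \<le> \<theta> * (exp ?M * (X * r * (m * (\<bar>v - v'\<bar> + \<bar>k - k'\<bar>))))"
    using theta0 by (intro mult_left_mono g) auto
  finally show ?thesis by (simp only: mult_ac)
qed

lemma forcing_lipschitz:
  assumes X: "0 \<le> X" and V: "0 \<le> V"
  obtains L where "0 < L"
    "\<And>r v k v' k'. r \<in> {0..X} \<Longrightarrow> \<bar>v\<bar> \<le> V \<Longrightarrow> \<bar>k\<bar> \<le> V \<Longrightarrow> \<bar>v'\<bar> \<le> V \<Longrightarrow> \<bar>k'\<bar> \<le> V
      \<Longrightarrow> \<bar>forcing c r v k - forcing c r v' k'\<bar> \<le> L * r * (\<bar>v - v'\<bar> + \<bar>k - k'\<bar>)"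
proof -
  define W where "W = (\<bar>\<beta> - 1\<bar> + 1) * V"
  define K where "K = X * W * exp (X\<^sup>2 * W)"
  define m where "m = \<bar>2 - \<gamma>\<bar> + \<bar>1 + \<beta> - \<gamma>\<bar>"
  define L1 where "L1 = \<theta> * exp (\<bar>2 - \<gamma>\<bar> * \<bar>d0\<bar> + m * (X\<^sup>2 * V)) * X * m"
  define a where "a = 3 * (\<beta> - \<gamma>) / (\<beta> * (\<beta> - 1))"
  define e where "e = 3 * (\<beta> - \<gamma>) / \<beta> - c"
  define L where "L = L1 + \<bar>a\<bar> * (K * \<bar>\<beta> - 1\<bar>) + \<bar>e\<bar> * K + 1"
  have W: "0 \<le> W" and K: "0 \<le> K" and L1: "0 \<le> L1"
    using X V theta0 by (simp_all add: W_def K_def L1_def m_def)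
  show ?thesis
  proof (rule that[of L])
    show "0 < L" using K L1 by (simp add: L_def add_nonneg_pos)
    fix r v k v' k'
    assume r: "r \<in> {0..X}" and b: "\<bar>v\<bar> \<le> V" "\<bar>k\<bar> \<le> V" "\<bar>v'\<bar> \<le> V" "\<bar>k'\<bar> \<le> V"
    define x1 where "x1 = exp_rem (r\<^sup>2 * ((\<beta> - 1) * v)) / r\<^sup>2 - exp_rem (r\<^sup>2 * ((\<beta> - 1) * v')) / r\<^sup>2"
    define x2 where "x2 = exp_rem (r\<^sup>2 * (- v)) / r\<^sup>2 - exp_rem (r\<^sup>2 * (- v')) / r\<^sup>2"
    have W1: "\<bar>(\<beta> - 1) * x\<bar> \<le> W" "\<bar>- x\<bar> \<le> W" if "\<bar>x\<bar> \<le> V" for x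
    proof -
      have "\<bar>\<beta> - 1\<bar> * \<bar>x\<bar> \<le> \<bar>\<beta> - 1\<bar> * V" "0 \<le> \<bar>\<beta> - 1\<bar> * V" using that V by (auto intro: mult_left_mono)
      then show "\<bar>(\<beta> - 1) * x\<bar> \<le> W" "\<bar>- x\<bar> \<le> W"
        using that V unfolding W_def abs_mult distrib_right by linarith+
    qed
    have "\<bar>x1\<bar> \<le> K * r * \<bar>(\<beta> - 1) * v - (\<beta> - 1) * v'\<bar>"
      unfolding x1_def K_def by (rule exp_rem_scaled_lipschitz[OF W1(1) W1(1) r]) (rule b)+
    also have "\<bar>(\<beta> - 1) * v - (\<beta> - 1) * v'\<bar> = \<bar>\<beta> - 1\<bar> * \<bar>v - v'\<bar>"
      by (simp add: abs_mult flip: right_diff_distrib)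
    finally have x1: "\<bar>x1\<bar> \<le> (K * \<bar>\<beta> - 1\<bar>) * r * \<bar>v - v'\<bar>" by (simp only: mult_ac)
    have "\<bar>x2\<bar> \<le> K * r * \<bar>- v - - v'\<bar>"
      unfolding x2_def K_def by (rule exp_rem_scaled_lipschitz[OF W1(2) W1(2) r]) (rule b)+
    also have "\<bar>- v - - v'\<bar> = \<bar>v - v'\<bar>" by simp
    finally have x2: "\<bar>x2\<bar> \<le> K * r * \<bar>v - v'\<bar>" .
    have gr: "\<bar>gravity r v k - gravity r v' k'\<bar> \<le> L1 * r * (\<bar>v - v'\<bar> + \<bar>k - k'\<bar>)"
      unfolding L1_def m_def by (rule gravity_lipschitz[OF r b])
    have "forcing c r v k - forcing c r v' k' = (gravity r v k - gravity r v' k') - a * x1 - e * x2"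
      by (simp add: forcing_def a_def e_def x1_def x2_def algebra_simps)
    then have "\<bar>forcing c r v k - forcing c r v' k'\<bar>
        \<le> \<bar>gravity r v k - gravity r v' k'\<bar> + \<bar>a\<bar> * \<bar>x1\<bar> + \<bar>e\<bar> * \<bar>x2\<bar>"
      unfolding abs_mult[symmetric] by linarith
    also have "\<dots> \<le> L1 * r * (\<bar>v - v'\<bar> + \<bar>k - k'\<bar>) + \<bar>a\<bar> * ((K * \<bar>\<beta> - 1\<bar>) * r * \<bar>v - v'\<bar>)
        + \<bar>e\<bar> * (K * r * \<bar>v - v'\<bar>)"
      by (intro add_mono mult_left_mono gr x1 x2) auto
    also have "\<dots> \<le> L1 * r * (\<bar>v - v'\<bar> + \<bar>k - k'\<bar>) + \<bar>a\<bar> * ((K * \<bar>\<beta> - 1\<bar>) * r * (\<bar>v - v'\<bar> + \<bar>k - k'\<bar>))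
        + \<bar>e\<bar> * (K * r * (\<bar>v - v'\<bar> + \<bar>k - k'\<bar>)) + r * (\<bar>v - v'\<bar> + \<bar>k - k'\<bar>)"
    proof -
      have "\<bar>a\<bar> * ((K * \<bar>\<beta> - 1\<bar>) * r * \<bar>v - v'\<bar>) \<le> \<bar>a\<bar> * ((K * \<bar>\<beta> - 1\<bar>) * r * (\<bar>v - v'\<bar> + \<bar>k - k'\<bar>))"
        "\<bar>e\<bar> * (K * r * \<bar>v - v'\<bar>) \<le> \<bar>e\<bar> * (K * r * (\<bar>v - v'\<bar> + \<bar>k - k'\<bar>))"
        using K r by (intro mult_left_mono; simp)+
      moreover have "0 \<le> r * (\<bar>v - v'\<bar> + \<bar>k - k'\<bar>)" using r by simp
      ultimately show ?thesis by linarith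
    qed
    also have "\<dots> = L * r * (\<bar>v - v'\<bar> + \<bar>k - k'\<bar>)"
      by (simp add: L_def distrib_right mult.assoc)
    finally show "\<bar>forcing c r v k - forcing c r v' k'\<bar> \<le> L * r * (\<bar>v - v'\<bar> + \<bar>k - k'\<bar>)" .
  qed
qed

text \<open>Clipping \<open>v\<close> and \<open>k\<close> to \<open>[-V,V]\<close> makes the right-hand sides globally Lipschitz, so that solutions exist
on intervals of any length; they solve the original equations while the clipping is inactive.\<close>

definition clipped_forcing :: "real \<Rightarrow> real \<Rightarrow> real \<Rightarrow> real \<Rightarrow> real \<Rightarrow> real" where
  "clipped_forcing V c r v k = forcing c r (clip V v) (clip V k)"

lemma clipped_forcing_continuous:
  assumes "continuous_on S v" "continuous_on S k"
  shows "continuous_on S (\<lambda>r. clipped_forcing V c r (v r) (k r))"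
  unfolding clipped_forcing_def by (intro forcing_continuous continuous_on_clip assms)

lemma clipped_forcing_lipschitz:
  assumes X: "0 \<le> X" and V: "0 \<le> V"
  obtains L where "0 < L"
    "\<And>F r v k v' k'. F \<in> {clipped_forcing V 3, clipped_forcing V 0} \<Longrightarrow> r \<in> {0..X}
      \<Longrightarrow> \<bar>F r v k - F r v' k'\<bar> \<le> L * r * (\<bar>v - v'\<bar> + \<bar>k - k'\<bar>)"
proof -
  have one: "\<exists>L>0. \<forall>r\<in>{0..X}. \<forall>v k v' k'. \<bar>clipped_forcing V c r v k - clipped_forcing V c r v' k'\<bar>
      \<le> L * r * (\<bar>v - v'\<bar> + \<bar>k - k'\<bar>)" for c
  proof -
    obtain L where L: "0 < L"
      "\<And>r v k v' k'. r \<in> {0..X} \<Longrightarrow> \<bar>v\<bar> \<le> V \<Longrightarrow> \<bar>k\<bar> \<le> V \<Longrightarrow> \<bar>v'\<bar> \<le> V \<Longrightarrow> \<bar>k'\<bar> \<le> V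
        \<Longrightarrow> \<bar>forcing c r v k - forcing c r v' k'\<bar> \<le> L * r * (\<bar>v - v'\<bar> + \<bar>k - k'\<bar>)"
      using forcing_lipschitz[OF X V, of c] by blast
    have "\<bar>clipped_forcing V c r v k - clipped_forcing V c r v' k'\<bar> \<le> L * r * (\<bar>v - v'\<bar> + \<bar>k - k'\<bar>)"
      if r: "r \<in> {0..X}" for r v k v' k'
    proof -
      have "\<bar>clipped_forcing V c r v k - clipped_forcing V c r v' k'\<bar>
          \<le> L * r * (\<bar>clip V v - clip V v'\<bar> + \<bar>clip V k - clip V k'\<bar>)"
        unfolding clipped_forcing_def by (intro L(2) r clip_abs_le V)
      also have "\<dots> \<le> L * r * (\<bar>v - v'\<bar> + \<bar>k - k'\<bar>)"
        using L(1) r by (intro mult_left_mono add_mono clip_nonexpansive) auto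
      finally show ?thesis .
    qed
    then show ?thesis using L(1) by blast
  qed
  obtain L3 where L3: "0 < L3" "\<forall>r\<in>{0..X}. \<forall>v k v' k'. \<bar>clipped_forcing V 3 r v k - clipped_forcing V 3 r v' k'\<bar>
      \<le> L3 * r * (\<bar>v - v'\<bar> + \<bar>k - k'\<bar>)" using one[of 3] by (elim exE conjE)
  obtain L0 where L0: "0 < L0" "\<forall>r\<in>{0..X}. \<forall>v k v' k'. \<bar>clipped_forcing V 0 r v k - clipped_forcing V 0 r v' k'\<bar>
      \<le> L0 * r * (\<bar>v - v'\<bar> + \<bar>k - k'\<bar>)" using one[of 0] by (elim exE conjE)
  show ?thesis
  proof (rule that[of "L3 + L0"])
    fix F r v k v' k' assume F: "F \<in> {clipped_forcing V 3, clipped_forcing V 0}" and r: "r \<in> {0..X}"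
    have "0 \<le> r * (\<bar>v - v'\<bar> + \<bar>k - k'\<bar>)" using r by simp
    then have "0 \<le> L3 * (r * (\<bar>v - v'\<bar> + \<bar>k - k'\<bar>))" "0 \<le> L0 * (r * (\<bar>v - v'\<bar> + \<bar>k - k'\<bar>))"
      using L3(1) L0(1) by simp_all
    then show "\<bar>F r v k - F r v' k'\<bar> \<le> (L3 + L0) * r * (\<bar>v - v'\<bar> + \<bar>k - k'\<bar>)"
      using F spec[OF spec[OF spec[OF spec[OF bspec[OF L3(2) r], of v], of k], of v'], of k']
        spec[OF spec[OF spec[OF spec[OF bspec[OF L0(2) r], of v], of k], of v'], of k']
      unfolding distrib_right mult.assoc by auto
  qed (use L3(1) L0(1) in simp)
qed

definition clipped_solution :: "real \<Rightarrow> real \<Rightarrow> (real \<Rightarrow> real) \<Rightarrow> (real \<Rightarrow> real) \<Rightarrow> bool" where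
  "clipped_solution V X v k \<longleftrightarrow> continuous_on {0..X} v \<and> continuous_on {0..X} k \<and>
     (\<forall>r\<in>{0..X}. v r = power_avg 4 (\<lambda>s. clipped_forcing V 3 s (v s) (k s)) r \<and>
                 k r = power_avg 1 (\<lambda>s. clipped_forcing V 0 s (v s) (k s)) r)"

lemma clipped_solution_exists:
  assumes X: "0 \<le> X" and V: "0 \<le> V"
  obtains v k where "clipped_solution V X v k"
proof -
  obtain L where L: "0 < L"
    "\<And>F r v k v' k'. F \<in> {clipped_forcing V 3, clipped_forcing V 0} \<Longrightarrow> r \<in> {0..X}
      \<Longrightarrow> \<bar>F r v k - F r v' k'\<bar> \<le> L * r * (\<bar>v - v'\<bar> + \<bar>k - k'\<bar>)"
    using clipped_forcing_lipschitz[OF X V] by blast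
  obtain v k where "continuous_on {0..X} v" "continuous_on {0..X} k"
    "\<And>r. r \<in> {0..X} \<Longrightarrow> v r = power_avg 4 (\<lambda>s. clipped_forcing V 3 s (v s) (k s)) r"
    "\<And>r. r \<in> {0..X} \<Longrightarrow> k r = power_avg 1 (\<lambda>s. clipped_forcing V 0 s (v s) (k s)) r"
    by (rule coupled_averages_exist[where X = X and ?F1.0 = "clipped_forcing V 3" and ?F2.0 = "clipped_forcing V 0"
          and m = 4 and n = 1, OF L(1)])
      (use clipped_forcing_continuous L(2) in \<open>auto\<close>)
  then show ?thesis using that unfolding clipped_solution_def by blast
qed

lemma clipped_solution_unique:
  assumes V: "0 \<le> V" and s: "clipped_solution V Y v k" and s': "clipped_solution V Y v' k'"
    and r: "r \<in> {0..Y}"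
  shows "v r = v' r \<and> k r = k' r"
proof -
  have X: "0 \<le> Y" using r by simp
  obtain L where L: "0 < L"
    "\<And>F r v k v' k'. F \<in> {clipped_forcing V 3, clipped_forcing V 0} \<Longrightarrow> r \<in> {0..Y}
      \<Longrightarrow> \<bar>F r v k - F r v' k'\<bar> \<le> L * r * (\<bar>v - v'\<bar> + \<bar>k - k'\<bar>)"
    using clipped_forcing_lipschitz[OF X V] by blast
  show ?thesis
  proof (rule coupled_averages_unique[where Y = Y and ?F1.0 = "clipped_forcing V 3" and ?F2.0 = "clipped_forcing V 0"
          and v = v and k = k and v' = v' and k' = k' and m = 4 and n = 1, OF L(1)])
    show "continuous_on {0..Y} (\<lambda>r. F r (v r) (k r))"
      if "F \<in> {clipped_forcing V 3, clipped_forcing V 0}" "continuous_on {0..Y} v" "continuous_on {0..Y} k" for F v k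
      using that clipped_forcing_continuous by auto
    show "v r = power_avg 4 (\<lambda>s. clipped_forcing V 3 s (v s) (k s)) r"
      "k r = power_avg 1 (\<lambda>s. clipped_forcing V 0 s (v s) (k s)) r"
      "v' r = power_avg 4 (\<lambda>s. clipped_forcing V 3 s (v' s) (k' s)) r"
      "k' r = power_avg 1 (\<lambda>s. clipped_forcing V 0 s (v' s) (k' s)) r" if "r \<in> {0..Y}" for r
      using that s s' unfolding clipped_solution_def by blast+
  qed (use L(2) s s' r in \<open>auto simp: clipped_solution_def\<close>)
qed

lemma clipped_solution_mono:
  "clipped_solution V X v k \<Longrightarrow> Y \<le> X \<Longrightarrow> clipped_solution V Y v k"
  unfolding clipped_solution_def by (auto elim: continuous_on_subset)

lemma scaled_solution_imp_clipped:
  assumes s: "scaled_solution R v k" and Y: "Y \<in> radii R" "0 < Y"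
    and bd: "\<And>r. r \<in> {0..Y} \<Longrightarrow> \<bar>v r\<bar> \<le> V \<and> \<bar>k r\<bar> \<le> V"
  shows "clipped_solution V Y v k"
proof -
  have sub: "{0..Y} \<subseteq> radii R" using radii_down Y by auto
  then have c: "continuous_on {0..Y} v" "continuous_on {0..Y} k"
    using s continuous_on_subset unfolding scaled_solution_def by blast+
  have cl: "clipped_forcing V c r (v r) (k r) = forcing c r (v r) (k r)" if "r \<in> {0..Y}" for c r
    using bd[OF that] by (simp add: clipped_forcing_def clip_inactive)
  have ode: "(v has_real_derivative (clipped_forcing V 3 r (v r) (k r) - real (Suc 4) * v r) / r) (at r)"
    "(k has_real_derivative (clipped_forcing V 0 r (v r) (k r) - real (Suc 1) * k r) / r) (at r)"
    if "0 < r" "r < Y" for r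
  proof -
    have "r \<in> radii R - {0}" "r \<in> {0..Y}" using that sub by auto
    then show "(v has_real_derivative (clipped_forcing V 3 r (v r) (k r) - real (Suc 4) * v r) / r) (at r)"
      "(k has_real_derivative (clipped_forcing V 0 r (v r) (k r) - real (Suc 1) * k r) / r) (at r)"
      using s unfolding scaled_solution_def by (simp_all add: cl)
  qed
  have "v r = power_avg 4 (\<lambda>s. clipped_forcing V 3 s (v s) (k s)) r" if r: "r \<in> {0..Y}" for r
    by (rule power_avg_unique[OF clipped_forcing_continuous[OF c] c(1) ode(1) Y(2) r])
  moreover have "k r = power_avg 1 (\<lambda>s. clipped_forcing V 0 s (v s) (k s)) r" if r: "r \<in> {0..Y}" for r
    by (rule power_avg_unique[OF clipped_forcing_continuous[OF c] c(2) ode(2) Y(2) r])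
  ultimately show ?thesis using c by (auto simp: clipped_solution_def)
qed

lemma clipped_solution_imp_scaled:
  assumes s: "clipped_solution V X v k" and Z: "0 < Z" "Z \<le> X"
    and bd: "\<And>r. r \<in> {0..<Z} \<Longrightarrow> \<bar>v r\<bar> \<le> V \<and> \<bar>k r\<bar> \<le> V"
  shows "scaled_solution (ereal Z) v k"
proof -
  have c: "continuous_on {0..X} v" "continuous_on {0..X} k" using s by (auto simp: clipped_solution_def)
  have deriv: "(w has_real_derivative (clipped_forcing V c r (v r) (k r) - real (Suc n) * w r) / r) (at r)"
    if w: "\<And>r. r \<in> {0..X} \<Longrightarrow> w r = power_avg n (\<lambda>s. clipped_forcing V c s (v s) (k s)) r"
      and r: "0 < r" "r < Z" for w c n r
  proof -
    have "(power_avg n (\<lambda>s. clipped_forcing V c s (v s) (k s)) has_real_derivative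
       (clipped_forcing V c r (v r) (k r) - real (Suc n) * w r) / r) (at r)"
      using power_avg_DERIV[OF clipped_forcing_continuous[OF c], where r = r and n = n] w[of r] r Z by simp
    then show ?thesis
      by (rule has_field_derivative_transform_within_open[of _ _ _ "{0<..<Z}"]) (use r Z w in auto)
  qed
  have "(v has_real_derivative (forcing 3 r (v r) (k r) - 5 * v r) / r) (at r) \<and>
        (k has_real_derivative (forcing 0 r (v r) (k r) - 2 * k r) / r) (at r)"
    if r: "0 < r" "r < Z" for r
    using deriv[of v 4 3 r] deriv[of k 1 0 r] r s bd[of r]
    by (simp add: clipped_solution_def clipped_forcing_def clip_inactive)
  then show ?thesis
    unfolding scaled_solution_def radii_ereal
    using c Z by (auto elim!: continuous_on_subset)
qed

lemma clipped_solution_unclips: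
  assumes s: "clipped_solution V X v k" and Y: "0 \<le> Y" "Y < X"
    and bd: "\<And>r. r \<in> {0..Y} \<Longrightarrow> \<bar>v r\<bar> < V \<and> \<bar>k r\<bar> < V"
  obtains Z where "Y < Z" "scaled_solution (ereal Z) v k"
proof -
  have c: "continuous_on {0..X} v" "continuous_on {0..X} k" using s by (auto simp: clipped_solution_def)
  obtain Z1 where Z1: "Y < Z1" "Z1 \<le> X" "\<And>r. r \<in> {0..<Z1} \<Longrightarrow> \<bar>v r\<bar> < V"
    using continuous_on_strict_bound_persists[OF c(1) Y, of V] bd by blast
  obtain Z2 where Z2: "Y < Z2" "Z2 \<le> X" "\<And>r. r \<in> {0..<Z2} \<Longrightarrow> \<bar>k r\<bar> < V"
    using continuous_on_strict_bound_persists[OF c(2) Y, of V] bd by blast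
  have "scaled_solution (ereal (min Z1 Z2)) v k"
    by (rule clipped_solution_imp_scaled[OF s]) (use Z1 Z2 Y in \<open>auto intro: less_imp_le\<close>)
  then show ?thesis using that[of "min Z1 Z2"] Z1 Z2 by simp
qed

text \<open>The equations force \<open>v 0 = forcing / 5\<close> and \<open>k 0 = forcing / 2\<close> at \<open>r = 0\<close>, so a clipping level slightly above
the value of the forcing at the centre is inactive for small \<open>r\<close>.\<close>

lemma scaled_solution_exists_locally:
  obtains Z v k where "0 < Z" "scaled_solution (ereal Z) v k"
proof -
  define V where "V = \<theta> * exp ((2 - \<gamma>) * d0) + 1"
  have V: "1 < V" using theta0 by (simp add: V_def)
  obtain v k where vk: "clipped_solution V 1 v k"
    using clipped_solution_exists[of 1 V] V by auto
  have "v 0 = power_avg 4 (\<lambda>s. clipped_forcing V 3 s (v s) (k s)) 0"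
    "k 0 = power_avg 1 (\<lambda>s. clipped_forcing V 0 s (v s) (k s)) 0"
    using vk unfolding clipped_solution_def by simp_all
  then have "v 0 = (V - 1) / 5" "k 0 = (V - 1) / 2"
    unfolding power_avg_zero clipped_forcing_def forcing_at_0 by (simp_all add: V_def)
  then have "\<bar>v r\<bar> < V \<and> \<bar>k r\<bar> < V" if "r \<in> {0..0}" for r using that V by auto
  then show ?thesis
    using clipped_solution_unclips[OF vk, of 0] that by auto
qed

lemma scaled_solution_local_bound:
  assumes s: "scaled_solution R v k" and Y: "Y \<in> radii R"
  obtains V where "0 \<le> V" "\<And>r. r \<in> {0..Y} \<Longrightarrow> \<bar>v r\<bar> \<le> V \<and> \<bar>k r\<bar> \<le> V"
proof -
  have "{0..Y} \<subseteq> radii R" using radii_down Y by auto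
  then have c: "continuous_on {0..Y} v" "continuous_on {0..Y} k"
    using s continuous_on_subset unfolding scaled_solution_def by blast+
  obtain V1 where "0 \<le> V1" "\<And>r. r \<in> {0..Y} \<Longrightarrow> norm (v r) \<le> V1"
    using continuous_on_Icc_norm_bound[OF c(1)] by blast
  moreover obtain V2 where "\<And>r. r \<in> {0..Y} \<Longrightarrow> norm (k r) \<le> V2"
    using continuous_on_Icc_norm_bound[OF c(2)] by blast
  ultimately show ?thesis using that[of "max V1 V2"] by (simp add: le_max_iff_disj)
qed

lemma scaled_solution_unique:
  assumes s: "scaled_solution R v k" and s': "scaled_solution R' v' k'"
    and r: "r \<in> radii R" "r \<in> radii R'"
  shows "v r = v' r \<and> k r = k' r"
proof -
  obtain Y1 where Y1: "r < Y1" "Y1 \<in> radii R" using radii_larger[OF r(1)] .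
  obtain Y2 where Y2: "r < Y2" "Y2 \<in> radii R'" using radii_larger[OF r(2)] .
  note Y = Y1 Y2
  define Y where "Y = min Y1 Y2"
  have Y0: "r < Y" "0 < Y" using Y radii_ge0[OF r(1)] by (auto simp: Y_def)
  have YR: "Y \<in> radii R" "Y \<in> radii R'"
    using radii_down[OF Y(2), of Y] radii_down[OF Y(4), of Y] Y0 by (auto simp: Y_def)
  obtain V where V: "0 \<le> V" "\<And>r. r \<in> {0..Y} \<Longrightarrow> \<bar>v r\<bar> \<le> V \<and> \<bar>k r\<bar> \<le> V"
    using scaled_solution_local_bound[OF s YR(1)] by blast
  obtain V' where V': "0 \<le> V'" "\<And>r. r \<in> {0..Y} \<Longrightarrow> \<bar>v' r\<bar> \<le> V' \<and> \<bar>k' r\<bar> \<le> V'"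
    using scaled_solution_local_bound[OF s' YR(2)] by blast
  have "clipped_solution (max V V') Y v k" "clipped_solution (max V V') Y v' k'"
    using V V' by (auto intro!: scaled_solution_imp_clipped[OF s YR(1) Y0(2)] scaled_solution_imp_clipped[OF s' YR(2) Y0(2)]
        simp: le_max_iff_disj)
  then show ?thesis
    using V Y0 radii_ge0[OF r(1)] by (intro clipped_solution_unique[of "max V V'" Y]) auto
qed

text \<open>Clip at the level \<open>V + 1\<close>, which is out of reach on \<open>[0,R)\<close>. By uniqueness the clipped solution on
\<open>[0,R + 1]\<close> continues the given one, and by continuity it stays below \<open>V + 1\<close> a little beyond \<open>R\<close>.\<close>

lemma bounded_scaled_solution_extends:
  assumes s: "scaled_solution (ereal R) v k"
    and bd: "\<And>r. r \<in> {0..<R} \<Longrightarrow> \<bar>v r\<bar> \<le> V \<and> \<bar>k r\<bar> \<le> V"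
  obtains Z v' k' where "R < Z" "scaled_solution (ereal Z) v' k'"
proof -
  have R: "0 < R" using s by (simp add: scaled_solution_def)
  have V: "0 \<le> V" using bd[of 0] R by auto
  obtain v' k' where s': "clipped_solution (V + 1) (R + 1) v' k'"
    using clipped_solution_exists[of "R + 1" "V + 1"] R V by auto
  then have c: "continuous_on {0..R} v'" "continuous_on {0..R} k'"
    by (auto simp: clipped_solution_def elim: continuous_on_subset)
  have eq: "v r = v' r \<and> k r = k' r" if r: "r \<in> {0..<R}" for r
  proof -
    define Y where "Y = (r + R) / 2"
    have Y: "r < Y" "Y < R" "0 < Y" using r R by (auto simp: Y_def)
    have "clipped_solution (V + 1) Y v k"
    proof (rule scaled_solution_imp_clipped[OF s _ Y(3)])
      show "\<bar>v x\<bar> \<le> V + 1 \<and> \<bar>k x\<bar> \<le> V + 1" if "x \<in> {0..Y}" for x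
        using bd[of x] that Y by simp
    qed (use Y in \<open>auto simp: radii_ereal\<close>)
    moreover have "clipped_solution (V + 1) Y v' k'"
      by (rule clipped_solution_mono[OF s']) (use Y in auto)
    ultimately show ?thesis
      by (rule clipped_solution_unique[rotated]) (use V Y r in auto)
  qed
  have lim: "\<bar>f R\<bar> \<le> V" if "continuous_on {0..R} f" "\<And>r. r \<in> {0..<R} \<Longrightarrow> \<bar>f r\<bar> \<le> V" for f :: "real \<Rightarrow> real"
  proof (rule tendsto_upperbound)
    show "((\<lambda>r. \<bar>f r\<bar>) \<longlongrightarrow> \<bar>f R\<bar>) (at R within {0..R})"
      using that(1) R by (intro tendsto_intros) (auto simp: continuous_on_def)
    show "eventually (\<lambda>r. \<bar>f r\<bar> \<le> V) (at R within {0..R})"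
      using that(2) by (auto simp: eventually_at_filter)
    show "at R within {0..R} \<noteq> bot" using R by (simp add: at_within_Icc_at_left)
  qed
  have "\<bar>v' r\<bar> < V + 1 \<and> \<bar>k' r\<bar> < V + 1" if "r \<in> {0..R}" for r
  proof (cases "r = R")
    case True
    then show ?thesis using lim[OF c(1)] lim[OF c(2)] bd eq by force
  next
    case False
    then show ?thesis using bd[of r] eq[of r] that by auto
  qed
  then show ?thesis
    using clipped_solution_unclips[OF s' less_imp_le[OF R]] that by (metis less_add_one)
qed

text \<open>Solutions agree on common intervals, so the supremum of all intervals of existence carries a
solution itself (\<open>maximal_scaled_solution\<close>).\<close>

definition R_sup :: ereal where
  "R_sup = Sup {R. \<exists>v k. scaled_solution R v k}"

lemma scaled_solution_le_R_sup: "scaled_solution R v k \<Longrightarrow> R \<le> R_sup"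
  unfolding R_sup_def by (rule Sup_upper) blast

lemma maximal_scaled_solution:
  obtains v k where "scaled_solution R_sup v k"
proof -
  obtain Z v0 k0 where Z: "0 < Z" "scaled_solution (ereal Z) v0 k0"
    by (rule scaled_solution_exists_locally)
  have "0 < ereal Z" using Z by simp
  also have "\<dots> \<le> R_sup" by (rule scaled_solution_le_R_sup[OF Z(2)])
  finally have R0: "0 < R_sup" .
  have "\<exists>R v k. scaled_solution R v k \<and> r \<in> radii R" if "r \<in> radii R_sup" for r
    using that unfolding R_sup_def radii_def by (auto simp: less_Sup_iff)
  then obtain R v k where vk: "\<And>r. r \<in> radii R_sup \<Longrightarrow> scaled_solution (R r) (v r) (k r) \<and> r \<in> radii (R r)"
    by metis
  define v' where "v' r = v r r" for r
  define k' where "k' r = k r r" for r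
  have eq: "v' s = v r s \<and> k' s = k r s" if r: "r \<in> radii R_sup" and s: "s \<in> radii (R r)" for r s
  proof -
    have "s \<in> radii R_sup" using radii_mono[OF s] scaled_solution_le_R_sup vk[OF r] by blast
    then show ?thesis
      unfolding v'_def k'_def using scaled_solution_unique[of "R s" "v s" "k s" "R r" "v r" "k r" s] vk r s by blast
  qed
  have "scaled_solution R_sup v' k'"
    unfolding scaled_solution_def
  proof (intro conjI ballI R0)
    have c: "continuous_on (radii (R r)) v' \<and> continuous_on (radii (R r)) k' \<and> R r \<le> R_sup \<and> r \<in> radii (R r)"
      if r: "r \<in> radii R_sup" for r
    proof -
      have "continuous_on (radii (R r)) (v r)" "continuous_on (radii (R r)) (k r)"
        using vk[OF r] by (auto simp: scaled_solution_def)
      then show ?thesis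
        using eq[OF r] vk[OF r] scaled_solution_le_R_sup by (auto cong: continuous_on_cong)
    qed
    show "continuous_on (radii R_sup) v'" "continuous_on (radii R_sup) k'"
      by (rule continuous_on_radii_local, use c in blast)+
  next
    fix r assume r: "r \<in> radii R_sup - {0}"
    then have sr: "scaled_solution (R r) (v r) (k r)" and rr: "r \<in> radii (R r)" "0 < r"
      using vk radii_ge0[of r R_sup] by auto
    obtain a where a: "r \<in> {0<..<a}" "{0..a} \<subseteq> radii (R r)" using radii_interior[OF rr] .
    have *: "v r x = v' x" "k r x = k' x" if "x \<in> {0<..<a}" for x
      using eq[of r x] r a(2) that subsetD[OF a(2), of x] by auto
    have here: "v' r = v r r" "k' r = k r r" by (simp_all add: v'_def k'_def)
    have d: "(v r has_real_derivative (forcing 3 r (v r r) (k r r) - 5 * v r r) / r) (at r)"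
        "(k r has_real_derivative (forcing 0 r (v r r) (k r r) - 2 * k r r) / r) (at r)"
      using sr rr unfolding scaled_solution_def by auto
    show "(v' has_real_derivative (forcing 3 r (v' r) (k' r) - 5 * v' r) / r) (at r)"
      using has_field_derivative_transform_within_open[OF d(1) _ a(1) *(1)] by (simp add: here)
    show "(k' has_real_derivative (forcing 0 r (v' r) (k' r) - 2 * k' r) / r) (at r)"
      using has_field_derivative_transform_within_open[OF d(2) _ a(1) *(2)] by (simp add: here)
  qed
  then show ?thesis by (rule that)
qed

end

section \<open>Functions with vanishing derivative at the centre\<close>

text \<open>This class is closed under the operations in the equations of state, and membership yields both the
\<open>C\<^sup>1\<close> property and the vanishing derivative at the centre that a ball requires.\<close>

definition C1_flat :: "real set \<Rightarrow> (real \<Rightarrow> real) \<Rightarrow> bool" where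
  "C1_flat S f \<longleftrightarrow>
     (\<exists>f'. f' 0 = 0 \<and> continuous_on S f' \<and> (\<forall>x\<in>S. (f has_real_derivative f' x) (at x within S)))"

lemma C1_flat_continuous: "C1_flat S f \<Longrightarrow> continuous_on S f"
  unfolding C1_flat_def by (auto intro: DERIV_continuous_on)

lemma C1_flat_const: "C1_flat S (\<lambda>_. c)"
  unfolding C1_flat_def by (intro exI[of _ "\<lambda>_. 0"]) auto

lemma C1_flat_add:
  assumes "C1_flat S f" "C1_flat S g" shows "C1_flat S (\<lambda>x. f x + g x)"
proof -
  obtain f' g' where "f' 0 = 0" "continuous_on S f'" "\<forall>x\<in>S. (f has_real_derivative f' x) (at x within S)"
    "g' 0 = 0" "continuous_on S g'" "\<forall>x\<in>S. (g has_real_derivative g' x) (at x within S)"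
    using assms unfolding C1_flat_def by blast
  then show ?thesis unfolding C1_flat_def
    by (intro exI[of _ "\<lambda>x. f' x + g' x"]) (auto intro!: continuous_intros DERIV_add)
qed

lemma C1_flat_cmult:
  assumes "C1_flat S f" shows "C1_flat S (\<lambda>x. c * f x)"
proof -
  obtain f' where "f' 0 = 0" "continuous_on S f'" "\<forall>x\<in>S. (f has_real_derivative f' x) (at x within S)"
    using assms unfolding C1_flat_def by blast
  then show ?thesis unfolding C1_flat_def
    by (intro exI[of _ "\<lambda>x. c * f' x"]) (auto intro!: continuous_intros DERIV_cmult)
qed

lemma C1_flat_exp:
  assumes f: "C1_flat S f" shows "C1_flat S (\<lambda>x. exp (f x))"
proof -
  obtain f' where f': "f' 0 = 0" "continuous_on S f'" "\<forall>x\<in>S. (f has_real_derivative f' x) (at x within S)"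
    using f unfolding C1_flat_def by blast
  have "((\<lambda>x. exp (f x)) has_real_derivative exp (f x) * f' x) (at x within S)" if "x \<in> S" for x
    by (rule derivative_eq_intros bspec[OF f'(3) that] refl)+
  then show ?thesis unfolding C1_flat_def
    using f' C1_flat_continuous[OF f]
    by (intro exI[of _ "\<lambda>x. exp (f x) * f' x"]) (auto intro!: continuous_intros)
qed

lemma C1_flat_cong:
  assumes f: "C1_flat S f" and eq: "\<And>x. x \<in> S \<Longrightarrow> g x = f x" shows "C1_flat S g"
proof -
  obtain f' where f': "f' 0 = 0" "continuous_on S f'" "\<forall>x\<in>S. (f has_real_derivative f' x) (at x within S)"
    using f unfolding C1_flat_def by blast
  have "(g has_real_derivative f' x) (at x within S)" if "x \<in> S" for x
    using has_derivative_transform[of x S g f, OF that eq] f'(3) that unfolding has_field_derivative_def by blast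
  with f' show ?thesis unfolding C1_flat_def by blast
qed

lemma C1_flat_subset:
  assumes "C1_flat S f" "T \<subseteq> S" shows "C1_flat T f"
  using assms unfolding C1_flat_def by (blast intro: continuous_on_subset DERIV_subset)

lemma C1_flat_imp_C1_within: "C1_flat S f \<Longrightarrow> C1_within S f"
  unfolding C1_flat_def C1_within_def by blast

lemma C1_flat_deriv_tendsto:
  assumes R: "0 < R" and f: "C1_flat (radii R) f" shows "(deriv f \<longlongrightarrow> 0) (at_right 0)"
proof -
  obtain f' where f': "f' 0 = 0" "continuous_on (radii R) f'"
    "\<forall>x\<in>radii R. (f has_real_derivative f' x) (at x within radii R)"
    using f unfolding C1_flat_def by blast
  obtain a where a: "0 < a" "{0..a} \<subseteq> radii R" using radii_initial_segment[OF R] .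
  have "continuous_on {0..a} f'" using f'(2) a(2) by (rule continuous_on_subset)
  then have "(f' \<longlongrightarrow> f' 0) (at 0 within {0..a})" using a(1) by (simp add: continuous_on_def)
  then have "(f' \<longlongrightarrow> 0) (at_right 0)" using a(1) f'(1) by (simp add: at_within_Icc_at_right)
  moreover have "eventually (\<lambda>r. f' r = deriv f r) (at_right 0)"
    using eventually_at_right_radii[OF R]
  proof eventually_elim
    case (elim r)
    then have "(f has_real_derivative f' r) (at r)" using f'(3) at_within_radii by metis
    then show ?case by (rule DERIV_imp_deriv[symmetric])
  qed
  ultimately show ?thesis by (rule Lim_transform_eventually)
qed

text \<open>A solution of the scaled equations is only continuous at \<open>0\<close>; the factor \<open>r\<^sup>2\<close> supplies the
differentiability.\<close>

lemma C1_flat_square_times: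
  assumes w: "continuous_on (radii R) w" and g: "continuous_on (radii R) g"
    and ode: "\<And>r. r \<in> radii R \<Longrightarrow> 0 < r \<Longrightarrow> (w has_real_derivative (g r - c * w r) / r) (at r)"
  shows "C1_flat (radii R) (\<lambda>r. r\<^sup>2 * w r)"
  unfolding C1_flat_def
proof (intro exI conjI ballI)
  show "continuous_on (radii R) (\<lambda>r. r * (g r + (2 - c) * w r))" by (intro continuous_intros w g)
  fix r assume r: "r \<in> radii R"
  show "((\<lambda>r. r\<^sup>2 * w r) has_real_derivative r * (g r + (2 - c) * w r)) (at r within radii R)"
  proof (cases "r = 0")
    case True
    then have "((\<lambda>x. x * w x) \<longlongrightarrow> 0 * w 0) (at 0 within radii R)"
      using w r by (intro tendsto_intros) (auto simp: continuous_on_def)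
    then have "((\<lambda>x. x\<^sup>2 * w x) has_real_derivative 0) (at 0 within radii R)"
      unfolding has_field_derivative_iff mult_zero_left
      by (rule Lim_transform_eventually) (auto simp: eventually_at_filter power2_eq_square)
    then show ?thesis using True by simp
  next
    case False
    then have r0: "0 < r" using radii_ge0[OF r] by simp
    have "((\<lambda>r. r\<^sup>2 * w r) has_real_derivative r * (g r + (2 - c) * w r)) (at r)"
      by (rule derivative_eq_intros ode[OF r r0] refl)+ (use r0 in \<open>simp add: field_simps power2_eq_square\<close>)
    then show ?thesis by (rule has_field_derivative_at_within)
  qed
qed simp

section \<open>Strongly regular solutions and scaled solutions\<close>

locale elastic_ball =
  fixes G K \<kappa> \<nu> \<gamma> \<beta> dc :: real
  assumes G0: "0 < G" and K0: "0 < K" and kappa0: "0 < \<kappa>" and dc0: "0 < dc"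
    and nu: "-1 < \<nu>" "\<nu> < 1 / 2" and gamma0: "0 < \<gamma>"
    and beta_ne: "\<beta> \<noteq> 0" "\<beta> \<noteq> 1"
begin

abbreviation \<theta> where "\<theta> \<equiv> theta G K \<kappa> \<nu>"

lemma theta_pos: "0 < \<theta>"
  using G0 K0 kappa0 nu by (simp add: theta_def)

sublocale scaled_flow \<beta> \<gamma> \<theta> "ln dc"
  by unfold_locales (use beta_ne theta_pos in auto)

abbreviation "regular \<equiv> strongly_regular_solution G K \<kappa> \<nu> \<gamma> \<beta>"

definition local_density :: "(real \<Rightarrow> real) \<Rightarrow> real \<Rightarrow> real" where
  "local_density k r = dc * exp (- (r\<^sup>2 * k r))"

definition average_density :: "(real \<Rightarrow> real) \<Rightarrow> (real \<Rightarrow> real) \<Rightarrow> real \<Rightarrow> real" where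
  "average_density v k r = dc * exp (r\<^sup>2 * v r - r\<^sup>2 * k r)"

lemma local_density_pos: "0 < local_density k r" and average_density_pos: "0 < average_density v k r"
  using dc0 by (simp_all add: local_density_def average_density_def)

text \<open>The density equation in logarithmic form. The computation is
\<open>y powr (1 - \<beta>) B y = y (exp_rem ((\<beta> - 1) p) + (\<beta> - 1) exp_rem (- p)) / (\<beta> (\<beta> - 1))\<close> for \<open>y = exp (- p)\<close>: in the
numerator of \<open>B\<close> the terms of order \<open>0\<close> and \<open>1\<close> in \<open>p\<close> cancel.\<close>

lemma density_forcing:
  assumes "0 < \<delta>" "0 < \<eta>" "0 < r" and v: "ln \<eta> - ln \<delta> = r\<^sup>2 * v" and k: "ln dc - ln \<delta> = r\<^sup>2 * k"
  shows "(\<delta> / \<eta>) powr (1 - \<beta>) *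
      (3 * (\<beta> - \<gamma>) / r * B \<beta> (\<delta> / \<eta>) * \<eta> - \<theta> * r * \<eta> powr (2 - \<gamma>) * \<delta>) = - \<delta> * r * forcing 0 r v k"
proof -
  define p where "p = r\<^sup>2 * v"
  define y where "y = exp (- p)"
  have y: "\<delta> / \<eta> = y" "0 < y"
  proof -
    have "ln (\<delta> / \<eta>) = - p" using v assms by (simp add: p_def ln_div)
    then show "\<delta> / \<eta> = y" unfolding y_def using assms by (metis exp_ln divide_pos_pos)
  qed (simp add: y_def)
  have powy: "y powr a = exp (- (a * p))" for a by (simp add: y_def powr_def)
  have de: "\<delta> = y * \<eta>" using y assms by (simp add: field_simps)
  have g: "y powr (1 - \<beta>) * \<eta> powr (2 - \<gamma>) * \<theta> = gravity r v k"
  proof -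
    have h: "ln \<eta> = ln dc - r\<^sup>2 * k + p" using v k by (simp add: p_def)
    have "\<eta> powr (2 - \<gamma>) = exp ((2 - \<gamma>) * (ln dc - r\<^sup>2 * k + p))" using assms by (simp add: powr_def h)
    then show ?thesis
      unfolding gravity_def powy p_def[symmetric] by (simp add: algebra_simps flip: exp_add)
  qed
  define D where "D = \<beta> * (\<beta> - 1)"
  have D0: "D \<noteq> 0" using beta_ne by (simp add: D_def)
  have B: "y powr (1 - \<beta>) * B \<beta> y = y * ((exp_rem ((\<beta> - 1) * p) + (\<beta> - 1) * exp_rem (- p)) / D)"
  proof -
    have e1: "y powr (1 - \<beta>) * y = y * exp ((\<beta> - 1) * p)"
      unfolding powy by (simp add: algebra_simps)
    have e2: "y powr (1 - \<beta>) * y powr (1 + \<beta>) = y * y"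
      using y(2) by (simp flip: powr_add add: powr_numeral power2_eq_square)
    have e3: "y powr (1 - \<beta>) * y powr \<beta> = y"
      using y(2) by (simp flip: powr_add)
    have "y powr (1 - \<beta>) * (y + (\<beta> - 1) * y powr (1 + \<beta>) - \<beta> * y powr \<beta>)
        = y powr (1 - \<beta>) * y + (\<beta> - 1) * (y powr (1 - \<beta>) * y powr (1 + \<beta>)) - \<beta> * (y powr (1 - \<beta>) * y powr \<beta>)"
      by (simp add: algebra_simps)
    also have "\<dots> = y * (exp ((\<beta> - 1) * p) + (\<beta> - 1) * y - \<beta>)"
      unfolding e1 e2 e3 by (simp add: algebra_simps)
    also have "\<dots> = y * (exp_rem ((\<beta> - 1) * p) + (\<beta> - 1) * exp_rem (- p))"
      by (simp add: exp_rem_def y_def algebra_simps)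
    finally show ?thesis by (simp add: B_def D_def)
  qed
  have "y powr (1 - \<beta>) * (3 * (\<beta> - \<gamma>) / r * B \<beta> y * \<eta> - \<theta> * r * \<eta> powr (2 - \<gamma>) * \<delta>)
      = 3 * (\<beta> - \<gamma>) / r * (y powr (1 - \<beta>) * B \<beta> y) * \<eta> - r * \<delta> * (y powr (1 - \<beta>) * \<eta> powr (2 - \<gamma>) * \<theta>)"
    by (simp add: algebra_simps)
  also have "\<dots> = 3 * (\<beta> - \<gamma>) / r * ((exp_rem ((\<beta> - 1) * p) + (\<beta> - 1) * exp_rem (- p)) / D) * \<delta> - r * \<delta> * gravity r v k"
    unfolding g B de by simp
  also have "\<dots> = - \<delta> * r * forcing 0 r v k"
  proof -
    have "r\<^sup>2 * forcing 0 r v k = r\<^sup>2 * gravity r v k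
        - 3 * (\<beta> - \<gamma>) * ((exp_rem ((\<beta> - 1) * p) + (\<beta> - 1) * exp_rem (- p)) / D)"
    proof -
      define E1 where "E1 = exp_rem ((\<beta> - 1) * p)"
      define E2 where "E2 = exp_rem (- p)"
      have c: "3 * (\<beta> - \<gamma>) / \<beta> - 0 = 3 * (\<beta> - \<gamma>) * (\<beta> - 1) / D"
        using beta_ne by (simp add: D_def)
      have p: "r\<^sup>2 * ((\<beta> - 1) * v) = (\<beta> - 1) * p" "r\<^sup>2 * (- v) = - p" by (simp_all add: p_def)
      have "forcing 0 r v k = gravity r v k - 3 * (\<beta> - \<gamma>) / D * (E1 / r\<^sup>2)
          - 3 * (\<beta> - \<gamma>) * (\<beta> - 1) / D * (E2 / r\<^sup>2)"
        unfolding forcing_def c p D_def E1_def E2_def by (rule refl)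
      then show ?thesis
        unfolding E1_def[symmetric] E2_def[symmetric] using assms(3) D0 by (simp add: right_diff_distrib add_divide_distrib distrib_left)
    qed
    then have "\<delta> / r * (r\<^sup>2 * forcing 0 r v k) = \<delta> / r * (r\<^sup>2 * gravity r v k
        - 3 * (\<beta> - \<gamma>) * ((exp_rem ((\<beta> - 1) * p) + (\<beta> - 1) * exp_rem (- p)) / D))" by simp
    then show ?thesis using assms(3) by (simp add: power2_eq_square right_diff_distrib mult_ac)
  qed
  finally show ?thesis unfolding y(1) .
qed

lemma mean_forcing:
  assumes "0 < \<delta>" "0 < \<eta>" "0 < r" and v: "ln \<eta> - ln \<delta> = r\<^sup>2 * v"
  shows "- (3 / r) * (\<eta> - \<delta>) = \<eta> * r * (forcing 3 r v k - 3 * v - forcing 0 r v k)"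
proof -
  have "ln (\<delta> / \<eta>) = - (r\<^sup>2 * v)" using v assms by (simp add: ln_div)
  then have "\<delta> / \<eta> = exp (- (r\<^sup>2 * v))" using assms by (metis exp_ln divide_pos_pos)
  then have d: "\<delta> = \<eta> * exp (- (r\<^sup>2 * v))" using assms by (simp add: field_simps)
  have "forcing 3 r v k - forcing 0 r v k = 3 * (exp_rem (r\<^sup>2 * (- v)) / r\<^sup>2)"
    by (simp add: forcing_def algebra_simps)
  also have "\<dots> = 3 * (exp (- (r\<^sup>2 * v)) - 1) / r\<^sup>2 + 3 * v"
    using assms(3) by (simp add: exp_rem_def field_simps)
  finally have E: "forcing 3 r v k - 3 * v - forcing 0 r v k = 3 * (exp (- (r\<^sup>2 * v)) - 1) / r\<^sup>2" by simp
  show ?thesis unfolding E d using assms(3) by (simp add: field_simps power2_eq_square)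
qed

lemma scaled_solution_C1_flat:
  assumes s: "scaled_solution R v k"
  shows "C1_flat (radii R) (\<lambda>r. r\<^sup>2 * v r)" "C1_flat (radii R) (\<lambda>r. r\<^sup>2 * k r)"
proof -
  have c: "continuous_on (radii R) v" "continuous_on (radii R) k"
    using s by (auto simp: scaled_solution_def)
  show "C1_flat (radii R) (\<lambda>r. r\<^sup>2 * v r)" "C1_flat (radii R) (\<lambda>r. r\<^sup>2 * k r)"
    using s c
      C1_flat_square_times[OF c(1) forcing_continuous[OF c, of 3], of 5]
      C1_flat_square_times[OF c(2) forcing_continuous[OF c, of 0], of 2]
    by (auto simp: scaled_solution_def)
qed

lemma scaled_imp_regular:
  assumes s: "scaled_solution R v k"
  shows "regular R (local_density k) (average_density v k)" "local_density k 0 = dc"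
proof -
  have R: "0 < R" and c: "continuous_on (radii R) v" "continuous_on (radii R) k"
    using s by (auto simp: scaled_solution_def)
  have ln: "ln (average_density v k r) - ln (local_density k r) = r\<^sup>2 * v r" "ln dc - ln (local_density k r) = r\<^sup>2 * k r" for r
    using dc0 by (simp_all add: average_density_def local_density_def ln_mult)
  have d: "(local_density k has_real_derivative - local_density k r * r * forcing 0 r (v r) (k r)) (at r) \<and>
     (average_density v k has_real_derivative average_density v k r * r * (forcing 3 r (v r) (k r) - 3 * v r - forcing 0 r (v r) (k r))) (at r)"
    if r: "r \<in> radii R - {0}" for r
  proof -
    have r0: "0 < r" using r radii_ge0[of r R] by auto
    have v': "(v has_real_derivative (forcing 3 r (v r) (k r) - 5 * v r) / r) (at r)"
      and k': "(k has_real_derivative (forcing 0 r (v r) (k r) - 2 * k r) / r) (at r)"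
      using s r by (auto simp: scaled_solution_def)
    show ?thesis
      unfolding local_density_def[abs_def] average_density_def[abs_def]
      by (rule conjI; (rule derivative_eq_intros v' k' refl)+) (use r0 in \<open>simp_all add: field_simps power2_eq_square\<close>)
  qed
  have flat: "C1_flat (radii R) (local_density k)"
  proof (rule C1_flat_cong)
    show "C1_flat (radii R) (\<lambda>r. dc * exp (- 1 * (r\<^sup>2 * k r)))"
      by (intro C1_flat_cmult C1_flat_exp scaled_solution_C1_flat[OF s])
  qed (simp add: local_density_def)
  note C1 = C1_flat_imp_C1_within[OF flat] and lim = C1_flat_deriv_tendsto[OF R flat]
  have mc: "continuous_on (radii R) (average_density v k)"
    unfolding average_density_def[abs_def] by (intro continuous_intros c)
  have ode: "(local_density k has_real_derivative
           (local_density k r / average_density v k r) powr (1 - \<beta>) *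
             (3 * (\<beta> - \<gamma>) / r * B \<beta> (local_density k r / average_density v k r) * average_density v k r
              - \<theta> * r * average_density v k r powr (2 - \<gamma>) * local_density k r)) (at r) \<and>
        (average_density v k has_real_derivative - (3 / r) * (average_density v k r - local_density k r)) (at r)"
    if "r \<in> radii R - {0}" for r
  proof -
    have "0 < r" using that radii_ge0[of r R] by auto
    then show ?thesis
      using d[OF that] density_forcing[OF local_density_pos average_density_pos _ ln] mean_forcing[OF local_density_pos average_density_pos _ ln(1), where k = "k r"]
      by simp
  qed
  show "regular R (local_density k) (average_density v k)"
    unfolding strongly_regular_solution_def
    using R C1 lim mc ode local_density_pos by (auto simp: local_density_def average_density_def)
  show "local_density k 0 = dc" by (simp add: local_density_def)
qed

text \<open>Positivity of \<open>\<eta>\<close> is a consequence of \<open>(r ^ 3 \<eta>)' = 3 r\<^sup>2 \<delta>\<close>.\<close>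

lemma regular_mean_pos:
  assumes s: "regular R \<delta> \<eta>" and r: "r \<in> radii R"
  shows "0 < \<eta> r"
proof (cases "r = 0")
  case True
  then show ?thesis using s r by (auto simp: strongly_regular_solution_def)
next
  case False
  then have r0: "0 < r" using radii_ge0[OF r] by simp
  have sub: "{0..r} \<subseteq> radii R" using radii_down[OF r] by auto
  have "(\<lambda>x. x ^ 3 * \<eta> x) 0 < (\<lambda>x. x ^ 3 * \<eta> x) r"
  proof (rule DERIV_pos_imp_increasing_open[OF r0])
    fix x assume x: "0 < x" "x < r"
    then have "x \<in> radii R - {0}" using sub by auto
    then have d: "0 < \<delta> x" and e: "(\<eta> has_real_derivative - (3 / x) * (\<eta> x - \<delta> x)) (at x)"
      using s by (auto simp: strongly_regular_solution_def)
    have "((\<lambda>x. x ^ 3 * \<eta> x) has_real_derivative 3 * x\<^sup>2 * \<delta> x) (at x)"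
      by (rule derivative_eq_intros e refl)+ (use x in \<open>simp add: field_simps power2_eq_square eval_nat_numeral\<close>)
    then show "\<exists>y. ((\<lambda>x. x ^ 3 * \<eta> x) has_real_derivative y) (at x) \<and> 0 < y" using x d by (intro exI[of _ "3 * x\<^sup>2 * \<delta> x"] conjI) auto
  next
    have "continuous_on {0..r} \<eta>" using s sub by (auto simp: strongly_regular_solution_def elim: continuous_on_subset)
    then show "continuous_on {0..r} (\<lambda>x. x ^ 3 * \<eta> x)" by (intro continuous_intros)
  qed
  then show ?thesis using r0 by (simp add: zero_less_mult_iff)
qed

text \<open>Here \<open>\<delta>' \<rightarrow> 0\<close> enters: \<open>(r ^ 3 (\<eta> - \<delta>))' = - r ^ 3 \<delta>'\<close>, so L'Hopital's rule applies to the quotient by \<open>r ^ 4\<close>.\<close>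

lemma regular_mean_minus_density_little_o:
  assumes s: "regular R \<delta> \<eta>"
  shows "((\<lambda>r. (\<eta> r - \<delta> r) / r) \<longlongrightarrow> 0) (at_right 0)" "(\<delta> \<longlongrightarrow> \<delta> 0) (at_right 0)" "(\<eta> \<longlongrightarrow> \<eta> 0) (at_right 0)"
proof -
  have R: "0 < R" using s by (simp add: strongly_regular_solution_def)
  obtain a where a: "0 < a" "{0..a} \<subseteq> radii R" using radii_initial_segment[OF R] .
  have "continuous_on (radii R) \<delta>" "continuous_on (radii R) \<eta>"
    using s unfolding strongly_regular_solution_def C1_within_def
    by (auto intro: DERIV_continuous_on)
  then have "continuous_on {0..a} \<delta>" "continuous_on {0..a} \<eta>" using a(2) by (auto elim: continuous_on_subset)
  then show d: "(\<delta> \<longlongrightarrow> \<delta> 0) (at_right 0)" and e: "(\<eta> \<longlongrightarrow> \<eta> 0) (at_right 0)"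
    using a(1) by (auto simp: continuous_on_def at_within_Icc_at_right dest!: bspec[of _ _ 0])
  have dd: "(\<delta> has_real_derivative deriv \<delta> r) (at r)"
    and ee: "(\<eta> has_real_derivative - (3 / r) * (\<eta> r - \<delta> r)) (at r)" if "0 < r" "r < a" for r
  proof -
    have "r \<in> radii R - {0}" using that subsetD[OF a(2), of r] by auto
    then obtain D where D: "(\<delta> has_real_derivative D) (at r)"
      and e: "(\<eta> has_real_derivative - (3 / r) * (\<eta> r - \<delta> r)) (at r)"
      using s unfolding strongly_regular_solution_def by blast
    show "(\<delta> has_real_derivative deriv \<delta> r) (at r)" "(\<eta> has_real_derivative - (3 / r) * (\<eta> r - \<delta> r)) (at r)"
      using D e DERIV_imp_deriv[OF D] by simp_all
  qed
  have ev: "eventually (\<lambda>r. 0 < r \<and> r < a) (at_right 0)"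
    unfolding eventually_at_right_field using a(1) by blast
  have "((\<lambda>r. r ^ 3 * (\<eta> r - \<delta> r) / r ^ 4) \<longlongrightarrow> 0) (at_right 0)"
  proof (rule lhopital_right_0)
    have "((\<lambda>r. r ^ 3 * (\<eta> r - \<delta> r)) \<longlongrightarrow> 0 ^ 3 * (\<eta> 0 - \<delta> 0)) (at_right 0)" by (intro tendsto_intros d e)
    then show "((\<lambda>r. r ^ 3 * (\<eta> r - \<delta> r)) \<longlongrightarrow> 0) (at_right 0)" by simp
    have "((\<lambda>r::real. r ^ 4) \<longlongrightarrow> 0 ^ 4) (at_right 0)" by (intro tendsto_intros)
    then show "((\<lambda>r::real. r ^ 4) \<longlongrightarrow> 0) (at_right 0)" by simp
    show "eventually (\<lambda>r. ((\<lambda>r. r ^ 3 * (\<eta> r - \<delta> r)) has_real_derivative - (r ^ 3 * deriv \<delta> r)) (at r)) (at_right 0)"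
      using ev
    proof eventually_elim
      case (elim r)
      then have r: "0 < r" "r < a" by auto
      show ?case
        by (rule derivative_eq_intros dd[OF r] ee[OF r] refl)+
          (use r in \<open>simp add: field_simps eval_nat_numeral\<close>)
    qed
    show "eventually (\<lambda>r::real. ((\<lambda>r. r ^ 4) has_real_derivative 4 * r ^ 3) (at r)) (at_right 0)"
      by (auto intro!: always_eventually derivative_eq_intros)
    have "((\<lambda>r. - deriv \<delta> r / 4) \<longlongrightarrow> - 0 / 4) (at_right 0)"
      using s by (intro tendsto_intros) (auto simp: strongly_regular_solution_def)
    then have "((\<lambda>r. - deriv \<delta> r / 4) \<longlongrightarrow> 0) (at_right 0)" by simp
    then show "((\<lambda>r. - (r ^ 3 * deriv \<delta> r) / (4 * r ^ 3)) \<longlongrightarrow> 0) (at_right 0)"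
      by (rule Lim_transform_eventually) (rule eventually_mono[OF ev], simp)
  qed (use ev in \<open>auto elim!: eventually_mono\<close>)
  then show "((\<lambda>r. (\<eta> r - \<delta> r) / r) \<longlongrightarrow> 0) (at_right 0)"
    by (rule Lim_transform_eventually) (use ev in \<open>auto elim!: eventually_mono simp: field_simps eval_nat_numeral\<close>)
qed

text \<open>From \<open>ln x \<le> x - 1\<close> one gets \<open>(\<eta> - \<delta>) / \<eta> \<le> ln \<eta> - ln \<delta> \<le> (\<eta> - \<delta>) / \<delta>\<close>.\<close>

lemma regular_log_ratio_little_o:
  assumes s: "regular R \<delta> \<eta>"
  shows "((\<lambda>r. (ln (\<eta> r) - ln (\<delta> r)) / r) \<longlongrightarrow> 0) (at_right 0)"
proof -
  have R: "0 < R" using s by (simp add: strongly_regular_solution_def)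
  obtain a where a: "0 < a" "{0..a} \<subseteq> radii R" using radii_initial_segment[OF R] .
  note lim = regular_mean_minus_density_little_o[OF s]
  have dp: "0 < \<delta> r" "0 < \<eta> r" if "r \<in> radii R" for r
    using s that regular_mean_pos[OF s that] by (auto simp: strongly_regular_solution_def)
  have ev: "eventually (\<lambda>r. 0 < r \<and> r \<in> radii R) (at_right 0)"
    by (rule eventually_at_right_radii[OF R])
  have p0: "0 < \<delta> 0" "0 < \<eta> 0" using dp[of 0] subsetD[OF a(2), of 0] a(1) by auto
  show ?thesis
  proof (rule tendsto_sandwich)
    have "((\<lambda>r. (\<eta> r - \<delta> r) / r / \<eta> r) \<longlongrightarrow> 0 / \<eta> 0) (at_right 0)"
      using p0 by (intro tendsto_intros lim) auto
    then show "((\<lambda>r. (\<eta> r - \<delta> r) / r / \<eta> r) \<longlongrightarrow> 0) (at_right 0)" by simp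
    have "((\<lambda>r. (\<eta> r - \<delta> r) / r / \<delta> r) \<longlongrightarrow> 0 / \<delta> 0) (at_right 0)"
      using p0 by (intro tendsto_intros lim) auto
    then show "((\<lambda>r. (\<eta> r - \<delta> r) / r / \<delta> r) \<longlongrightarrow> 0) (at_right 0)" by simp
    show "eventually (\<lambda>r. (\<eta> r - \<delta> r) / r / \<eta> r \<le> (ln (\<eta> r) - ln (\<delta> r)) / r) (at_right 0)"
      using ev
    proof eventually_elim
      case (elim r)
      have "ln (\<delta> r / \<eta> r) \<le> \<delta> r / \<eta> r - 1" using dp elim by (intro ln_le_minus_one) auto
      then have "(\<eta> r - \<delta> r) / \<eta> r \<le> ln (\<eta> r) - ln (\<delta> r)" using dp[of r] elim by (simp add: ln_div diff_divide_distrib)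
      then have "(\<eta> r - \<delta> r) / \<eta> r / r \<le> (ln (\<eta> r) - ln (\<delta> r)) / r" using elim by (intro divide_right_mono) auto
      then show ?case by (simp add: mult.commute)
    qed
    show "eventually (\<lambda>r. (ln (\<eta> r) - ln (\<delta> r)) / r \<le> (\<eta> r - \<delta> r) / r / \<delta> r) (at_right 0)"
      using ev
    proof eventually_elim
      case (elim r)
      have "ln (\<eta> r / \<delta> r) \<le> \<eta> r / \<delta> r - 1" using dp elim by (intro ln_le_minus_one) auto
      then have "ln (\<eta> r) - ln (\<delta> r) \<le> (\<eta> r - \<delta> r) / \<delta> r" using dp[of r] elim by (simp add: ln_div diff_divide_distrib)
      then have "(ln (\<eta> r) - ln (\<delta> r)) / r \<le> (\<eta> r - \<delta> r) / \<delta> r / r" using elim by (intro divide_right_mono) auto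
      then show ?case by (simp add: mult.commute)
    qed
  qed
qed

text \<open>The point is that \<open>v\<close> and \<open>k\<close> have limits at the centre. Since the forcing converges once \<open>p = o(r)\<close>,
L'Hopital's rule applied to \<open>r ^ 3 p / r ^ 5\<close> and to \<open>(ln dc - ln \<delta>) / r\<^sup>2\<close> gives the limits; the
factor \<open>r ^ 3\<close> removes the linear term \<open>- 3 p\<close> from \<open>r p'\<close>.\<close>

lemma regular_imp_scaled:
  assumes s: "regular R \<delta> \<eta>" and dc: "\<delta> 0 = dc"
  obtains v k where "scaled_solution R v k" "\<And>r. r \<in> radii R \<Longrightarrow> \<delta> r = local_density k r \<and> \<eta> r = average_density v k r"
proof -
  have R: "0 < R" and e0: "\<eta> 0 = dc" using s dc by (auto simp: strongly_regular_solution_def)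
  obtain a where a: "0 < a" "{0..a} \<subseteq> radii R" using radii_initial_segment[OF R] .
  have dp: "0 < \<delta> r" "0 < \<eta> r" if "r \<in> radii R" for r
    using s that regular_mean_pos[OF s that] by (auto simp: strongly_regular_solution_def)
  have ev: "eventually (\<lambda>r. 0 < r \<and> r \<in> radii R) (at_right 0)"
    by (rule eventually_at_right_radii[OF R])
  note lim = regular_mean_minus_density_little_o[OF s]
  define g0 where "g0 = \<theta> * exp ((2 - \<gamma>) * ln dc)"
  define p where "p r = ln (\<eta> r) - ln (\<delta> r)" for r
  define v where "v r = (if r = 0 then g0 / 5 else p r / r\<^sup>2)" for r
  define k where "k r = (if r = 0 then g0 / 2 else (ln dc - ln (\<delta> r)) / r\<^sup>2)" for r
  have pv: "p r = r\<^sup>2 * v r" and dk: "ln dc - ln (\<delta> r) = r\<^sup>2 * k r" for r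
    using dc e0 by (auto simp: v_def k_def p_def)
  have rate: "(\<delta> has_real_derivative - \<delta> r * r * forcing 0 r (v r) (k r)) (at r)"
    "(\<eta> has_real_derivative \<eta> r * r * (forcing 3 r (v r) (k r) - 3 * v r - forcing 0 r (v r) (k r))) (at r)"
    if r: "r \<in> radii R" "0 < r" for r
  proof -
    have d: "0 < \<delta> r" "0 < \<eta> r" "0 < r" using dp r by auto
    have "(\<delta> has_real_derivative
           (\<delta> r / \<eta> r) powr (1 - \<beta>) *
             (3 * (\<beta> - \<gamma>) / r * B \<beta> (\<delta> r / \<eta> r) * \<eta> r
              - \<theta> * r * \<eta> r powr (2 - \<gamma>) * \<delta> r)) (at r) \<and>
        (\<eta> has_real_derivative - (3 / r) * (\<eta> r - \<delta> r)) (at r)"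
      using s r by (simp add: strongly_regular_solution_def)
    then show "(\<delta> has_real_derivative - \<delta> r * r * forcing 0 r (v r) (k r)) (at r)"
      "(\<eta> has_real_derivative \<eta> r * r * (forcing 3 r (v r) (k r) - 3 * v r - forcing 0 r (v r) (k r))) (at r)"
      using density_forcing[OF d pv[unfolded p_def] dk] mean_forcing[OF d pv[unfolded p_def], of "k r"] by simp_all
  qed
  have p': "(p has_real_derivative r * (forcing 3 r (v r) (k r) - 3 * v r)) (at r)"
    and d': "((\<lambda>r. ln dc - ln (\<delta> r)) has_real_derivative r * forcing 0 r (v r) (k r)) (at r)"
    if r: "r \<in> radii R" "0 < r" for r
    unfolding p_def[abs_def]
    by ((rule derivative_eq_intros rate[OF r] dp r refl)+, use dp[OF r(1)] in \<open>simp add: field_simps\<close>)+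
  have forcing_lim: "((\<lambda>r. forcing c r (v r) (k r)) \<longlongrightarrow> g0) (at_right 0)" for c
  proof -
    have q: "((\<lambda>r. p r / r) \<longlongrightarrow> 0) (at_right 0)"
      unfolding p_def by (rule regular_log_ratio_little_o[OF s])
    have ld: "((\<lambda>r. ln (\<delta> r)) \<longlongrightarrow> ln dc) (at_right 0)" and le: "((\<lambda>r. ln (\<eta> r)) \<longlongrightarrow> ln dc) (at_right 0)"
      using tendsto_ln[OF lim(2)] tendsto_ln[OF lim(3)] dc e0 dc0 by auto
    have "((\<lambda>r. \<theta> * exp ((2 - \<gamma>) * ln (\<delta> r) + (1 + \<beta> - \<gamma>) * p r)
         - 3 * (\<beta> - \<gamma>) / (\<beta> * (\<beta> - 1)) * (exp_rem ((\<beta> - 1) * p r) / r\<^sup>2)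
         - (3 * (\<beta> - \<gamma>) / \<beta> - c) * (exp_rem ((-1) * p r) / r\<^sup>2))
       \<longlongrightarrow> \<theta> * exp ((2 - \<gamma>) * ln dc + (1 + \<beta> - \<gamma>) * (ln dc - ln dc))
         - 3 * (\<beta> - \<gamma>) / (\<beta> * (\<beta> - 1)) * 0 - (3 * (\<beta> - \<gamma>) / \<beta> - c) * 0) (at_right 0)"
      by (intro tendsto_diff tendsto_mult tendsto_const tendsto_exp tendsto_add exp_rem_little_o q ld,
          unfold p_def, intro tendsto_diff ld le)
    moreover have "\<theta> * exp ((2 - \<gamma>) * ln (\<delta> r) + (1 + \<beta> - \<gamma>) * p r)
         - 3 * (\<beta> - \<gamma>) / (\<beta> * (\<beta> - 1)) * (exp_rem ((\<beta> - 1) * p r) / r\<^sup>2)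
         - (3 * (\<beta> - \<gamma>) / \<beta> - c) * (exp_rem ((-1) * p r) / r\<^sup>2) = forcing c r (v r) (k r)" for r
    proof -
      have "ln (\<delta> r) = ln dc - r\<^sup>2 * k r" using dk[of r] by simp
      then show ?thesis unfolding forcing_def gravity_def by (simp add: pv mult.left_commute)
    qed
    ultimately show ?thesis by (simp add: g0_def)
  qed
  have vlim: "((\<lambda>r. p r / r\<^sup>2) \<longlongrightarrow> g0 / 5) (at_right 0)"
  proof -
    have "((\<lambda>r. r ^ 3 * p r / r ^ 5) \<longlongrightarrow> g0 / 5) (at_right 0)"
    proof (rule lhopital_right_0)
      have "((\<lambda>r. r ^ 3 * p r) \<longlongrightarrow> 0 ^ 3 * (ln (\<eta> 0) - ln (\<delta> 0))) (at_right 0)"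
        unfolding p_def using dc e0 dc0 by (intro tendsto_intros lim) auto
      then show "((\<lambda>r. r ^ 3 * p r) \<longlongrightarrow> 0) (at_right 0)" by simp
      have "((\<lambda>r::real. r ^ 5) \<longlongrightarrow> 0 ^ 5) (at_right 0)" by (intro tendsto_intros)
      then show "((\<lambda>r::real. r ^ 5) \<longlongrightarrow> 0) (at_right 0)" by simp
      show "eventually (\<lambda>r. ((\<lambda>r. r ^ 3 * p r) has_real_derivative r ^ 4 * forcing 3 r (v r) (k r)) (at r)) (at_right 0)"
        using ev
      proof eventually_elim
        case (elim r)
        then have r: "r \<in> radii R" "0 < r" by auto
        show ?case
          by (rule derivative_eq_intros p'[OF r] refl)+ (simp add: pv algebra_simps eval_nat_numeral)
      qed
      show "eventually (\<lambda>r::real. ((\<lambda>r. r ^ 5) has_real_derivative 5 * r ^ 4) (at r)) (at_right 0)"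
        by (auto intro!: always_eventually derivative_eq_intros)
      have "((\<lambda>r. forcing 3 r (v r) (k r) / 5) \<longlongrightarrow> g0 / 5) (at_right 0)"
        by (intro tendsto_intros forcing_lim) auto
      then show "((\<lambda>r. r ^ 4 * forcing 3 r (v r) (k r) / (5 * r ^ 4)) \<longlongrightarrow> g0 / 5) (at_right 0)"
        by (rule Lim_transform_eventually) (rule eventually_mono[OF ev], simp)
    qed (use ev in \<open>auto elim!: eventually_mono\<close>)
    then show ?thesis
      by (rule Lim_transform_eventually) (use ev in \<open>auto elim!: eventually_mono simp: field_simps eval_nat_numeral\<close>)
  qed
  have klim: "((\<lambda>r. (ln dc - ln (\<delta> r)) / r\<^sup>2) \<longlongrightarrow> g0 / 2) (at_right 0)"
  proof (rule lhopital_right_0)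
    have "((\<lambda>r. ln dc - ln (\<delta> r)) \<longlongrightarrow> ln dc - ln (\<delta> 0)) (at_right 0)"
      using dc dc0 by (intro tendsto_intros lim) auto
    then show "((\<lambda>r. ln dc - ln (\<delta> r)) \<longlongrightarrow> 0) (at_right 0)" using dc by simp
    have "((\<lambda>r::real. r\<^sup>2) \<longlongrightarrow> 0\<^sup>2) (at_right 0)" by (intro tendsto_intros)
    then show "((\<lambda>r::real. r\<^sup>2) \<longlongrightarrow> 0) (at_right 0)" by simp
    show "eventually (\<lambda>r. ((\<lambda>r. ln dc - ln (\<delta> r)) has_real_derivative r * forcing 0 r (v r) (k r)) (at r)) (at_right 0)"
      using ev by eventually_elim (rule d', auto)
    show "eventually (\<lambda>r::real. ((\<lambda>r. r\<^sup>2) has_real_derivative 2 * r) (at r)) (at_right 0)"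
      by (auto intro!: always_eventually derivative_eq_intros)
    have "((\<lambda>r. forcing 0 r (v r) (k r) / 2) \<longlongrightarrow> g0 / 2) (at_right 0)"
      by (intro tendsto_intros forcing_lim) auto
    then show "((\<lambda>r. r * forcing 0 r (v r) (k r) / (2 * r)) \<longlongrightarrow> g0 / 2) (at_right 0)"
      by (rule Lim_transform_eventually) (rule eventually_mono[OF ev], simp)
  qed (use ev in \<open>auto elim!: eventually_mono\<close>)
  have ode: "(v has_real_derivative (forcing 3 r (v r) (k r) - 5 * v r) / r) (at r)"
    "(k has_real_derivative (forcing 0 r (v r) (k r) - 2 * k r) / r) (at r)"
    if r: "r \<in> radii R" "0 < r" for r
  proof -
    have "((\<lambda>r. p r / r\<^sup>2) has_real_derivative (forcing 3 r (v r) (k r) - 5 * v r) / r) (at r)"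
      by (rule derivative_eq_intros p'[OF r] refl)+
        (use r in \<open>simp_all add: pv field_simps power2_eq_square\<close>)
    then show "(v has_real_derivative (forcing 3 r (v r) (k r) - 5 * v r) / r) (at r)"
      by (rule has_field_derivative_transform_within_open[of _ _ _ "{0<..}"]) (use r in \<open>auto simp: v_def\<close>)
    have "((\<lambda>r. (ln dc - ln (\<delta> r)) / r\<^sup>2) has_real_derivative (forcing 0 r (v r) (k r) - 2 * k r) / r) (at r)"
      by (rule DERIV_cong[OF DERIV_divide[OF d'[OF r] DERIV_power[OF DERIV_ident]]])
        (use r in \<open>simp_all add: dk field_simps power2_eq_square\<close>)
    then show "(k has_real_derivative (forcing 0 r (v r) (k r) - 2 * k r) / r) (at r)"
      by (rule has_field_derivative_transform_within_open[of _ _ _ "{0<..}"]) (use r in \<open>auto simp: k_def\<close>)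
  qed
  have cont: "continuous_on (radii R) w"
    if lim0: "(w \<longlongrightarrow> w 0) (at_right 0)" and dw: "\<And>r. r \<in> radii R \<Longrightarrow> 0 < r \<Longrightarrow> isCont w r" for w :: "real \<Rightarrow> real"
    unfolding continuous_on_eq_continuous_within
  proof
    fix r assume r: "r \<in> radii R"
    show "continuous (at r within radii R) w"
    proof (cases "r = 0")
      case True
      have "at 0 within radii R \<le> at 0 within {0..}" by (rule at_le) (auto simp: radii_ge0)
      then show ?thesis
        using lim0 True by (auto simp: continuous_within at_within_Ici_at_right intro: tendsto_mono)
    next
      case False
      then show ?thesis using dw[OF r] radii_ge0[OF r] by (auto intro: continuous_at_imp_continuous_at_within)
    qed
  qed
  have "(v \<longlongrightarrow> v 0) (at_right 0)" "(k \<longlongrightarrow> k 0) (at_right 0)"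
    using Lim_transform_eventually[OF vlim, of v] Lim_transform_eventually[OF klim, of k]
    by (auto simp: v_def k_def eventually_at_filter)
  then have "continuous_on (radii R) v" "continuous_on (radii R) k"
    using ode by (auto intro!: cont DERIV_isCont)
  then have "scaled_solution R v k"
    using R ode radii_ge0[of _ R] unfolding scaled_solution_def by (auto simp: less_le)
  moreover have "\<delta> r = local_density k r \<and> \<eta> r = average_density v k r" if r: "r \<in> radii R" for r
  proof
    have "ln (\<delta> r) = ln dc + - (r\<^sup>2 * k r)" "ln (\<eta> r) = ln dc + (r\<^sup>2 * v r - r\<^sup>2 * k r)"
      using dk[of r] pv[of r] by (simp_all add: p_def)
    then have "exp (ln (\<delta> r)) = local_density k r" "exp (ln (\<eta> r)) = average_density v k r"
      using dc0 by (simp_all only: local_density_def average_density_def exp_add exp_ln)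
    then show "\<delta> r = local_density k r" "\<eta> r = average_density v k r" using dp[OF r] by simp_all
  qed
  ultimately show ?thesis by (rule that)
qed

end

section \<open>Reaching the surface and the interval of existence\<close>

context elastic_ball begin

definition log_ratio :: "(real \<Rightarrow> real) \<Rightarrow> real \<Rightarrow> real" where
  "log_ratio v r = r\<^sup>2 * v r"

definition log_mean :: "(real \<Rightarrow> real) \<Rightarrow> (real \<Rightarrow> real) \<Rightarrow> real \<Rightarrow> real" where
  "log_mean v k r = ln dc + r\<^sup>2 * v r - r\<^sup>2 * k r"

definition pull :: "(real \<Rightarrow> real) \<Rightarrow> (real \<Rightarrow> real) \<Rightarrow> real \<Rightarrow> real" where
  "pull v k r = \<theta> * r\<^sup>2 * exp ((2 - \<gamma>) * log_mean v k r)"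

text \<open>The function \<open>\<Phi>\<close> of the introduction: \<open>3 (1 - y) + 3 (\<beta> - \<gamma>) y powr (-\<beta>) B y\<close> for \<open>y = exp (- p)\<close>.\<close>

definition restoring :: "real \<Rightarrow> real" where
  "restoring p = 3 * (1 - exp (- p)) +
     3 * (\<beta> - \<gamma>) / (\<beta> * (\<beta> - 1)) * (exp_rem ((\<beta> - 1) * p) + (\<beta> - 1) * exp_rem (- p))"

lemma pull_pos: "0 < r \<Longrightarrow> 0 < pull v k r"
  using theta_pos by (simp add: pull_def)

lemma log_ratio_DERIV:
  assumes s: "scaled_solution R v k" and r: "r \<in> radii R" "0 < r"
  shows "(log_ratio v has_real_derivative
      (pull v k r * exp ((\<beta> - 1) * log_ratio v r) - restoring (log_ratio v r)) / r) (at r)"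
proof -
  have v': "(v has_real_derivative (forcing 3 r (v r) (k r) - 5 * v r) / r) (at r)"
    using s r by (simp add: scaled_solution_def)
  have "(log_ratio v has_real_derivative (r\<^sup>2 * forcing 3 r (v r) (k r) - 3 * log_ratio v r) / r) (at r)"
    unfolding log_ratio_def[abs_def]
    by (rule derivative_eq_intros v' refl)+ (use r in \<open>simp add: field_simps power2_eq_square\<close>)
  moreover have "r\<^sup>2 * forcing 3 r (v r) (k r) - 3 * log_ratio v r
      = pull v k r * exp ((\<beta> - 1) * log_ratio v r) - restoring (log_ratio v r)"
  proof -
    define p where "p = log_ratio v r"
    define A where "A = 3 * (\<beta> - \<gamma>) / (\<beta> * (\<beta> - 1))"
    define E1 where "E1 = exp_rem ((\<beta> - 1) * p)"
    define E2 where "E2 = exp_rem (- p)"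
    have c: "3 * (\<beta> - \<gamma>) / \<beta> - 3 = A * (\<beta> - 1) - 3"
      using beta_ne by (simp add: A_def)
    have p: "r\<^sup>2 * ((\<beta> - 1) * v r) = (\<beta> - 1) * p" "r\<^sup>2 * (- v r) = - p" by (simp_all add: p_def log_ratio_def)
    have "gravity r (v r) (k r) = \<theta> * (exp ((2 - \<gamma>) * log_mean v k r) * exp ((\<beta> - 1) * p))"
      unfolding gravity_def exp_add[symmetric] by (simp add: log_mean_def p_def log_ratio_def algebra_simps)
    then have g: "r\<^sup>2 * gravity r (v r) (k r) = pull v k r * exp ((\<beta> - 1) * p)"
      by (simp add: pull_def)
    have "forcing 3 r (v r) (k r) = gravity r (v r) (k r) - A * (E1 / r\<^sup>2)
          - (A * (\<beta> - 1) - 3) * (E2 / r\<^sup>2)"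
      unfolding forcing_def c p A_def[symmetric] E1_def E2_def by (rule refl)
    then have "r\<^sup>2 * forcing 3 r (v r) (k r) = pull v k r * exp ((\<beta> - 1) * p) - A * E1
          - (A * (\<beta> - 1) - 3) * E2"
      using r by (simp add: right_diff_distrib g)
    moreover have "restoring p = 3 * p + A * E1 + (A * (\<beta> - 1) - 3) * E2"
    proof -
      have "3 * p - 3 * E2 = 3 * (1 - exp (- p))" by (simp add: E2_def exp_rem_def)
      then show ?thesis
        unfolding restoring_def A_def[symmetric] E1_def[symmetric] E2_def[symmetric]
        by (simp add: algebra_simps)
    qed
    ultimately show ?thesis by (simp add: p_def)
  qed
  ultimately show ?thesis by simp
qed

lemma log_mean_DERIV:
  assumes s: "scaled_solution R v k" and r: "r \<in> radii R" "0 < r"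
  shows "(log_mean v k has_real_derivative - 3 * (1 - exp (- log_ratio v r)) / r) (at r)"
proof -
  have v': "(v has_real_derivative (forcing 3 r (v r) (k r) - 5 * v r) / r) (at r)"
    and k': "(k has_real_derivative (forcing 0 r (v r) (k r) - 2 * k r) / r) (at r)"
    using s r by (simp_all add: scaled_solution_def)
  have "(log_mean v k has_real_derivative r * (forcing 3 r (v r) (k r) - 3 * v r - forcing 0 r (v r) (k r))) (at r)"
    unfolding log_mean_def[abs_def]
    by (rule derivative_eq_intros v' k' refl)+ (use r in \<open>simp add: field_simps power2_eq_square\<close>)
  moreover have "r * (forcing 3 r (v r) (k r) - 3 * v r - forcing 0 r (v r) (k r)) = - 3 * (1 - exp (- log_ratio v r)) / r"
  proof -
    have "forcing 3 r (v r) (k r) - forcing 0 r (v r) (k r) = 3 * (exp_rem (r\<^sup>2 * (- v r)) / r\<^sup>2)"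
      by (simp add: forcing_def algebra_simps)
    then show ?thesis using r by (simp add: exp_rem_def log_ratio_def field_simps power2_eq_square)
  qed
  ultimately show ?thesis by simp
qed

lemma scaled_solution_at_0:
  assumes s: "scaled_solution R v k"
  shows "v 0 = \<theta> * exp ((2 - \<gamma>) * ln dc) / 5"
proof -
  have "0 < R" using s by (simp add: scaled_solution_def)
  then obtain a where a: "0 < a" "{0..a} \<subseteq> radii R" using radii_initial_segment by blast
  then have aR: "a \<in> radii R" by auto
  obtain V where V: "\<And>r. r \<in> {0..a} \<Longrightarrow> \<bar>v r\<bar> \<le> V \<and> \<bar>k r\<bar> \<le> V"
    using scaled_solution_local_bound[OF s aR] by blast
  have "v 0 = power_avg 4 (\<lambda>s. clipped_forcing V 3 s (v s) (k s)) 0"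
    using scaled_solution_imp_clipped[OF s aR a(1) V] a(1) unfolding clipped_solution_def by simp
  then show ?thesis unfolding power_avg_zero clipped_forcing_def forcing_at_0 by simp
qed

text \<open>At a first zero of \<open>v\<close> beyond the centre only the gravitational term is left in \<open>v'\<close>, and it is positive.\<close>

lemma log_ratio_pos:
  assumes s: "scaled_solution R v k" and r: "r \<in> radii R" "0 < r"
  shows "0 < log_ratio v r"
proof (rule ccontr)
  assume "\<not> ?thesis"
  then have vr: "v r \<le> 0" using r by (simp add: log_ratio_def not_less mult_le_0_iff)
  have sub: "{0..r} \<subseteq> radii R" using radii_down[OF r(1)] by auto
  have vc: "continuous_on {0..r} v" using s sub by (auto simp: scaled_solution_def elim: continuous_on_subset)
  have v0: "0 < v 0" unfolding scaled_solution_at_0[OF s] using theta_pos by simp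
  obtain m where m: "0 < m" "m \<le> r" "v m = 0" "\<And>x. x \<in> {0..<m} \<Longrightarrow> 0 < v x"
    using first_zero[OF vc v0 vr] r by auto
  have "m \<in> radii R - {0}" using sub m by auto
  then have "(v has_real_derivative (forcing 3 m (v m) (k m) - 5 * v m) / m) (at m)"
    using s by (auto simp: scaled_solution_def)
  moreover have "0 < (forcing 3 m (v m) (k m) - 5 * v m) / m"
    using m theta_pos by (simp add: forcing_def gravity_def)
  ultimately obtain d where d: "0 < d" "\<And>h. 0 < h \<Longrightarrow> h < d \<Longrightarrow> v (m - h) < v m"
    using DERIV_pos_inc_left by blast
  \<comment> \<open>\<open>v\<close> would be negative just before its first zero\<close>
  define h where "h = min d m / 2"
  have h: "0 < h" "h < d" "h < m" using d m by (auto simp: h_def)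
  then show False using d(2)[of h] m(3) m(4)[of "m - h"] by auto
qed

lemma log_mean_decreasing:
  assumes s: "scaled_solution R v k" and ab: "0 < a" "a \<le> b" "b \<in> radii R"
  shows "log_mean v k b \<le> log_mean v k a"
proof (rule DERIV_nonpos_imp_nonincreasing[OF ab(2)])
  fix x assume "a \<le> x" "x \<le> b"
  then have x: "x \<in> radii R" "0 < x" using radii_down[OF ab(3)] ab by auto
  have "- 3 * (1 - exp (- log_ratio v x)) / x \<le> 0"
    using log_ratio_pos[OF s x] x by (intro divide_nonpos_pos) auto
  then show "\<exists>y. (log_mean v k has_real_derivative y) (at x) \<and> y \<le> 0"
    using log_mean_DERIV[OF s x] by blast
qed

text \<open>Since \<open>r ^ 3 \<eta>\<close> is proportional to the enclosed mass, \<open>\<eta>\<close> cannot tend to \<open>0\<close> at a finite radius.\<close>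

lemma log_mean_lower_bound:
  assumes s: "scaled_solution R v k" and ab: "0 < a" "a \<le> b" "b \<in> radii R"
  shows "log_mean v k a + 3 * ln a \<le> log_mean v k b + 3 * ln b"
proof (rule DERIV_nonneg_imp_nondecreasing[OF ab(2)])
  fix x assume "a \<le> x" "x \<le> b"
  then have x: "x \<in> radii R" "0 < x" using radii_down[OF ab(3)] ab by auto
  have "((\<lambda>x. log_mean v k x + 3 * ln x) has_real_derivative 3 * exp (- log_ratio v x) / x) (at x)"
    by (rule derivative_eq_intros log_mean_DERIV[OF s x] x refl)+ (use x in \<open>simp add: field_simps\<close>)
  then show "\<exists>y. ((\<lambda>x. log_mean v k x + 3 * ln x) has_real_derivative y) (at x) \<and> 0 \<le> y"
    using x by (intro exI conjI) auto
qed

text \<open>Only \<open>p\<close> can obstruct continuation to a finite radius: \<open>\<eta>\<close> is decreasing and bounded away from \<open>0\<close>.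
The bound on \<open>p\<close> is asked for on the outer half only, since near the centre \<open>v\<close> and \<open>k\<close> are
bounded by continuity.\<close>

lemma bounded_log_ratio_extends:
  assumes s: "scaled_solution (ereal R) v k"
    and P: "\<And>r. r \<in> {R/2..<R} \<Longrightarrow> log_ratio v r \<le> P"
  obtains Z v' k' where "R < Z" "scaled_solution (ereal Z) v' k'"
proof -
  have R: "0 < R" using s by (simp add: scaled_solution_def)
  define a where "a = R / 2"
  have a: "0 < a" "a < R" "a \<in> radii (ereal R)" using R by (auto simp: a_def radii_ereal)
  obtain V0 where V0: "0 \<le> V0" "\<And>r. r \<in> {0..a} \<Longrightarrow> \<bar>v r\<bar> \<le> V0 \<and> \<bar>k r\<bar> \<le> V0"
    using scaled_solution_local_bound[OF s a(3)] by blast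
  define N where "N = \<bar>ln dc\<bar> + \<bar>P\<bar> + \<bar>log_mean v k a\<bar> + \<bar>log_mean v k a + 3 * ln a - 3 * ln R\<bar>"
  have "\<bar>v r\<bar> \<le> max V0 (N / a\<^sup>2) \<and> \<bar>k r\<bar> \<le> max V0 (N / a\<^sup>2)" if r: "r \<in> {0..<R}" for r
  proof (cases "r \<le> a")
    case True
    then show ?thesis using V0(2)[of r] r by (auto simp: le_max_iff_disj)
  next
    case False
    then have ar: "a \<le> r" and rR: "r \<in> radii (ereal R)" and r0: "0 < r" using r a by (auto simp: radii_ereal)
    have p: "0 < log_ratio v r" "log_ratio v r \<le> P"
      using log_ratio_pos[OF s rR r0] P[of r] r ar by (auto simp: a_def)
    have L: "log_mean v k r \<le> log_mean v k a"
      "log_mean v k a + 3 * ln a \<le> log_mean v k r + 3 * ln r"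
      using log_mean_decreasing[OF s a(1) ar rR] log_mean_lower_bound[OF s a(1) ar rR] by auto
    have "ln r \<le> ln R" using r r0 by simp
    then have b: "\<bar>log_ratio v r\<bar> \<le> N" "\<bar>ln dc + log_ratio v r - log_mean v k r\<bar> \<le> N"
      using p L unfolding N_def by linarith+
    have sq: "a\<^sup>2 \<le> r\<^sup>2" using a ar by (intro power_mono) auto
    have scale: "\<bar>x\<bar> \<le> N / a\<^sup>2" if "\<bar>r\<^sup>2 * x\<bar> \<le> N" for x
    proof -
      have "a\<^sup>2 * \<bar>x\<bar> \<le> r\<^sup>2 * \<bar>x\<bar>" using sq by (intro mult_right_mono) auto
      also have "\<dots> \<le> N" using that by (simp add: abs_mult)
      finally show ?thesis using a by (simp add: pos_le_divide_eq mult.commute)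
    qed
    have "\<bar>r\<^sup>2 * v r\<bar> \<le> N" "\<bar>r\<^sup>2 * k r\<bar> \<le> N"
      using b by (simp_all add: log_ratio_def log_mean_def)
    then show ?thesis using scale by (auto simp: le_max_iff_disj)
  qed
  then show ?thesis using bounded_scaled_solution_extends[OF s] that by blast
qed

text \<open>The derivative of \<open>ln u\<close> with respect to \<open>ln r\<close> is \<open>2 - 3 (2 - \<gamma>) (1 - y)\<close>.\<close>

lemma pull_growth:
  assumes s: "scaled_solution R v k" and b: "1 \<le> b" "b \<in> radii R"
    and rate: "\<And>x. x \<in> {1..b} \<Longrightarrow> \<epsilon> \<le> 2 - 3 * (2 - \<gamma>) * (1 - exp (- log_ratio v x))"
  shows "pull v k 1 * exp (\<epsilon> * ln b) \<le> pull v k b"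
proof -
  let ?g = "\<lambda>x. (2 - \<gamma>) * log_mean v k x + (2 - \<epsilon>) * ln x"
  have "?g 1 \<le> ?g b"
  proof (rule DERIV_nonneg_imp_nondecreasing[OF b(1)])
    fix x assume x1: "1 \<le> x" "x \<le> b"
    then have x: "x \<in> radii R" "0 < x" using radii_down[OF b(2)] by auto
    have "(?g has_real_derivative (2 - 3 * (2 - \<gamma>) * (1 - exp (- log_ratio v x)) - \<epsilon>) / x) (at x)"
      by (rule derivative_eq_intros log_mean_DERIV[OF s x] x refl)+ (use x in \<open>simp add: field_simps\<close>)
    then show "\<exists>y. (?g has_real_derivative y) (at x) \<and> 0 \<le> y"
      using rate[of x] x x1 by (intro exI conjI) auto
  qed
  then have le: "(2 - \<gamma>) * log_mean v k 1 + \<epsilon> * ln b \<le> (2 - \<gamma>) * log_mean v k b + 2 * ln b"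
    by (simp add: algebra_simps)
  have b2: "b\<^sup>2 = exp (2 * ln b)" using b unfolding mult_2 exp_add by (simp add: power2_eq_square)
  have "pull v k 1 * exp (\<epsilon> * ln b) = \<theta> * exp ((2 - \<gamma>) * log_mean v k 1 + \<epsilon> * ln b)"
    by (simp add: pull_def exp_add)
  also have "\<dots> \<le> \<theta> * exp ((2 - \<gamma>) * log_mean v k b + 2 * ln b)"
    using le theta_pos by simp
  also have "\<dots> = pull v k b" by (simp add: pull_def exp_add b2)
  finally show ?thesis .
qed

text \<open>If \<open>p\<close> stayed below \<open>P\<close>, the solution would be global and \<open>u\<close> would grow like \<open>r powr \<epsilon>\<close>, while
\<open>\<Phi> p\<close> stays bounded and \<open>exp ((\<beta> - 1) p)\<close> bounded away from \<open>0\<close>; so eventually \<open>r p' \<ge> 1\<close> and \<open>p\<close>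
would grow like \<open>ln r\<close>.\<close>

lemma log_ratio_reaches:
  assumes s: "scaled_solution R_sup v k" and P: "0 < P" and eps: "0 < \<epsilon>"
    and rate: "\<And>p. 0 < p \<Longrightarrow> p < P \<Longrightarrow> \<epsilon> \<le> 2 - 3 * (2 - \<gamma>) * (1 - exp (- p))"
  shows "\<exists>r\<in>radii R_sup. P \<le> log_ratio v r"
proof (rule ccontr)
  assume "\<not> ?thesis"
  then have lt: "log_ratio v r < P" if "r \<in> radii R_sup" for r
    using that by (auto simp: not_le)
  have inf: "R_sup = \<infinity>"
  proof (cases R_sup)
    case (real R)
    have "0 < R" using s real by (simp add: scaled_solution_def)
    then have le: "log_ratio v r \<le> P" if "r \<in> {R/2..<R}" for r
      using lt[of r] that by (simp add: real radii_ereal)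
    have "scaled_solution (ereal R) v k" using s real by simp
    then obtain Z v' k' where "R < Z" "scaled_solution (ereal Z) v' k'"
      using bounded_log_ratio_extends[OF _ le] by blast
    then show ?thesis using scaled_solution_le_R_sup[of "ereal Z"] real by simp
  qed (use s in \<open>auto simp: scaled_solution_def\<close>)
  have all: "r \<in> radii R_sup" if "0 \<le> r" for r using that by (simp add: inf radii_def)
  have "continuous_on {0..P} restoring"
    unfolding restoring_def[abs_def] exp_rem_def by (intro continuous_intros)
  then obtain C where C: "\<And>p. p \<in> {0..P} \<Longrightarrow> norm (restoring p) \<le> C"
    using continuous_on_Icc_norm_bound by blast
  define c where "c = exp (- \<bar>\<beta> - 1\<bar> * P)"
  have c: "0 < c" by (simp add: c_def)
  obtain r1 where r1: "1 \<le> r1" "\<And>x. r1 \<le> x \<Longrightarrow> C + 1 \<le> pull v k 1 * c * exp (\<epsilon> * ln x)"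
    using exp_growth_exceeds[OF eps, of "pull v k 1 * c" "C + 1"] pull_pos[of 1 v k] c by auto
  \<comment> \<open>a stretch of length \<open>P\<close> in \<open>ln r\<close> on which \<open>p\<close> grows at least like \<open>ln r\<close>\<close>
  define b where "b = r1 * exp P"
  have b: "r1 \<le> b" using r1(1) P by (simp add: b_def)
  have "log_ratio v r1 - ln r1 \<le> log_ratio v b - ln b"
  proof (rule DERIV_nonneg_imp_nondecreasing[OF b])
    fix x assume x: "r1 \<le> x" "x \<le> b"
    then have xR: "x \<in> radii R_sup" "0 < x" "1 \<le> x" using all[of x] r1 by auto
    have p: "0 < log_ratio v x" "log_ratio v x < P"
      using log_ratio_pos[OF s xR(1,2)] lt[OF xR(1)] by auto
    have "pull v k 1 * exp (\<epsilon> * ln x) \<le> pull v k x"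
    proof (rule pull_growth[OF s xR(3,1)])
      fix z assume "z \<in> {1..x}"
      then show "\<epsilon> \<le> 2 - 3 * (2 - \<gamma>) * (1 - exp (- log_ratio v z))"
        using log_ratio_pos[OF s all, of z] lt[OF all, of z] by (intro rate) auto
    qed
    moreover have "c \<le> exp ((\<beta> - 1) * log_ratio v x)"
    proof -
      have "\<bar>(\<beta> - 1) * log_ratio v x\<bar> \<le> \<bar>\<beta> - 1\<bar> * P"
        using p by (simp add: abs_mult mult_left_mono)
      then show ?thesis by (simp add: c_def)
    qed
    ultimately have "pull v k 1 * exp (\<epsilon> * ln x) * c \<le> pull v k x * exp ((\<beta> - 1) * log_ratio v x)"
      using c pull_pos[of x v k] xR by (intro mult_mono) auto
    then have "C + 1 \<le> pull v k x * exp ((\<beta> - 1) * log_ratio v x)"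
      using r1(2)[OF x(1)] by (simp add: mult_ac)
    then have big: "1 \<le> pull v k x * exp ((\<beta> - 1) * log_ratio v x) - restoring (log_ratio v x)"
      using C[of "log_ratio v x"] p by (auto simp: abs_le_iff)
    have "((\<lambda>x. log_ratio v x - ln x) has_real_derivative
        (pull v k x * exp ((\<beta> - 1) * log_ratio v x) - restoring (log_ratio v x) - 1) / x) (at x)"
      by (rule derivative_eq_intros log_ratio_DERIV[OF s xR(1,2)] xR refl)+ (simp add: diff_divide_distrib)
    then show "\<exists>y. ((\<lambda>x. log_ratio v x - ln x) has_real_derivative y) (at x) \<and> 0 \<le> y"
      using big xR by (intro exI conjI) auto
  qed
  moreover have "ln b = ln r1 + P" using r1 by (simp add: b_def ln_mult)
  moreover have "0 < log_ratio v r1" using log_ratio_pos[OF s all] r1 by simp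
  ultimately have "P < log_ratio v b" by simp
  then show False using lt[OF all, of b] b r1 by simp
qed

text \<open>For \<open>1 < \<beta> \<le> \<gamma>\<close> the elastic term has the sign that lets \<open>p\<close> grow, so \<open>\<Phi> \<le> 3\<close>. The quantity
\<open>S = exp (- (\<beta> - 1) p) = y powr (\<beta> - 1)\<close> turns the equation for \<open>p\<close>, which blows up, into one with
\<open>r S' \<le> - (\<beta> - 1)\<close> as soon as \<open>u \<ge> 4\<close>.\<close>

lemma R_sup_finite:
  assumes b: "1 < \<beta>" "\<beta> \<le> \<gamma>" and g: "2 < \<gamma>"
  shows "R_sup < \<infinity>"
proof (rule ccontr)
  assume "\<not> ?thesis"
  then have inf: "R_sup = \<infinity>" by simp
  obtain v k where s: "scaled_solution R_sup v k" by (rule maximal_scaled_solution)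
  have all: "r \<in> radii R_sup" if "0 \<le> r" for r using that by (simp add: inf radii_def)
  have pos: "0 < log_ratio v r" if "0 < r" for r using log_ratio_pos[OF s all] that by simp
  have grow: "pull v k 1 * exp (2 * ln x) \<le> pull v k x" if "1 \<le> x" for x
  proof (rule pull_growth[OF s that all])
    fix z assume "z \<in> {1..x}"
    then have "0 \<le> (\<gamma> - 2) * (1 - exp (- log_ratio v z))" using pos[of z] g by (intro mult_nonneg_nonneg) auto
    then show "2 \<le> 2 - 3 * (2 - \<gamma>) * (1 - exp (- log_ratio v z))" by (simp add: algebra_simps)
  qed (use that in simp)
  obtain r1 where r1: "1 \<le> r1" "\<And>x. r1 \<le> x \<Longrightarrow> 4 \<le> pull v k 1 * exp (2 * ln x)"
    using exp_growth_exceeds[of 2 "pull v k 1" 4] pull_pos[of 1 v k] by auto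
  have rest: "restoring p \<le> 3" for p
  proof -
    have "3 * (\<beta> - \<gamma>) / (\<beta> * (\<beta> - 1)) \<le> 0" using b by (simp add: divide_le_0_iff)
    moreover have "0 \<le> exp_rem ((\<beta> - 1) * p) + (\<beta> - 1) * exp_rem (- p)"
      using b exp_rem_nonneg by (intro add_nonneg_nonneg mult_nonneg_nonneg) auto
    ultimately have "3 * (\<beta> - \<gamma>) / (\<beta> * (\<beta> - 1)) * (exp_rem ((\<beta> - 1) * p) + (\<beta> - 1) * exp_rem (- p)) \<le> 0"
      by (rule mult_nonpos_nonneg)
    moreover have "3 * (1 - exp (- p)) \<le> 3" by simp
    ultimately have "restoring p \<le> 3 + 0" unfolding restoring_def by (rule add_mono[rotated])
    then show ?thesis by simp
  qed
  define S where "S x = exp (- ((\<beta> - 1) * log_ratio v x))" for x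
  \<comment> \<open>over this range \<open>S\<close> would decrease by at least \<open>2\<close>, although \<open>0 < S \<le> 1\<close>\<close>
  define c where "c = r1 * exp (2 / (\<beta> - 1))"
  have c: "r1 \<le> c" using r1 b by (simp add: c_def)
  have "S c + (\<beta> - 1) * ln c \<le> S r1 + (\<beta> - 1) * ln r1"
  proof (rule DERIV_nonpos_imp_nonincreasing[OF c])
    fix x assume x: "r1 \<le> x" "x \<le> c"
    then have xR: "x \<in> radii R_sup" "0 < x" "1 \<le> x" using all[of x] r1 by auto
    have "((\<lambda>x. S x + (\<beta> - 1) * ln x) has_real_derivative
        - (\<beta> - 1) * (S x * (pull v k x * exp ((\<beta> - 1) * log_ratio v x)) - S x * restoring (log_ratio v x) - 1) / x) (at x)"
      unfolding S_def
      by (rule derivative_eq_intros log_ratio_DERIV[OF s xR(1,2)] xR refl)+ (use xR in \<open>simp add: field_simps\<close>)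
    moreover have "S x * (pull v k x * exp ((\<beta> - 1) * log_ratio v x)) = pull v k x"
    proof -
      have "S x * exp ((\<beta> - 1) * log_ratio v x) = 1" by (simp add: S_def flip: exp_add)
      then show ?thesis by (simp add: mult.left_commute)
    qed
    moreover have "S x * restoring (log_ratio v x) \<le> 3"
    proof -
      have S: "0 < S x" "S x \<le> 1" using pos[of x] xR b by (auto simp: S_def)
      have "S x * restoring (log_ratio v x) \<le> S x * 3" by (rule mult_left_mono[OF rest]) (use S in simp)
      then show ?thesis using S(2) by linarith
    qed
    moreover have "4 \<le> pull v k x" using r1(2)[OF x(1)] grow[OF xR(3)] by simp
    ultimately show "\<exists>y. ((\<lambda>x. S x + (\<beta> - 1) * ln x) has_real_derivative y) (at x) \<and> y \<le> 0"
      using xR b by (intro exI conjI) (auto intro!: divide_nonpos_pos mult_nonpos_nonneg)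
  qed
  moreover have "ln c = ln r1 + 2 / (\<beta> - 1)" using r1 by (simp add: c_def ln_mult)
  then have "(\<beta> - 1) * ln c = (\<beta> - 1) * ln r1 + 2" using b by (simp add: field_simps)
  moreover have "S r1 \<le> 1" using pos[of r1] r1 b by (simp add: S_def)
  moreover have "0 < S c" by (simp add: S_def)
  ultimately show False by linarith
qed

text \<open>For \<open>\<beta> < 1\<close> and \<open>p > 0\<close> all exponentials in \<open>\<Phi>\<close> and the damping factor \<open>exp ((\<beta> - 1) p)\<close> are at most \<open>1\<close>,
and \<open>u\<close> is bounded at finite radii because \<open>\<eta>\<close> decreases and \<open>2 - \<gamma> > 0\<close>. Hence \<open>p'\<close> is bounded there.\<close>

lemma R_sup_infinite:
  assumes b: "\<beta> < 1" and g: "\<gamma> \<le> 1"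
  shows "R_sup = \<infinity>"
proof (cases R_sup)
  case (real R)
  obtain v k where "scaled_solution R_sup v k" by (rule maximal_scaled_solution)
  then have s: "scaled_solution (ereal R) v k" using real by simp
  have R: "0 < R" using s by (simp add: scaled_solution_def)
  define a where "a = R / 2"
  have a: "0 < a" "a < R" "a \<in> radii (ereal R)" using R by (auto simp: a_def radii_ereal)
  define M where "M = \<bar>3 * (\<beta> - \<gamma>) / (\<beta> * (\<beta> - 1))\<bar> * (1 + \<bar>\<beta> - 1\<bar> + \<bar>\<beta>\<bar>)"
  define N where "N = \<theta> * R\<^sup>2 * exp ((2 - \<gamma>) * log_mean v k a) + M"
  have N: "0 \<le> N" using theta_pos by (simp add: N_def M_def)
  have rest: "- M \<le> restoring p" if p: "0 < p" for p
  proof -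
    have e: "exp_rem ((\<beta> - 1) * p) + (\<beta> - 1) * exp_rem (- p) = exp ((\<beta> - 1) * p) + (\<beta> - 1) * exp (- p) - \<beta>"
      by (simp add: exp_rem_def algebra_simps)
    have tri: "\<bar>x + y - z\<bar> \<le> 1 + c + \<bar>z\<bar>" if "\<bar>x\<bar> \<le> 1" "\<bar>y\<bar> \<le> c" for x y z c :: real
      using that by linarith
    have "\<bar>exp ((\<beta> - 1) * p)\<bar> \<le> 1" using b p by (simp add: mult_nonpos_nonneg)
    moreover have "\<bar>(\<beta> - 1) * exp (- p)\<bar> \<le> \<bar>\<beta> - 1\<bar>"
      unfolding abs_mult using p by (intro mult_left_le) auto
    ultimately have "\<bar>exp_rem ((\<beta> - 1) * p) + (\<beta> - 1) * exp_rem (- p)\<bar> \<le> 1 + \<bar>\<beta> - 1\<bar> + \<bar>\<beta>\<bar>"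
      unfolding e by (rule tri)
    then have "\<bar>3 * (\<beta> - \<gamma>) / (\<beta> * (\<beta> - 1)) * (exp_rem ((\<beta> - 1) * p) + (\<beta> - 1) * exp_rem (- p))\<bar> \<le> M"
      unfolding abs_mult[of "3 * (\<beta> - \<gamma>) / (\<beta> * (\<beta> - 1))"] M_def by (intro mult_left_mono) auto
    moreover have "0 \<le> 3 * (1 - exp (- p))" using p by simp
    ultimately show ?thesis unfolding restoring_def abs_le_iff by linarith
  qed
  have bound: "log_ratio v r \<le> log_ratio v a + N * (ln R - ln a)" if r: "r \<in> {R/2..<R}" for r
  proof -
    have ar: "a \<le> r" and rR: "r \<in> radii (ereal R)" using r R by (auto simp: a_def radii_ereal)
    have "log_ratio v r - N * ln r \<le> log_ratio v a - N * ln a"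
    proof (rule DERIV_nonpos_imp_nonincreasing[OF ar])
      fix x assume x: "a \<le> x" "x \<le> r"
      then have xR: "x \<in> radii (ereal R)" "0 < x" using radii_down[OF rR] a by auto
      have p: "0 < log_ratio v x" by (rule log_ratio_pos[OF s xR])
      have "pull v k x * exp ((\<beta> - 1) * log_ratio v x) \<le> pull v k x * 1"
        using p b pull_pos[OF xR(2), of v k] by (intro mult_left_mono) (auto simp: mult_nonpos_nonneg)
      also have "\<dots> \<le> \<theta> * R\<^sup>2 * exp ((2 - \<gamma>) * log_mean v k a)"
      proof -
        have "(2 - \<gamma>) * log_mean v k x \<le> (2 - \<gamma>) * log_mean v k a"
          using log_mean_decreasing[OF s a(1) x(1) xR(1)] g by (intro mult_left_mono) auto
        moreover have "x\<^sup>2 \<le> R\<^sup>2" using x r xR by (intro power_mono) auto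
        ultimately show ?thesis
          using theta_pos unfolding pull_def by (simp add: mult_mono)
      qed
      finally have "pull v k x * exp ((\<beta> - 1) * log_ratio v x) - restoring (log_ratio v x) \<le> N"
        using rest[OF p] unfolding N_def by linarith
      moreover have "((\<lambda>x. log_ratio v x - N * ln x) has_real_derivative
          (pull v k x * exp ((\<beta> - 1) * log_ratio v x) - restoring (log_ratio v x) - N) / x) (at x)"
        by (rule derivative_eq_intros log_ratio_DERIV[OF s xR] xR refl)+ (use xR in \<open>simp add: field_simps\<close>)
      ultimately show "\<exists>y. ((\<lambda>x. log_ratio v x - N * ln x) has_real_derivative y) (at x) \<and> y \<le> 0"
        using xR by (intro exI conjI) (auto intro!: divide_nonpos_pos)
    qed
    moreover have "N * ln r \<le> N * ln R" using N r a ar by (intro mult_left_mono) auto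
    ultimately show ?thesis by (simp add: right_diff_distrib)
  qed
  obtain Z v' k' where "R < Z" "scaled_solution (ereal Z) v' k'"
    using bounded_log_ratio_extends[OF s bound] by blast
  then show ?thesis using scaled_solution_le_R_sup[of "ereal Z"] real by simp
next
  case MInf
  then show ?thesis using maximal_scaled_solution by (auto simp: scaled_solution_def)
qed simp

end

section \<open>Sign of the anisotropy\<close>

lemma powr_chord_DERIV:
  fixes t \<beta> :: real assumes "0 < t" "\<beta> \<noteq> 0"
  shows "((\<lambda>t. (1 - t powr \<beta>) / \<beta> + t) has_real_derivative 1 - t powr (\<beta> - 1)) (at t)"
  by (rule DERIV_cong[OF DERIV_add[OF DERIV_cdivide[OF DERIV_diff[OF DERIV_const
        has_real_derivative_powr[OF assms(1)]]] DERIV_ident]]) (use assms in simp)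

lemma powr_chord_le:
  fixes y \<beta> :: real assumes "1 < \<beta>" "0 < y" "y \<le> 1"
  shows "(1 - y powr \<beta>) / \<beta> \<le> 1 - y"
proof -
  have "(1 - y powr \<beta>) / \<beta> + y \<le> (1 - 1 powr \<beta>) / \<beta> + 1"
  proof (rule DERIV_nonneg_imp_nondecreasing[OF assms(3)])
    fix t assume t: "y \<le> t" "t \<le> 1"
    then have t0: "0 < t" using assms by simp
    have "t powr (\<beta> - 1) \<le> 1" using t t0 assms by (intro powr_le1) auto
    moreover have "((\<lambda>t. (1 - t powr \<beta>) / \<beta> + t) has_real_derivative 1 - t powr (\<beta> - 1)) (at t)"
      by (rule powr_chord_DERIV) (use t0 assms in auto)
    ultimately show "\<exists>z. ((\<lambda>t. (1 - t powr \<beta>) / \<beta> + t) has_real_derivative z) (at t) \<and> 0 \<le> z"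
      by (intro exI conjI) auto
  qed
  then show ?thesis by simp
qed

lemma powr_chord_ge:
  fixes y \<beta> :: real assumes "\<beta> < 1" "\<beta> \<noteq> 0" "0 < y" "y \<le> 1"
  shows "1 - y \<le> (1 - y powr \<beta>) / \<beta>"
proof -
  have "(1 - 1 powr \<beta>) / \<beta> + 1 \<le> (1 - y powr \<beta>) / \<beta> + y"
  proof (rule DERIV_nonpos_imp_nonincreasing[OF assms(4)])
    fix t assume t: "y \<le> t" "t \<le> 1"
    then have t0: "0 < t" using assms by simp
    have "1 powr (\<beta> - 1) \<le> t powr (\<beta> - 1)" using t t0 assms by (intro powr_mono2') auto
    moreover have "((\<lambda>t. (1 - t powr \<beta>) / \<beta> + t) has_real_derivative 1 - t powr (\<beta> - 1)) (at t)"
      by (rule powr_chord_DERIV) (use t0 assms in auto)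
    ultimately show "\<exists>z. ((\<lambda>t. (1 - t powr \<beta>) / \<beta> + t) has_real_derivative z) (at t) \<and> z \<le> 0"
      by (intro exI conjI) auto
  qed
  then show ?thesis by simp
qed

definition regime :: "real \<Rightarrow> real \<Rightarrow> bool" where
  "regime \<gamma> \<beta> \<longleftrightarrow> 1 < \<beta> \<and> \<beta> \<le> \<gamma> \<or> \<gamma> \<le> \<beta> \<and> \<beta> < 1 \<or> \<beta> < \<gamma> \<and> \<gamma> \<le> 1"

text \<open>With \<open>x = (1 - y powr \<beta>) / \<beta>\<close> and \<open>z = 1 - y\<close> the expression is
\<open>3 q / (2 (\<beta> - 1)) ((\<beta> - \<gamma>) x + (\<gamma> - 1) z) - z / 2\<close>. If \<open>\<beta> - \<gamma> \<le> 0\<close>, the tangent to the power at \<open>1\<close> allows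
replacing \<open>x\<close> by \<open>z\<close>, which leaves \<open>(3 q - 1) z / 2\<close>. If \<open>\<gamma> \<le> \<beta> < 1\<close>, the bound \<open>y \<le> y powr \<beta>\<close> gives
\<open>x \<le> z / \<beta>\<close> instead and leaves \<open>(3 q \<gamma> / \<beta> - 1) z / 2\<close>, which is nonnegative by the upper bound on \<open>\<beta>\<close>.\<close>

lemma anisotropy_coefficients_nonneg:
  fixes y \<beta> \<gamma> q :: real
  assumes b: "\<beta> \<noteq> 0" and g: "0 < \<gamma>" and q: "1 / 3 < q" and sound: "\<beta> \<le> 3 * q * \<gamma>"
    and y: "0 < y" "y \<le> 1" and reg: "regime \<gamma> \<beta>"
  shows "0 \<le> 3 * (\<beta> - \<gamma>) * q / (2 * \<beta> * (\<beta> - 1)) * (1 - y powr \<beta>)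
     + (3 * (\<gamma> - 1) * q / (2 * (\<beta> - 1)) - 1 / 2) * (1 - y)"
proof -
  define x where "x = (1 - y powr \<beta>) / \<beta>"
  define z where "z = 1 - y"
  define c where "c = 3 * q / (2 * (\<beta> - 1))"
  have b1: "\<beta> \<noteq> 1" using reg by (auto simp: regime_def)
  have z: "0 \<le> z" using y by (simp add: z_def)
  have eq: "3 * (\<beta> - \<gamma>) * q / (2 * \<beta> * (\<beta> - 1)) * (1 - y powr \<beta>)
     + (3 * (\<gamma> - 1) * q / (2 * (\<beta> - 1)) - 1 / 2) * (1 - y)
    = c * ((\<beta> - \<gamma>) * x + (\<gamma> - 1) * z) - z / 2"
  proof -
    have x: "1 - y powr \<beta> = \<beta> * x" using b by (simp add: x_def)
    have t: "3 * (\<beta> - \<gamma>) * q / (2 * \<beta> * (\<beta> - 1)) * (\<beta> * x) = c * ((\<beta> - \<gamma>) * x)"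
      "3 * (\<gamma> - 1) * q / (2 * (\<beta> - 1)) = c * (\<gamma> - 1)"
      using b by (simp_all add: c_def)
    show ?thesis unfolding x t z_def[symmetric] by (simp add: algebra_simps)
  qed
  have c1: "c * (\<beta> - 1) = 3 * q / 2" using b1 unfolding c_def by (simp add: divide_simps)
  have core: "z / 2 \<le> c * ((\<beta> - 1) * z)"
  proof -
    have "1 / 2 * z \<le> 3 * q / 2 * z" using q z by (intro mult_right_mono) auto
    then show ?thesis unfolding c1[symmetric] by (simp add: mult.assoc)
  qed
  from reg[unfolded regime_def] consider (gt) "1 < \<beta>" "\<beta> \<le> \<gamma>" | (mid) "\<gamma> \<le> \<beta>" "\<beta> < 1" | (lt) "\<beta> < \<gamma>" "\<gamma> \<le> 1" by blast
  then have "z / 2 \<le> c * ((\<beta> - \<gamma>) * x + (\<gamma> - 1) * z)"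
  proof cases
    case gt
    have "x \<le> z" unfolding x_def z_def using gt y by (intro powr_chord_le)
    then have "(\<beta> - \<gamma>) * z \<le> (\<beta> - \<gamma>) * x" using gt by (intro mult_left_mono_neg) auto
    then have "(\<beta> - 1) * z \<le> (\<beta> - \<gamma>) * x + (\<gamma> - 1) * z" by (simp add: algebra_simps)
    moreover have "0 \<le> c" using gt q by (simp add: c_def)
    ultimately show ?thesis using core by (meson mult_left_mono order_trans)
  next
    case lt
    have "z \<le> x" unfolding x_def z_def using lt y b by (intro powr_chord_ge) auto
    then have "(\<beta> - \<gamma>) * x \<le> (\<beta> - \<gamma>) * z" using lt by (intro mult_left_mono_neg) auto
    then have "(\<beta> - \<gamma>) * x + (\<gamma> - 1) * z \<le> (\<beta> - 1) * z" by (simp add: algebra_simps)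
    moreover have "c \<le> 0" using lt q by (simp add: c_def divide_le_0_iff)
    ultimately show ?thesis using core by (meson mult_left_mono_neg order_trans)
  next
    case mid
    have b0: "0 < \<beta>" using mid g by simp
    have "y powr 1 \<le> y powr \<beta>" using y mid by (intro powr_mono') auto
    then have "x \<le> z / \<beta>" unfolding x_def z_def using y b0 by (intro divide_right_mono) auto
    then have "(\<beta> - \<gamma>) * x \<le> (\<beta> - \<gamma>) * (z / \<beta>)" using mid by (intro mult_left_mono) auto
    then have "(\<beta> - \<gamma>) * x + (\<gamma> - 1) * z \<le> (\<beta> - 1) * z * (\<gamma> / \<beta>)" using b0 by (simp add: field_simps)
    moreover have "c \<le> 0" using mid q by (simp add: c_def divide_le_0_iff)
    ultimately have "c * ((\<beta> - 1) * z * (\<gamma> / \<beta>)) \<le> c * ((\<beta> - \<gamma>) * x + (\<gamma> - 1) * z)"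
      by (rule mult_left_mono_neg)
    moreover have "c * ((\<beta> - 1) * z * (\<gamma> / \<beta>)) = z / 2 * (3 * q * \<gamma> / \<beta>)"
    proof -
      have "c * ((\<beta> - 1) * z * (\<gamma> / \<beta>)) = c * (\<beta> - 1) * (z * (\<gamma> / \<beta>))" by (simp only: mult.assoc)
      then show ?thesis unfolding c1 by simp
    qed
    moreover have "z / 2 * 1 \<le> z / 2 * (3 * q * \<gamma> / \<beta>)"
      using z sound b0 by (intro mult_left_mono) auto
    ultimately show ?thesis unfolding mult_1_right by linarith
  qed
  then show ?thesis unfolding eq by simp
qed

section \<open>Constitutive functions along a solution\<close>

text \<open>The assumption \<open>base_pos\<close> means \<open>y_b > 0\<close>: the surface is reached at a positive density.\<close>

locale sound_elastic_ball = elastic_ball +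
  assumes base_pos: "0 < 1 - \<beta> / (3 * \<gamma>) * ((1 + \<nu>) / (1 - \<nu>))"
    and sound: "\<beta> \<le> 3 * ((1 - \<nu>) / (1 + \<nu>)) * \<gamma>"
    and reg: "regime \<gamma> \<beta>"
begin

text \<open>\<open>base = y_b powr \<beta>\<close>, \<open>P_b = - ln y_b\<close>, and \<open>anisotropy p = (1 - y) Q y\<close> for \<open>y = exp (- p)\<close>.\<close>

definition q where "q = (1 - \<nu>) / (1 + \<nu>)"
definition stiffness where "stiffness = 3 * \<kappa> * q / \<beta>"
definition shear1 where "shear1 = 3 * (\<beta> - \<gamma>) * q / (2 * \<beta> * (\<beta> - 1))"
definition shear2 where "shear2 = 3 * (\<gamma> - 1) * q / (2 * (\<beta> - 1)) - 1 / 2"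
definition base where "base = 1 - \<beta> / (3 * \<gamma> * q)"
definition P_b where "P_b = - ln base / \<beta>"
definition anisotropy where "anisotropy p = shear1 * (1 - exp (- (\<beta> * p))) + shear2 * (1 - exp (- p))"

lemma q_gt: "1 / 3 < q" using nu by (simp add: q_def field_simps)

lemma base_eq: "base = 1 - \<beta> / (3 * \<gamma>) * ((1 + \<nu>) / (1 - \<nu>))"
  using nu by (simp add: base_def q_def)

lemma base: "0 < base" using base_pos by (simp add: base_eq)

lemma exp_P_b: "exp (- (\<beta> * P_b)) = base"
  using beta_ne base by (simp add: P_b_def)

lemma y_b_eq: "y_b \<nu> \<gamma> \<beta> = exp (- P_b)"
  using base unfolding y_b_def base_eq[symmetric] by (simp add: P_b_def powr_def)

lemma P_b_pos: "0 < P_b"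
proof -
  define d where "d = 3 * \<gamma> * q"
  have "0 < d" using gamma0 q_gt by (simp add: d_def)
  then have "base < 1 \<longleftrightarrow> 0 < \<beta>" "1 < base \<longleftrightarrow> \<beta> < 0"
    unfolding base_def d_def[symmetric] by (auto simp: zero_less_divide_iff divide_less_0_iff)
  then show ?thesis using base beta_ne
    by (cases "0 < \<beta>") (auto simp: P_b_def divide_less_0_iff zero_less_divide_iff)
qed

lemma F_rad_exp:
  "F_rad \<kappa> \<nu> \<gamma> \<beta> (exp (L - p)) (exp L) = stiffness * (exp (- (\<beta> * p)) - base) * exp (\<gamma> * L)"
proof -
  have "exp (L - p) / exp L = exp (- p)" by (simp add: exp_diff exp_minus field_simps)
  moreover have "y_b \<nu> \<gamma> \<beta> powr \<beta> = base" unfolding y_b_eq exp_P_b[symmetric] by (simp add: powr_def)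
  ultimately show ?thesis by (simp add: F_rad_def powr_def stiffness_def q_def[symmetric])
qed

text \<open>In the product \<open>(1 - y) Q y\<close> the denominator of \<open>Q\<close> cancels; at \<open>y = 1\<close> both sides vanish.\<close>

lemma F_tan_exp:
  "F_tan \<kappa> \<nu> \<gamma> \<beta> (exp (L - p)) (exp L) = F_rad \<kappa> \<nu> \<gamma> \<beta> (exp (L - p)) (exp L) + 3 * \<kappa> * anisotropy p * exp (\<gamma> * L)"
proof -
  define y where "y = exp (- p)"
  have y: "exp (L - p) / exp L = y" by (simp add: y_def exp_diff exp_minus field_simps)
  have yb: "y powr \<beta> = exp (- (\<beta> * p))" by (simp add: y_def powr_def)
  have "(1 - y) * Q \<nu> \<gamma> \<beta> y = anisotropy p"
  proof (cases "y = 1")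
    case True
    then have "p = 0" by (simp add: y_def)
    then show ?thesis using True by (simp add: anisotropy_def)
  next
    case False
    define X where "X = exp (- (\<beta> * p))"
    define t where "t = 1 - y"
    have t: "t \<noteq> 0" using False by (simp add: t_def)
    have sh: "3 * (\<beta> - \<gamma>) * (1 - \<nu>) / (2 * \<beta> * (\<beta> - 1) * (1 + \<nu>)) = shear1"
      "3 * (\<gamma> - 1) * (1 - \<nu>) / (2 * (\<beta> - 1) * (1 + \<nu>)) - 1 / 2 = shear2"
      by (simp_all add: shear1_def shear2_def q_def mult_ac)
    have "Q \<nu> \<gamma> \<beta> y = shear1 * ((1 - X) / t) + shear2"
      unfolding Q_def sh(1) sh(2)[symmetric] using False by (simp add: yb X_def t_def)
    then show ?thesis
      unfolding anisotropy_def y_def[symmetric] X_def[symmetric] t_def[symmetric]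
      using t by (simp add: distrib_left mult.commute)
  qed
  then show ?thesis unfolding F_tan_def y by (simp add: powr_def mult.assoc)
qed

lemma anisotropy_nonneg: "0 \<le> p \<Longrightarrow> 0 \<le> anisotropy p"
  using anisotropy_coefficients_nonneg[of \<beta> \<gamma> q "exp (- p)"] beta_ne gamma0 q_gt sound reg
  by (simp add: anisotropy_def shear1_def shear2_def powr_def flip: q_def)

lemma F_rad_exp_pos_iff: "0 < F_rad \<kappa> \<nu> \<gamma> \<beta> (exp (L - p)) (exp L) \<longleftrightarrow> p < P_b"
proof -
  have "0 < stiffness * (exp (- (\<beta> * p)) - base) \<longleftrightarrow> p < P_b"
  proof (cases "0 < \<beta>")
    case True
    then have "0 < stiffness" using kappa0 q_gt by (simp add: stiffness_def)
    then show ?thesis unfolding exp_P_b[symmetric] using True by (simp add: zero_less_mult_iff)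
  next
    case False
    then have "stiffness < 0" using kappa0 q_gt beta_ne
      by (simp add: stiffness_def divide_pos_neg)
    then show ?thesis unfolding exp_P_b[symmetric] using False beta_ne
      by (simp add: zero_less_mult_iff mult_less_cancel_left_neg)
  qed
  then show ?thesis unfolding F_rad_exp by (simp add: zero_less_mult_iff)
qed

lemma F_rad_exp_zero_iff: "F_rad \<kappa> \<nu> \<gamma> \<beta> (exp (L - p)) (exp L) = 0 \<longleftrightarrow> p = P_b"
  unfolding F_rad_exp exp_P_b[symmetric] using kappa0 q_gt beta_ne by (auto simp: stiffness_def)

lemma local_density_exp: "local_density k r = exp (log_mean v k r - log_ratio v r)"
  and average_density_exp: "average_density v k r = exp (log_mean v k r)"
  using dc0 by (simp_all add: local_density_def average_density_def log_mean_def log_ratio_def exp_diff exp_add exp_minus field_simps)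

lemma p_tan_ge_p_rad:
  assumes s: "scaled_solution R v k" and r: "r \<in> radii R"
  shows "F_rad \<kappa> \<nu> \<gamma> \<beta> (local_density k r) (average_density v k r) \<le> F_tan \<kappa> \<nu> \<gamma> \<beta> (local_density k r) (average_density v k r)"
proof -
  have "0 \<le> log_ratio v r"
    using log_ratio_pos[OF s r] radii_ge0[OF r] by (cases "r = 0") (auto simp: log_ratio_def)
  then show ?thesis
    unfolding local_density_exp[of k r v] average_density_exp F_tan_exp using anisotropy_nonneg kappa0 by simp
qed

text \<open>The density and both pressures are linear combinations of products of powers of \<open>\<delta>\<close> and \<open>\<eta>\<close>, that is, of
exponentials of linear combinations of \<open>r\<^sup>2 v\<close> and \<open>r\<^sup>2 k\<close>.\<close>

lemma pressures_C1_flat: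
  assumes s: "scaled_solution R v k"
  shows "C1_flat (radii R) (\<lambda>r. K * local_density k r)"
    "C1_flat (radii R) (\<lambda>r. F_rad \<kappa> \<nu> \<gamma> \<beta> (local_density k r) (average_density v k r))"
    "C1_flat (radii R) (\<lambda>r. F_tan \<kappa> \<nu> \<gamma> \<beta> (local_density k r) (average_density v k r))"
proof -
  note flat = scaled_solution_C1_flat[OF s]
  have p: "C1_flat (radii R) (log_ratio v)"
    using flat(1) by (simp add: log_ratio_def[abs_def])
  have "C1_flat (radii R) (\<lambda>r. (ln dc + r\<^sup>2 * v r) + (-1) * (r\<^sup>2 * k r))"
    by (intro C1_flat_add C1_flat_const C1_flat_cmult flat)
  then have L: "C1_flat (radii R) (log_mean v k)" by (simp add: log_mean_def[abs_def])
  have X: "C1_flat (radii R) (\<lambda>r. exp (a * log_ratio v r + b * log_mean v k r))" for a b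
    by (intro C1_flat_exp C1_flat_add C1_flat_cmult p L)
  have "C1_flat (radii R) (\<lambda>r. K * exp (-1 * log_ratio v r + 1 * log_mean v k r))"
    by (intro C1_flat_cmult X)
  then show "C1_flat (radii R) (\<lambda>r. K * local_density k r)" by (simp add: local_density_exp[of k _ v])
  have split: "exp (- \<beta> * x + \<gamma> * l) = exp (- (\<beta> * x)) * exp (\<gamma> * l)"
    "exp (- 1 * x + \<gamma> * l) = exp (- x) * exp (\<gamma> * l)" "exp (0 * x + \<gamma> * l) = exp (\<gamma> * l)" for x l
    by (simp_all flip: exp_add)
  have "C1_flat (radii R) (\<lambda>r. stiffness * exp (- \<beta> * log_ratio v r + \<gamma> * log_mean v k r)
      + (- (stiffness * base)) * exp (0 * log_ratio v r + \<gamma> * log_mean v k r))"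
    by (intro C1_flat_cmult C1_flat_add X)
  then show rad: "C1_flat (radii R) (\<lambda>r. F_rad \<kappa> \<nu> \<gamma> \<beta> (local_density k r) (average_density v k r))"
    unfolding split local_density_exp[of k _ v] average_density_exp F_rad_exp by (simp add: algebra_simps)
  have "C1_flat (radii R) (\<lambda>r. F_rad \<kappa> \<nu> \<gamma> \<beta> (local_density k r) (average_density v k r)
      + 3 * \<kappa> * ((shear1 + shear2) * exp (0 * log_ratio v r + \<gamma> * log_mean v k r)
        + ((- shear1) * exp (- \<beta> * log_ratio v r + \<gamma> * log_mean v k r)
        + (- shear2) * exp (- 1 * log_ratio v r + \<gamma> * log_mean v k r))))"
    by (intro C1_flat_cmult C1_flat_add X rad)
  then show "C1_flat (radii R) (\<lambda>r. F_tan \<kappa> \<nu> \<gamma> \<beta> (local_density k r) (average_density v k r))"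
    unfolding split local_density_exp[of k _ v] average_density_exp F_tan_exp anisotropy_def by (simp add: algebra_simps)
qed

text \<open>The equation for \<open>\<eta>\<close> is \<open>(r ^ 3 \<eta>)' = 3 r\<^sup>2 \<delta>\<close>, so \<open>\<eta>\<close> is indeed the mean density.\<close>

lemma density_integral:
  assumes s: "scaled_solution R v k" and r: "r \<in> radii R" "0 < r"
  shows "integral {0..r} (\<lambda>s. local_density k s * s\<^sup>2) = r ^ 3 / 3 * average_density v k r"
proof -
  have reg: "regular R (local_density k) (average_density v k)" by (rule scaled_imp_regular[OF s])
  have sub: "{0..r} \<subseteq> radii R" using radii_down[OF r(1)] by auto
  have c: "continuous_on {0..r} (average_density v k)"
    using reg sub by (auto simp: strongly_regular_solution_def elim: continuous_on_subset)
  have "((\<lambda>s. local_density k s * s\<^sup>2) has_integral (1 / 3 * (r ^ 3 * average_density v k r) - 1 / 3 * (0 ^ 3 * average_density v k 0))) {0..r}"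
  proof (rule fundamental_theorem_of_calculus_interior)
    show "continuous_on {0..r} (\<lambda>s. 1 / 3 * (s ^ 3 * average_density v k s))" by (intro continuous_intros c)
    fix x assume x: "x \<in> {0<..<r}"
    then have "x \<in> radii R - {0}" using sub by auto
    then have e: "(average_density v k has_real_derivative - (3 / x) * (average_density v k x - local_density k x)) (at x)"
      using reg by (auto simp: strongly_regular_solution_def)
    have "((\<lambda>s. 1 / 3 * (s ^ 3 * average_density v k s)) has_real_derivative local_density k x * x\<^sup>2) (at x)"
      by (rule derivative_eq_intros e refl)+ (use x in \<open>simp_all add: field_simps eval_nat_numeral\<close>)
    then show "((\<lambda>s. 1 / 3 * (s ^ 3 * average_density v k s)) has_vector_derivative local_density k x * x\<^sup>2) (at x)"
      by (simp add: has_real_derivative_iff_has_vector_derivative)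
  qed (use r in simp)
  then show ?thesis by (simp add: integral_unique)
qed

text \<open>Differentiate \<open>p_rad = C (y powr \<beta> - base) \<eta> powr \<gamma>\<close> with the equations for \<open>p = - ln y\<close> and \<open>ln \<eta>\<close>. The
\<open>u\<close>-term is the weight (here the value of \<open>\<theta>\<close> matters); the remaining terms form a polynomial identity in
\<open>y\<close> and \<open>X = y powr \<beta>\<close>, and \<open>Q\<close> is exactly the function that makes it hold.\<close>

lemma equilibrium:
  assumes s: "scaled_solution R v k" and r: "r \<in> radii R" "0 < r"
  shows "((\<lambda>r. F_rad \<kappa> \<nu> \<gamma> \<beta> (local_density k r) (average_density v k r)) has_real_derivative
     2 / r * (F_tan \<kappa> \<nu> \<gamma> \<beta> (local_density k r) (average_density v k r) - F_rad \<kappa> \<nu> \<gamma> \<beta> (local_density k r) (average_density v k r))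
     - G * (K * local_density k r) * (4 * pi * (K * (r ^ 3 / 3 * average_density v k r)) / r\<^sup>2)) (at r)"
proof -
  define p where "p = log_ratio v r"
  define L where "L = log_mean v k r"
  define y where "y = exp (- p)"
  define X where "X = exp (- (\<beta> * p))"
  define E where "E = exp (\<gamma> * L)"
  define u where "u = pull v k r"
  define C where "C = stiffness"
  define dp where "dp = (u * exp ((\<beta> - 1) * p) - restoring p) / r"
  define dL where "dL = - 3 * (1 - y) / r"
  have p': "(log_ratio v has_real_derivative dp) (at r)"
    unfolding dp_def u_def p_def by (rule log_ratio_DERIV[OF s r])
  have L': "(log_mean v k has_real_derivative dL) (at r)"
    unfolding dL_def y_def p_def by (rule log_mean_DERIV[OF s r])
  have q0: "0 < q" using q_gt by simp
  have Xe: "X * exp ((\<beta> - 1) * p) = y" unfolding X_def y_def exp_add[symmetric] by (simp add: algebra_simps)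
  have rest: "X * restoring p = 3 * (1 - y) * X
      + 3 * (\<beta> - \<gamma>) / (\<beta> * (\<beta> - 1)) * (y + (\<beta> - 1) * y * X - \<beta> * X)"
  proof -
    \<comment> \<open>the linear parts of the two remainders cancel\<close>
    have "exp_rem ((\<beta> - 1) * p) + (\<beta> - 1) * exp_rem (- p) = exp ((\<beta> - 1) * p) + (\<beta> - 1) * y - \<beta>"
      by (simp add: exp_rem_def y_def algebra_simps)
    then have "X * restoring p = 3 * (1 - y) * X
        + 3 * (\<beta> - \<gamma>) / (\<beta> * (\<beta> - 1)) * (X * (exp ((\<beta> - 1) * p) + (\<beta> - 1) * y - \<beta>))"
      unfolding restoring_def by (simp add: y_def[symmetric] distrib_left mult_ac)
    also have "X * (exp ((\<beta> - 1) * p) + (\<beta> - 1) * y - \<beta>) = y + (\<beta> - 1) * y * X - \<beta> * X"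
      using Xe by (simp add: algebra_simps)
    finally show ?thesis .
  qed
  have D: "((\<lambda>r. C * (exp (- (\<beta> * log_ratio v r)) - base) * exp (\<gamma> * log_mean v k r)) has_real_derivative
      C * (E * (- \<beta> * X * dp + (X - base) * (\<gamma> * dL)))) (at r)"
    by (rule derivative_eq_intros p' L' refl)+
      (simp add: X_def E_def p_def[symmetric] L_def[symmetric] algebra_simps)
  have F: "F_rad \<kappa> \<nu> \<gamma> \<beta> (local_density k r) (average_density v k r) = C * (exp (- (\<beta> * log_ratio v r)) - base) * exp (\<gamma> * log_mean v k r)" for r
    unfolding local_density_exp[of k r v] average_density_exp F_rad_exp by (simp add: C_def)
  have T: "F_tan \<kappa> \<nu> \<gamma> \<beta> (local_density k r) (average_density v k r) - F_rad \<kappa> \<nu> \<gamma> \<beta> (local_density k r) (average_density v k r) = 3 * \<kappa> * anisotropy p * E"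
    unfolding local_density_exp[of k r v] average_density_exp F_tan_exp by (simp add: p_def E_def L_def)
  have gravity_part: "C * (E * (\<beta> * (u * y))) / r = G * (K * local_density k r) * (4 * pi * (K * (r ^ 3 / 3 * average_density v k r)) / r\<^sup>2)"
  proof -
    have dm: "local_density k r = y * exp L" "average_density v k r = exp L"
      unfolding local_density_exp[of k r v] average_density_exp by (simp_all add: y_def p_def L_def exp_diff exp_minus field_simps)
    have uE: "u * E = \<theta> * r\<^sup>2 * (exp L * exp L)"
    proof -
      have "exp ((2 - \<gamma>) * L) * exp (\<gamma> * L) = exp L * exp L"
        unfolding exp_add[symmetric] by (simp add: algebra_simps)
      then show ?thesis by (simp add: u_def pull_def E_def L_def mult.assoc)
    qed
    have "C * (E * (\<beta> * (u * y))) / r = C * \<beta> * (u * E) * y / r" by (simp add: mult_ac)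
    also have "\<dots> = C * \<beta> * \<theta> * r\<^sup>2 * (exp L * exp L) * y / r" unfolding uE by (simp add: mult_ac)
    also have "C * \<beta> * \<theta> = 4 * pi * G * K\<^sup>2 / 3"
    proof -
      have "\<theta> = 4 * pi * G * K\<^sup>2 / (9 * \<kappa> * q)" by (simp add: theta_def q_def)
      then show ?thesis using beta_ne kappa0 q0 by (simp add: C_def stiffness_def)
    qed
    finally show ?thesis unfolding dm using r by (simp add: field_simps eval_nat_numeral)
  qed
  have tension_part: "C * (E * (\<beta> * (X * restoring p) - 3 * \<gamma> * (X - base) * (1 - y))) = 6 * \<kappa> * anisotropy p * E"
  proof -
    have "C * (\<beta> * (X * restoring p) - 3 * \<gamma> * (X - base) * (1 - y)) = 6 * \<kappa> * anisotropy p"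
      unfolding rest anisotropy_def base_def C_def stiffness_def shear1_def shear2_def y_def[symmetric] X_def[symmetric]
      using q0 beta_ne gamma0 by (simp add: divide_simps) (simp add: algebra_simps)
    then show ?thesis by (simp add: mult_ac)
  qed
  have "C * (E * (- \<beta> * X * dp + (X - base) * (\<gamma> * dL)))
      = C * (E * (\<beta> * (X * restoring p) - 3 * \<gamma> * (X - base) * (1 - y))) / r - C * (E * (\<beta> * (u * (X * exp ((\<beta> - 1) * p))))) / r"
    using r by (simp add: dp_def dL_def field_simps)
  also have "\<dots> = 2 / r * (3 * \<kappa> * anisotropy p * E)
      - G * (K * local_density k r) * (4 * pi * (K * (r ^ 3 / 3 * average_density v k r)) / r\<^sup>2)"
    unfolding tension_part Xe gravity_part by simp
  finally show ?thesis using D unfolding F T[symmetric] by (simp only: F)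
qed

section \<open>Existence and uniqueness of balls\<close>

text \<open>An extension would again be strongly regular, hence come from a scaled solution, whose interval cannot
exceed \<open>R_sup\<close>.\<close>

lemma R_sup_maximal:
  assumes s: "scaled_solution R_sup v k"
  shows "maximal_solution G K \<kappa> \<nu> \<gamma> \<beta> R_sup (local_density k) (average_density v k)"
  unfolding maximal_solution_def
proof (intro conjI notI)
  show "regular R_sup (local_density k) (average_density v k)" by (rule scaled_imp_regular[OF s])
  assume "\<exists>R' \<delta>' \<eta>'. R_sup < R' \<and> regular R' \<delta>' \<eta>' \<and>
    (\<forall>r\<in>radii R_sup. \<delta>' r = local_density k r \<and> \<eta>' r = average_density v k r)"
  then obtain R' \<delta>' \<eta>' where R': "R_sup < R'" "regular R' \<delta>' \<eta>'"
    "\<forall>r\<in>radii R_sup. \<delta>' r = local_density k r \<and> \<eta>' r = average_density v k r" by blast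
  have "0 \<in> radii R_sup" using s by (simp add: scaled_solution_def radii_def zero_ereal_def)
  then have "\<delta>' 0 = dc" using R'(3) by (simp add: local_density_def)
  then obtain v' k' where "scaled_solution R' v' k'" using regular_imp_scaled[OF R'(2)] by blast
  then have "R' \<le> R_sup" by (rule scaled_solution_le_R_sup)
  with R'(1) show False by simp
qed

lemma ball_from_surface:
  assumes s: "scaled_solution R v k" and a: "a \<in> radii R" "0 < a"
    and surf: "log_ratio v a = P_b" and below: "\<And>x. x \<in> {0..<a} \<Longrightarrow> log_ratio v x < P_b"
  obtains \<rho> p_rad p_tan where "static_ball G K \<kappa> \<nu> \<gamma> \<beta> a \<rho> p_rad p_tan"
    "truncation K \<kappa> \<nu> \<gamma> \<beta> R (local_density k) (average_density v k) a \<rho> p_rad p_tan" "\<rho> 0 = K * dc"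
proof -
  define cut :: "(real \<Rightarrow> real) \<Rightarrow> real \<Rightarrow> real" where "cut f r = (if r \<le> a then f r else 0)" for f r
  define frad where "frad r = F_rad \<kappa> \<nu> \<gamma> \<beta> (local_density k r) (average_density v k r)" for r
  define ftan where "ftan r = F_tan \<kappa> \<nu> \<gamma> \<beta> (local_density k r) (average_density v k r)" for r
  define rho where "rho r = K * local_density k r" for r
  have sub: "{0..a} \<subseteq> radii R" using radii_down[OF a(1)] by auto
  have rad_pos: "0 < frad r" if "r \<in> {0..<a}" for r
    unfolding frad_def local_density_exp[of k r v] average_density_exp F_rad_exp_pos_iff by (rule below[OF that])
  have rad_a: "frad a = 0"
    unfolding frad_def local_density_exp[of k a v] average_density_exp F_rad_exp_zero_iff by (rule surf)
  have tan_ge: "frad r \<le> ftan r" if "r \<in> {0..a}" for r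
    unfolding frad_def ftan_def using p_tan_ge_p_rad[OF s] sub that by auto
  have flat: "C1_flat (radii R) rho" "C1_flat (radii R) frad" "C1_flat (radii R) ftan"
    using pressures_C1_flat[OF s] by (simp_all add: rho_def[abs_def] frad_def[abs_def] ftan_def[abs_def])
  have pos: "0 < rho r" "0 < frad r" "0 < ftan r" if "r \<in> {0..<a}" for r
    using rad_pos[OF that] tan_ge[of r] that K0 local_density_pos[of k r] by (auto simp: rho_def)
  have fields: "(\<forall>r\<in>{0..<a}. 0 < cut f r) \<and> continuous_on {0..a} (cut f) \<and> C1_within {0..<a} (cut f) \<and>
      (deriv (cut f) \<longlongrightarrow> 0) (at_right 0) \<and> (\<forall>r>a. cut f r = 0)"
    if f: "C1_flat (radii R) f" and p: "\<And>r. r \<in> {0..<a} \<Longrightarrow> 0 < f r" for f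
  proof (intro conjI)
    have "C1_flat {0..<a} f" using f by (rule C1_flat_subset) (use sub in auto)
    then have flat: "C1_flat {0..<a} (cut f)" by (rule C1_flat_cong) (simp add: cut_def)
    then show "C1_within {0..<a} (cut f)" by (rule C1_flat_imp_C1_within)
    show "(deriv (cut f) \<longlongrightarrow> 0) (at_right 0)"
      using C1_flat_deriv_tendsto[of "ereal a" "cut f"] a(2) flat by (simp add: radii_ereal)
    have "continuous_on {0..a} f" using C1_flat_continuous[OF f] sub by (rule continuous_on_subset)
    then show "continuous_on {0..a} (cut f)" by (rule continuous_on_eq) (simp add: cut_def)
  qed (use p in \<open>auto simp: cut_def\<close>)
  have "static_ball G K \<kappa> \<nu> \<gamma> \<beta> a (cut rho) (cut frad) (cut ftan)"
    unfolding static_ball_def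
  proof (intro conjI)
    show "0 < a" by (rule a(2))
    show "\<forall>f\<in>{cut rho, cut frad, cut ftan}. (\<forall>r\<in>{0..<a}. 0 < f r) \<and> continuous_on {0..a} f \<and> C1_within {0..<a} f \<and>
      (deriv f \<longlongrightarrow> 0) (at_right 0) \<and> (\<forall>r>a. f r = 0)"
      using fields[OF flat(1) pos(1)] fields[OF flat(2) pos(2)] fields[OF flat(3) pos(3)] by auto
    show "cut frad 0 = cut ftan 0"
    proof -
      have "anisotropy (log_ratio v 0) = 0" by (simp add: anisotropy_def log_ratio_def)
      then have "frad 0 = ftan 0" unfolding frad_def ftan_def local_density_exp[of k 0 v] average_density_exp F_tan_exp by simp
      then show ?thesis by (simp add: cut_def)
    qed
    show "cut frad a = 0" using rad_a by (simp add: cut_def)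
    show "\<exists>\<delta> \<eta>. \<forall>r\<in>{0..<a}. cut rho r = K * \<delta> r \<and> \<eta> r = mean_density \<delta> r \<and>
        cut frad r = F_rad \<kappa> \<nu> \<gamma> \<beta> (\<delta> r) (\<eta> r) \<and> cut ftan r = F_tan \<kappa> \<nu> \<gamma> \<beta> (\<delta> r) (\<eta> r)"
    proof (intro exI ballI conjI)
      fix r assume r: "r \<in> {0..<a}"
      show "average_density v k r = mean_density (local_density k) r"
      proof (cases "r = 0")
        case True
        then show ?thesis by (simp add: mean_density_def average_density_def local_density_def)
      next
        case False
        then have "r \<in> radii R" "0 < r" using r sub by auto
        then show ?thesis using density_integral[OF s, of r] by (simp add: mean_density_def field_simps)
      qed
    qed (auto simp: cut_def rho_def frad_def ftan_def)
    show "\<forall>r\<in>{0<..<a}. (cut frad has_real_derivative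
        2 / r * (cut ftan r - cut frad r) - G * cut rho r * (mass (cut rho) r / r\<^sup>2)) (at r)"
    proof
      fix r assume r: "r \<in> {0<..<a}"
      then have rR: "r \<in> radii R" "0 < r" using sub by auto
      have "integral {0..r} (\<lambda>s. cut rho s * s\<^sup>2) = integral {0..r} (\<lambda>s. K * (local_density k s * s\<^sup>2))"
        by (rule integral_cong) (use r in \<open>auto simp: cut_def rho_def\<close>)
      also have "\<dots> = K * (r ^ 3 / 3 * average_density v k r)" by (simp add: density_integral[OF s rR])
      finally have m: "mass (cut rho) r / r\<^sup>2 = 4 * pi * (K * (r ^ 3 / 3 * average_density v k r)) / r\<^sup>2"
        unfolding mass_def by (rule arg_cong)
      have c: "cut f r = f r" for f using r by (simp add: cut_def)
      have "(frad has_real_derivative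
        2 / r * (cut ftan r - cut frad r) - G * cut rho r * (mass (cut rho) r / r\<^sup>2)) (at r)"
        unfolding m c using equilibrium[OF s rR] by (simp only: frad_def[abs_def] ftan_def rho_def)
      then show "(cut frad has_real_derivative
        2 / r * (cut ftan r - cut frad r) - G * cut rho r * (mass (cut rho) r / r\<^sup>2)) (at r)"
        by (rule has_field_derivative_transform_within_open[of _ _ _ "{0<..<a}"]) (use r in \<open>auto simp: cut_def\<close>)
    qed
  qed
  moreover have "truncation K \<kappa> \<nu> \<gamma> \<beta> R (local_density k) (average_density v k) a (cut rho) (cut frad) (cut ftan)"
    unfolding truncation_def using a(1) rad_a rad_pos
    by (auto simp: cut_def rho_def frad_def ftan_def less_le)
  moreover have "cut rho 0 = K * dc" using a(2) by (simp add: cut_def rho_def local_density_def)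
  ultimately show ?thesis by (rule that)
qed

lemma ball_exists:
  assumes eps: "0 < \<epsilon>" and rate: "\<And>p. 0 < p \<Longrightarrow> p < P_b \<Longrightarrow> \<epsilon> \<le> 2 - 3 * (2 - \<gamma>) * (1 - exp (- p))"
  obtains R \<rho> p_rad p_tan \<delta> \<eta> where "static_ball G K \<kappa> \<nu> \<gamma> \<beta> R \<rho> p_rad p_tan"
    "maximal_solution G K \<kappa> \<nu> \<gamma> \<beta> R_sup \<delta> \<eta>"
    "truncation K \<kappa> \<nu> \<gamma> \<beta> R_sup \<delta> \<eta> R \<rho> p_rad p_tan" "\<rho> 0 = K * dc"
proof -
  obtain v k where s: "scaled_solution R_sup v k" by (rule maximal_scaled_solution)
  obtain b where b: "b \<in> radii R_sup" "P_b \<le> log_ratio v b"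
    using log_ratio_reaches[OF s P_b_pos eps rate] by blast
  have b0: "0 \<le> b" using radii_ge0[OF b(1)] .
  have "{0..b} \<subseteq> radii R_sup" using radii_down[OF b(1)] by auto
  then have "continuous_on {0..b} v" using s by (auto simp: scaled_solution_def elim: continuous_on_subset)
  then have "continuous_on {0..b} (\<lambda>r. P_b - log_ratio v r)"
    unfolding log_ratio_def by (intro continuous_intros)
  then obtain a where a: "0 < a" "a \<le> b" "P_b - log_ratio v a = 0"
    "\<And>x. x \<in> {0..<a} \<Longrightarrow> 0 < P_b - log_ratio v x"
    using first_zero[of 0 b "\<lambda>r. P_b - log_ratio v r"] P_b_pos b b0 by (auto simp: log_ratio_def)
  have "a \<in> radii R_sup" using radii_down[OF b(1)] a by simp
  then obtain \<rho> p_rad p_tan where "static_ball G K \<kappa> \<nu> \<gamma> \<beta> a \<rho> p_rad p_tan"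
    "truncation K \<kappa> \<nu> \<gamma> \<beta> R_sup (local_density k) (average_density v k) a \<rho> p_rad p_tan" "\<rho> 0 = K * dc"
    using ball_from_surface[OF s, of a] a by auto
  then show ?thesis using that R_sup_maximal[OF s] by blast
qed

lemma truncation_density_at_0:
  assumes "truncation K \<kappa> \<nu> \<gamma> \<beta> Rm \<delta> \<eta> R \<rho> p_rad p_tan" "\<rho> 0 = K * dc"
  shows "\<delta> 0 = dc"
proof -
  have "0 \<in> {0..R}" using assms radii_ge0[of R Rm] by (simp add: truncation_def)
  then have "\<rho> 0 = K * \<delta> 0" using assms(1) unfolding truncation_def by blast
  then show ?thesis using assms(2) K0 by simp
qed

text \<open>The solutions agree on their common interval, and the surface of each ball is the first zero of the
same function, so the radii agree as well.\<close>

lemma truncation_unique: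
  assumes reg: "regular Rm \<delta> \<eta>" and tr: "truncation K \<kappa> \<nu> \<gamma> \<beta> Rm \<delta> \<eta> R \<rho> p_rad p_tan" and c: "\<rho> 0 = K * dc"
    and reg': "regular Rm' \<delta>' \<eta>'" and tr': "truncation K \<kappa> \<nu> \<gamma> \<beta> Rm' \<delta>' \<eta>' R' \<rho>' p_rad' p_tan'" and c': "\<rho>' 0 = K * dc"
    and r: "0 \<le> r"
  shows "\<rho> r = \<rho>' r \<and> p_rad r = p_rad' r \<and> p_tan r = p_tan' r"
proof -
  obtain v k where s: "scaled_solution Rm v k" "\<And>r. r \<in> radii Rm \<Longrightarrow> \<delta> r = local_density k r \<and> \<eta> r = average_density v k r"
    using regular_imp_scaled[OF reg truncation_density_at_0[OF tr c]] by blast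
  obtain v' k' where s': "scaled_solution Rm' v' k'" "\<And>r. r \<in> radii Rm' \<Longrightarrow> \<delta>' r = local_density k' r \<and> \<eta>' r = average_density v' k' r"
    using regular_imp_scaled[OF reg' truncation_density_at_0[OF tr' c']] by blast
  have eq: "\<delta> x = \<delta>' x" "\<eta> x = \<eta>' x" if "x \<in> radii Rm" "x \<in> radii Rm'" for x
    using scaled_solution_unique[OF s(1) s'(1) that] s(2)[OF that(1)] s'(2)[OF that(2)]
    by (simp_all add: local_density_def average_density_def)
  have RR: "R \<in> radii Rm" "R' \<in> radii Rm'" using tr tr' by (auto simp: truncation_def)
  have "\<not> R < R'"
  proof
    assume lt: "R < R'"
    then have "R \<in> radii Rm'" using radii_down[OF RR(2), of R] radii_ge0[OF RR(1)] by simp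
    moreover have "R \<in> {0..<R'}" using lt radii_ge0[OF RR(1)] by simp
    ultimately show False using tr tr' eq[OF RR(1)] unfolding truncation_def by auto
  qed
  moreover have "\<not> R' < R"
  proof
    assume lt: "R' < R"
    then have "R' \<in> radii Rm" using radii_down[OF RR(1), of R'] radii_ge0[OF RR(2)] by simp
    moreover have "R' \<in> {0..<R}" using lt radii_ge0[OF RR(2)] by simp
    ultimately have "F_rad \<kappa> \<nu> \<gamma> \<beta> (\<delta>' R') (\<eta>' R') \<noteq> 0"
      using tr eq[of R'] RR(2) unfolding truncation_def by metis
    then show False using tr' unfolding truncation_def by simp
  qed
  ultimately have R: "R' = R" by simp
  show ?thesis
  proof (cases "r \<le> R")
    case True
    then have "r \<in> radii Rm" "r \<in> radii Rm'" using radii_down[OF RR(1)] radii_down[OF RR(2)] r R by auto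
    then show ?thesis using tr tr' eq[of r] True r R unfolding truncation_def by simp
  next
    case False
    then show ?thesis using tr tr' R unfolding truncation_def by auto
  qed
qed

lemma truncation_pressures:
  assumes reg: "regular Rm \<delta> \<eta>" and tr: "truncation K \<kappa> \<nu> \<gamma> \<beta> Rm \<delta> \<eta> R \<rho> p_rad p_tan" and c: "\<rho> 0 = K * dc"
    and r: "r \<in> {0..R}"
  shows "p_rad r \<le> p_tan r"
proof -
  obtain v k where s: "scaled_solution Rm v k" "\<And>r. r \<in> radii Rm \<Longrightarrow> \<delta> r = local_density k r \<and> \<eta> r = average_density v k r"
    using regular_imp_scaled[OF reg truncation_density_at_0[OF tr c]] by blast
  have "R \<in> radii Rm" using tr by (simp add: truncation_def)
  then have rR: "r \<in> radii Rm" using radii_down r by auto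
  have "p_rad r = F_rad \<kappa> \<nu> \<gamma> \<beta> (\<delta> r) (\<eta> r)" "p_tan r = F_tan \<kappa> \<nu> \<gamma> \<beta> (\<delta> r) (\<eta> r)"
    using tr r by (auto simp: truncation_def)
  then show ?thesis using p_tan_ge_p_rad[OF s(1) rR] s(2)[OF rR] by simp
qed

lemma unique_ballI:
  assumes "P R \<rho> p_rad p_tan"
    and from_regular: "\<And>R \<rho> p_rad p_tan. P R \<rho> p_rad p_tan \<Longrightarrow>
      (\<exists>Rm \<delta> \<eta>. regular Rm \<delta> \<eta> \<and> truncation K \<kappa> \<nu> \<gamma> \<beta> Rm \<delta> \<eta> R \<rho> p_rad p_tan) \<and> \<rho> 0 = K * dc"
  shows "unique_ball P"
proof -
  have "\<rho> r = \<rho>' r \<and> p_rad r = p_rad' r \<and> p_tan r = p_tan' r"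
    if P1: "P R \<rho> p_rad p_tan" and P2: "P R' \<rho>' p_rad' p_tan'" and r: "0 \<le> r" for R \<rho> p_rad p_tan R' \<rho>' p_rad' p_tan' r
  proof -
    obtain Rm \<delta> \<eta> where 1: "regular Rm \<delta> \<eta>" "truncation K \<kappa> \<nu> \<gamma> \<beta> Rm \<delta> \<eta> R \<rho> p_rad p_tan" "\<rho> 0 = K * dc"
      using from_regular[OF P1] by blast
    obtain Rm' \<delta>' \<eta>' where 2: "regular Rm' \<delta>' \<eta>'" "truncation K \<kappa> \<nu> \<gamma> \<beta> Rm' \<delta>' \<eta>' R' \<rho>' p_rad' p_tan'" "\<rho>' 0 = K * dc"
      using from_regular[OF P2] by blast
    show ?thesis by (rule truncation_unique[OF 1 2 r])
  qed
  then show ?thesis using assms(1) unfolding unique_ball_def by blast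
qed

lemma unique_type_A_ball:
  assumes b: "1 < \<beta>" "\<beta> \<le> \<gamma>" and g: "2 < \<gamma>"
  shows "unique_ball (\<lambda>R \<rho> p_rad p_tan. static_ball_type_A G K \<kappa> \<nu> \<gamma> \<beta> R \<rho> p_rad p_tan \<and> \<rho> 0 = K * dc)"
    and "static_ball_type_A G K \<kappa> \<nu> \<gamma> \<beta> R \<rho> p_rad p_tan \<Longrightarrow> \<rho> 0 = K * dc \<Longrightarrow> r \<in> {0..R} \<Longrightarrow> p_rad r \<le> p_tan r"
proof -
  have two: "(0::real) < 2" by simp
  have rate: "2 \<le> 2 - 3 * (2 - \<gamma>) * (1 - exp (- p))" if "0 < p" "p < P_b" for p
  proof -
    have "0 \<le> (\<gamma> - 2) * (1 - exp (- p))" using that g by (intro mult_nonneg_nonneg) auto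
    then show ?thesis by (simp add: algebra_simps)
  qed
  obtain R' \<rho>' p_rad' p_tan' \<delta> \<eta> where "static_ball G K \<kappa> \<nu> \<gamma> \<beta> R' \<rho>' p_rad' p_tan'"
    "maximal_solution G K \<kappa> \<nu> \<gamma> \<beta> R_sup \<delta> \<eta>"
    "truncation K \<kappa> \<nu> \<gamma> \<beta> R_sup \<delta> \<eta> R' \<rho>' p_rad' p_tan'" "\<rho>' 0 = K * dc"
    by (rule ball_exists[OF two rate])
  then have ex: "static_ball_type_A G K \<kappa> \<nu> \<gamma> \<beta> R' \<rho>' p_rad' p_tan' \<and> \<rho>' 0 = K * dc"
    using R_sup_finite[OF b g] unfolding static_ball_type_A_def by blast
  show "unique_ball (\<lambda>R \<rho> p_rad p_tan. static_ball_type_A G K \<kappa> \<nu> \<gamma> \<beta> R \<rho> p_rad p_tan \<and> \<rho> 0 = K * dc)"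
    by (rule unique_ballI[where P = "\<lambda>R \<rho> p_rad p_tan. static_ball_type_A G K \<kappa> \<nu> \<gamma> \<beta> R \<rho> p_rad p_tan \<and> \<rho> 0 = K * dc", OF ex])
      (auto simp: static_ball_type_A_def maximal_solution_def)
  show "static_ball_type_A G K \<kappa> \<nu> \<gamma> \<beta> R \<rho> p_rad p_tan \<Longrightarrow> \<rho> 0 = K * dc \<Longrightarrow> r \<in> {0..R} \<Longrightarrow> p_rad r \<le> p_tan r"
    unfolding static_ball_type_A_def maximal_solution_def using truncation_pressures by blast
qed

lemma unique_type_B_ball:
  assumes b: "\<beta> < 1" and g: "\<gamma> \<le> 1" and y: "(4 - 3 * \<gamma>) / (3 * (2 - \<gamma>)) < y_b \<nu> \<gamma> \<beta>"
  shows "unique_ball (\<lambda>R \<rho> p_rad p_tan. static_ball_type_B G K \<kappa> \<nu> \<gamma> \<beta> R \<rho> p_rad p_tan \<and> \<rho> 0 = K * dc)"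
    and "static_ball_type_B G K \<kappa> \<nu> \<gamma> \<beta> R \<rho> p_rad p_tan \<Longrightarrow> \<rho> 0 = K * dc \<Longrightarrow> r \<in> {0..R} \<Longrightarrow> p_rad r \<le> p_tan r"
proof -
  \<comment> \<open>the growth rate of the pull at the surface; the hypothesis on \<open>y_b\<close> says that it is positive\<close>
  define \<epsilon> where "\<epsilon> = 2 - 3 * (2 - \<gamma>) * (1 - y_b \<nu> \<gamma> \<beta>)"
  have eps: "0 < \<epsilon>" using y g by (simp add: \<epsilon>_def pos_divide_less_eq algebra_simps)
  have rate: "\<epsilon> \<le> 2 - 3 * (2 - \<gamma>) * (1 - exp (- p))" if "0 < p" "p < P_b" for p
  proof -
    have "3 * (2 - \<gamma>) * (1 - exp (- p)) \<le> 3 * (2 - \<gamma>) * (1 - y_b \<nu> \<gamma> \<beta>)"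
      using that g by (intro mult_left_mono) (auto simp: y_b_eq)
    then show ?thesis by (simp add: \<epsilon>_def)
  qed
  obtain R' \<rho>' p_rad' p_tan' \<delta> \<eta> where "static_ball G K \<kappa> \<nu> \<gamma> \<beta> R' \<rho>' p_rad' p_tan'"
    "maximal_solution G K \<kappa> \<nu> \<gamma> \<beta> R_sup \<delta> \<eta>"
    "truncation K \<kappa> \<nu> \<gamma> \<beta> R_sup \<delta> \<eta> R' \<rho>' p_rad' p_tan'" "\<rho>' 0 = K * dc"
    by (rule ball_exists[OF eps rate])
  then have ex: "static_ball_type_B G K \<kappa> \<nu> \<gamma> \<beta> R' \<rho>' p_rad' p_tan' \<and> \<rho>' 0 = K * dc"
    using R_sup_infinite[OF b g] unfolding static_ball_type_B_def by blast
  show "unique_ball (\<lambda>R \<rho> p_rad p_tan. static_ball_type_B G K \<kappa> \<nu> \<gamma> \<beta> R \<rho> p_rad p_tan \<and> \<rho> 0 = K * dc)"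
    by (rule unique_ballI[where P = "\<lambda>R \<rho> p_rad p_tan. static_ball_type_B G K \<kappa> \<nu> \<gamma> \<beta> R \<rho> p_rad p_tan \<and> \<rho> 0 = K * dc", OF ex])
      (auto simp: static_ball_type_B_def maximal_solution_def)
  show "static_ball_type_B G K \<kappa> \<nu> \<gamma> \<beta> R \<rho> p_rad p_tan \<Longrightarrow> \<rho> 0 = K * dc \<Longrightarrow> r \<in> {0..R} \<Longrightarrow> p_rad r \<le> p_tan r"
    unfolding static_ball_type_B_def maximal_solution_def using truncation_pressures by blast
qed

end

theorem theorem1:
  fixes G K \<delta>\<^sub>c \<kappa> \<nu> \<gamma> \<beta> :: real
  assumes "0 < G" and "0 < K" and "0 < \<delta>\<^sub>c" and "0 < \<kappa>"
    and "-1 < \<nu>" and "\<nu> < 1 / 2"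
    and "0 < \<gamma>" and "\<beta> \<noteq> 0" and "\<beta> \<le> 3 * ((1 - \<nu>) / (1 + \<nu>)) * \<gamma>"
  shows "(2 < \<gamma> \<and> 1 < \<beta> \<and> \<beta> \<le> \<gamma> \<longrightarrow>
            unique_ball (\<lambda>R \<rho> p_rad p_tan.
              static_ball_type_A G K \<kappa> \<nu> \<gamma> \<beta> R \<rho> p_rad p_tan \<and> \<rho> 0 = K * \<delta>\<^sub>c) \<and>
            (\<forall>R \<rho> p_rad p_tan.
              static_ball_type_A G K \<kappa> \<nu> \<gamma> \<beta> R \<rho> p_rad p_tan \<and> \<rho> 0 = K * \<delta>\<^sub>c \<longrightarrow>
              (\<forall>r\<in>{0..R}. p_tan r \<ge> p_rad r)))
       \<and> (((0 < \<gamma> \<and> \<gamma> \<le> \<beta> \<and> \<beta> < 1) \<or> (\<beta> < \<gamma> \<and> \<gamma> \<le> 1)) \<and>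
          (4 - 3 * \<gamma>) / (3 * (2 - \<gamma>))
            < (1 - \<beta> / (3 * \<gamma>) * ((1 + \<nu>) / (1 - \<nu>))) powr (1 / \<beta>) \<longrightarrow>
            unique_ball (\<lambda>R \<rho> p_rad p_tan.
              static_ball_type_B G K \<kappa> \<nu> \<gamma> \<beta> R \<rho> p_rad p_tan \<and> \<rho> 0 = K * \<delta>\<^sub>c) \<and>
            (\<forall>R \<rho> p_rad p_tan.
              static_ball_type_B G K \<kappa> \<nu> \<gamma> \<beta> R \<rho> p_rad p_tan \<and> \<rho> 0 = K * \<delta>\<^sub>c \<longrightarrow>
              (\<forall>r\<in>{0..R}. p_tan r \<ge> p_rad r)))"
proof (intro conjI[of "_ \<longrightarrow> _"] impI)
  have ratio: "0 < (1 + \<nu>) / (1 - \<nu>)" "(1 + \<nu>) / (1 - \<nu>) < 3" using assms(5,6) by (auto simp: field_simps)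
  have base_nonneg: "\<beta> / (3 * \<gamma>) * ((1 + \<nu>) / (1 - \<nu>)) \<le> 1"
    using assms(5-7,9) by (simp add: field_simps)
  {
    assume A: "2 < \<gamma> \<and> 1 < \<beta> \<and> \<beta> \<le> \<gamma>"
    \<comment> \<open>\<open>\<nu> < 1 / 2\<close> excludes \<open>y_b = 0\<close> here\<close>
    have "\<beta> / (3 * \<gamma>) * ((1 + \<nu>) / (1 - \<nu>)) \<le> 1 / 3 * ((1 + \<nu>) / (1 - \<nu>))"
      using A ratio by (intro mult_right_mono) auto
    also have "\<dots> < 1" using ratio(2) by linarith
    finally interpret sound_elastic_ball G K \<kappa> \<nu> \<gamma> \<beta> \<delta>\<^sub>c
      by unfold_locales (use assms A in \<open>auto simp: regime_def\<close>)
    from unique_type_A_ball A show "unique_ball (\<lambda>R \<rho> p_rad p_tan.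
              static_ball_type_A G K \<kappa> \<nu> \<gamma> \<beta> R \<rho> p_rad p_tan \<and> \<rho> 0 = K * \<delta>\<^sub>c) \<and>
            (\<forall>R \<rho> p_rad p_tan.
              static_ball_type_A G K \<kappa> \<nu> \<gamma> \<beta> R \<rho> p_rad p_tan \<and> \<rho> 0 = K * \<delta>\<^sub>c \<longrightarrow>
              (\<forall>r\<in>{0..R}. p_tan r \<ge> p_rad r))" by auto
  next
    assume B: "((0 < \<gamma> \<and> \<gamma> \<le> \<beta> \<and> \<beta> < 1) \<or> (\<beta> < \<gamma> \<and> \<gamma> \<le> 1)) \<and>
          (4 - 3 * \<gamma>) / (3 * (2 - \<gamma>))
            < (1 - \<beta> / (3 * \<gamma>) * ((1 + \<nu>) / (1 - \<nu>))) powr (1 / \<beta>)"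
    then have "\<gamma> \<le> 1" "\<beta> < 1" by auto
    \<comment> \<open>the left-hand side of the condition is positive, and \<open>0 powr a = 0\<close>, so the base cannot vanish\<close>
    then have "0 < (4 - 3 * \<gamma>) / (3 * (2 - \<gamma>))" by simp
    with B have "0 < (1 - \<beta> / (3 * \<gamma>) * ((1 + \<nu>) / (1 - \<nu>))) powr (1 / \<beta>)" by linarith
    then have "1 - \<beta> / (3 * \<gamma>) * ((1 + \<nu>) / (1 - \<nu>)) \<noteq> 0" by (metis powr_0 less_irrefl)
    then have "0 < 1 - \<beta> / (3 * \<gamma>) * ((1 + \<nu>) / (1 - \<nu>))" using base_nonneg by linarith
    then interpret sound_elastic_ball G K \<kappa> \<nu> \<gamma> \<beta> \<delta>\<^sub>c
      by unfold_locales (use assms B in \<open>auto simp: regime_def\<close>)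
    from unique_type_B_ball[OF \<open>\<beta> < 1\<close> \<open>\<gamma> \<le> 1\<close>] B show "unique_ball (\<lambda>R \<rho> p_rad p_tan.
              static_ball_type_B G K \<kappa> \<nu> \<gamma> \<beta> R \<rho> p_rad p_tan \<and> \<rho> 0 = K * \<delta>\<^sub>c) \<and>
            (\<forall>R \<rho> p_rad p_tan.
              static_ball_type_B G K \<kappa> \<nu> \<gamma> \<beta> R \<rho> p_rad p_tan \<and> \<rho> 0 = K * \<delta>\<^sub>c \<longrightarrow>
              (\<forall>r\<in>{0..R}. p_tan r \<ge> p_rad r))" unfolding y_b_def by auto
  }
qed

end
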